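(* Let $\Theta=\mathbb{T}^{d_d}$ and $M=\mathbb{T}^{d_p}$, let $\alpha\in\mathbb{R}^{d_d}$ have rationally independent entries, let $\varepsilon>0$, and let $v:\mathbb{T}^{d_d}\times\mathbb{T}^{d_p}\to\mathbb{R}^{d_p}$ be a smooth vector field that is divergence-free in the second variable. Let $\mathbf{G}$ be the augmented generator (generator of the Mather semigroup on $L^2(\mathbb{T}^{d_d}\times\mathbb{T}^{d_p},\mathbb{C})$) described in the context, and let $\mathbf{f}\in\mathcal{D}(\mathbf{G})$. Then for all $(m,n)\in\mathbb{Z}^{d_d}\times\mathbb{Z}^{d_p}$, $$\widehat{\mathbf{G}\mathbf{f}}(m,n)=\sum_{(m',n')\in\mathbb{Z}^{d_d}\times\mathbb{Z}^{d_p}}\Gamma(m,n\,;\,m',n')\,\widehat{\mathbf{f}}(m',n'),$$ where the infinite-dimensional matrix $\Gamma$ is given by $$\Gamma(m,n\,;\,m',n')=\begin{cases}-\frac12\varepsilon^2(2\pi\|n\|_e)^2-2\pi i\big(m\cdot\alpha+n\cdot\widehat{v}(0,0)\big), & (m,n)=(m',n'),\\[2pt] -2\pi i\,\big(n\cdot\widehat{v}(m-m',n-n')\big), & (m,n)\ne(m',n').\end{cases}$$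
   Context: $\mathbb{T}^k=\mathbb{R}^k/\mathbb{Z}^k$; $\|\cdot\|_e$ is the Euclidean norm. Fourier modes: $F_{m,n}(\theta,x)=e^{2\pi i(\theta\cdot m+x\cdot n)}$, and $\widehat{\mathbf{f}}(m,n)=\int_{\mathbb{T}^{d_d}}\int_{\mathbb{T}^{d_p}}e^{-2\pi i(\theta\cdot m+x\cdot n)}\mathbf{f}(\theta,x)\,dx\,d\theta$. For the vector field $v$, $\widehat{v}(m,n)\in\mathbb{C}^{d_p}$ is the vector of Fourier coefficients of its components. Augmented generator: let $\phi^t\theta=\theta+t\alpha$. For $\theta\in\Theta$ let $\mathcal{P}_\theta^t$ be the solution operator on $L^2(\mathbb{T}^{d_p},\mathbb{C})$, taking $f_0$ to $f(t)$, of the Fokker--Planck equation $\partial_tf(t)=\tfrac12\varepsilon^2\Delta_xf(t)-\nabla_xf(t)\cdot v(\phi^t\theta,\cdot)$, $f(0)=f_0$. On $\mathfrak{F}=L^2(\Theta,L^2(M,\mathbb{C}))\cong L^2(\mathbb{T}^{d_d}\times\mathbb{T}^{d_p},\mathbb{C})$ (Lebesgue measure) the Mather semigroup is $[\mathbf{M}^t\mathbf{f}](\theta)=\mathcal{P}_{\phi^{-t}\theta}^t\mathbf{f}(\phi^{-t}\theta)$, a strongly continuous semigroup. Its generator $\mathbf{G}$, with domain $\mathcal{D}(\mathbf{G})$, acts (derivatives in the weak sense) by $$[\mathbf{G}\mathbf{f}](\theta,x)=\tfrac12\varepsilon^2\Delta_x\mathbf{f}(\theta,x)-\nabla_x\mathbf{f}(\theta,x)\cdot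 v(\theta,x)-\partial_\theta\mathbf{f}(\theta,x)\cdot\alpha .$$ *)

theory Defs
  imports "HOL-Analysis.Analysis"
begin

section \<open>Functions on the torus\<close>

text \<open>
  Functions on the torus are functions on the covering Euclidean space that are invariant under
  the lattice spanned by the orthonormal basis. For \<^typ>\<open>real^'k\<close> this is the torus of dimension
  \<open>CARD('k)\<close>; for \<^typ>\<open>(real^'d) \<times> (real^'p)\<close> it is the product of the two tori. Integration over
  the torus is Lebesgue integration over the closed unit cube (whose faces overlap only in a null
  set).
\<close>

definition torus_periodic :: "('a::euclidean_space \<Rightarrow> 'b) \<Rightarrow> bool" where
  "torus_periodic f \<longleftrightarrow> (\<forall>x. \<forall>b\<in>Basis. f (x + b) = f x)"

definition torus :: "'a::euclidean_space measure" where
  "torus = restrict_space lborel (cbox 0 One)"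

text \<open>
  Elements of the space of square-integrable functions are represented by Borel functions;
  equality in that space is equality almost everywhere. Since \<^const>\<open>lebesgue_integral\<close> is 0 on
  non-integrable functions, \<open>L2norm\<close> is meaningful only on \<open>torus_L2\<close>.
\<close>

definition torus_L2 :: "('a::euclidean_space \<Rightarrow> complex) set" where
  "torus_L2 = {f. torus_periodic f \<and> f \<in> borel_measurable borel \<and>
                  integrable torus (\<lambda>x. (norm (f x))\<^sup>2)}"

definition L2norm :: "('a::euclidean_space \<Rightarrow> complex) \<Rightarrow> real" where
  "L2norm f = sqrt (\<integral>x. (norm (f x))\<^sup>2 \<partial>torus)"

primrec Ck :: "nat \<Rightarrow> ('a::real_normed_vector \<Rightarrow> 'b::real_normed_vector) \<Rightarrow> bool" where
  "Ck 0 f \<longleftrightarrow> continuous_on UNIV f"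
| "Ck (Suc k) f \<longleftrightarrow>
     f differentiable_on UNIV \<and> (\<forall>h. Ck k (\<lambda>x. frechet_derivative f (at x) h))"

definition smooth :: "('a::real_normed_vector \<Rightarrow> 'b::real_normed_vector) \<Rightarrow> bool" where
  "smooth f \<longleftrightarrow> (\<forall>k. Ck k f)"

section \<open>Fourier coefficients\<close>

definition of_int_vec :: "int^'k \<Rightarrow> real^'k" where
  "of_int_vec m = (\<chi> i. of_int (m $ i))"

definition fourier_coeff ::
    "((real^'d) \<times> (real^'p) \<Rightarrow> complex) \<Rightarrow> int^'d \<Rightarrow> int^'p \<Rightarrow> complex" where
  "fourier_coeff f m n =
     (\<integral>\<theta>. (\<integral>x. exp (- (2 * of_real pi * \<i> *
                          of_real (\<theta> \<bullet> of_int_vec m + x \<bullet> of_int_vec n))) * f (\<theta>, x)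
            \<partial>torus) \<partial>torus)"

definition fourier_coeff_vec ::
    "((real^'d) \<times> (real^'p) \<Rightarrow> real^'p) \<Rightarrow> int^'d \<Rightarrow> int^'p \<Rightarrow> complex^'p" where
  "fourier_coeff_vec v m n = (\<chi> i. fourier_coeff (\<lambda>z. of_real (v z $ i)) m n)"

section \<open>Driving and velocity field\<close>

definition rationally_independent :: "real^'d \<Rightarrow> bool" where
  "rationally_independent \<alpha> \<longleftrightarrow>
     (\<forall>q :: 'd \<Rightarrow> rat. (\<Sum>i\<in>UNIV. of_rat (q i) * \<alpha> $ i) = 0 \<longrightarrow> (\<forall>i. q i = 0))"

definition divergence_free_snd :: "((real^'d) \<times> (real^'p) \<Rightarrow> real^'p) \<Rightarrow> bool" where
  "divergence_free_snd v \<longleftrightarrow>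
     (\<forall>\<theta> x. (\<Sum>i\<in>UNIV. frechet_derivative (\<lambda>y. v (\<theta>, y)) (at x) (axis i 1) $ i) = 0)"

section \<open>The Fokker--Planck equation\<close>

text \<open>\<open>g\<close> is the weak derivative of \<open>f\<close> in direction \<open>b\<close>, as a function on the torus.\<close>

definition weak_deriv ::
    "'a::euclidean_space \<Rightarrow> ('a \<Rightarrow> complex) \<Rightarrow> ('a \<Rightarrow> complex) \<Rightarrow> bool" where
  "weak_deriv b f g \<longleftrightarrow> f \<in> torus_L2 \<and> g \<in> torus_L2 \<and>
     (\<forall>\<phi> :: 'a \<Rightarrow> complex. smooth \<phi> \<and> torus_periodic \<phi> \<longrightarrow>
        (\<integral>x. f x * frechet_derivative \<phi> (at x) b \<partial>torus) = - (\<integral>x. g x * \<phi> x \<partial>torus))"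

text \<open>\<open>r = \<onehalf> \<epsilon>\<^sup>2 \<Delta>f - \<nabla>f \<cdot> w\<close>; here \<open>D i\<close> is the \<open>i\<close>-th entry of \<open>\<nabla>f\<close> and \<open>\<Delta>f\<close> is the sum of
  the \<open>D2 i\<close>.\<close>

definition fokker_planck_rhs ::
    "real \<Rightarrow> (real^'p \<Rightarrow> real^'p) \<Rightarrow> (real^'p \<Rightarrow> complex) \<Rightarrow> (real^'p \<Rightarrow> complex) \<Rightarrow> bool" where
  "fokker_planck_rhs \<epsilon> w f r \<longleftrightarrow> r \<in> torus_L2 \<and>
     (\<exists>D D2. (\<forall>i. weak_deriv (axis i 1) f (D i)) \<and>
             (\<forall>i. weak_deriv (axis i 1) (D i) (D2 i)) \<and>
             (AE x in torus. r x = of_real (1/2 * \<epsilon>\<^sup>2) * (\<Sum>i\<in>UNIV. D2 i x)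
                                    - (\<Sum>i\<in>UNIV. D i x * of_real (w x $ i))))"

text \<open>
  \<open>u\<close> solves the initial value problem with driving state \<open>\<theta>\<close> and initial value \<open>f0\<close>: it is a
  continuous curve in the square-integrable functions for \<open>t \<ge> 0\<close> which starts at \<open>f0\<close>, is
  differentiable in the norm for \<open>t > 0\<close>, and whose derivative there is the right-hand side of the
  equation. (Differentiability at \<open>t = 0\<close> would fail for general \<open>f0\<close>.)
\<close>

definition fokker_planck_solution ::
    "real \<Rightarrow> real^'d \<Rightarrow> ((real^'d) \<times> (real^'p) \<Rightarrow> real^'p) \<Rightarrow>
     real^'d \<Rightarrow> (real^'p \<Rightarrow> complex) \<Rightarrow> (real \<Rightarrow> real^'p \<Rightarrow> complex) \<Rightarrow> bool" where
  "fokker_planck_solution \<epsilon> \<alpha> v \<theta> f0 u \<longleftrightarrow>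
     (\<forall>t\<ge>0. u t \<in> torus_L2) \<and>
     (AE x in torus. u 0 x = f0 x) \<and>
     (\<forall>t\<ge>0. ((\<lambda>s. L2norm (\<lambda>x. u s x - u t x)) \<longlongrightarrow> 0) (at t within {0..})) \<and>
     (\<forall>t>0. \<exists>r. fokker_planck_rhs \<epsilon> (\<lambda>x. v (\<theta> + t *\<^sub>R \<alpha>, x)) (u t) r \<and>
        ((\<lambda>s. L2norm (\<lambda>x. (u s x - u t x) / of_real (s - t) - r x)) \<longlongrightarrow> 0) (at t))"

text \<open>
  \<open>P \<theta> t f0\<close> is the value at time \<open>t\<close> of the solution started at \<open>f0\<close>. The first conjunct says
  that \<open>\<theta>\<close> is a point of the torus.
\<close>

definition solution_operator ::
    "real \<Rightarrow> real^'d \<Rightarrow> ((real^'d) \<times> (real^'p) \<Rightarrow> real^'p) \<Rightarrow>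
     (real^'d \<Rightarrow> real \<Rightarrow> (real^'p \<Rightarrow> complex) \<Rightarrow> (real^'p \<Rightarrow> complex)) \<Rightarrow> bool" where
  "solution_operator \<epsilon> \<alpha> v P \<longleftrightarrow> torus_periodic P \<and>
     (\<forall>\<theta>. \<forall>f0\<in>torus_L2. fokker_planck_solution \<epsilon> \<alpha> v \<theta> f0 (\<lambda>t. P \<theta> t f0))"

section \<open>The Mather semigroup and its generator\<close>

text \<open>
  \<open>g\<close> represents \<open>M\<^sup>t f\<close>. This is a relation because the functions \<open>P \<theta> t f0\<close> are determined only
  up to null sets, separately for each \<open>\<theta>\<close>: putting arbitrary representatives together need not
  give a jointly measurable function. Requiring \<open>g \<in> torus_L2\<close> and equality for almost every \<open>\<theta>\<close>
  is the identification of \<open>L\<^sup>2(\<Theta>, L\<^sup>2(M))\<close> with \<open>L\<^sup>2(\<Theta> \<times> M)\<close>.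
\<close>

definition mather ::
    "(real^'d \<Rightarrow> real \<Rightarrow> (real^'p \<Rightarrow> complex) \<Rightarrow> (real^'p \<Rightarrow> complex)) \<Rightarrow> real^'d \<Rightarrow> real \<Rightarrow>
     ((real^'d) \<times> (real^'p) \<Rightarrow> complex) \<Rightarrow> ((real^'d) \<times> (real^'p) \<Rightarrow> complex) \<Rightarrow> bool" where
  "mather P \<alpha> t f g \<longleftrightarrow> f \<in> torus_L2 \<and> g \<in> torus_L2 \<and>
     (AE \<theta> in torus. AE x in torus.
        g (\<theta>, x) = P (\<theta> - t *\<^sub>R \<alpha>) t (\<lambda>y. f (\<theta> - t *\<^sub>R \<alpha>, y)) x)"

text \<open>\<open>g\<close> is the norm limit of \<open>(M\<^sup>t f - f) / t\<close> as \<open>t\<close> decreases to 0.\<close>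

definition generator_limit ::
    "(real^'d \<Rightarrow> real \<Rightarrow> (real^'p \<Rightarrow> complex) \<Rightarrow> (real^'p \<Rightarrow> complex)) \<Rightarrow> real^'d \<Rightarrow>
     ((real^'d) \<times> (real^'p) \<Rightarrow> complex) \<Rightarrow> ((real^'d) \<times> (real^'p) \<Rightarrow> complex) \<Rightarrow> bool" where
  "generator_limit P \<alpha> f g \<longleftrightarrow> f \<in> torus_L2 \<and> g \<in> torus_L2 \<and>
     (\<exists>u. (\<forall>t>0. mather P \<alpha> t f (u t)) \<and>
          ((\<lambda>t. L2norm (\<lambda>z. (u t z - f z) / of_real t - g z)) \<longlongrightarrow> 0) (at_right 0))"

definition generator_domain ::
    "(real^'d \<Rightarrow> real \<Rightarrow> (real^'p \<Rightarrow> complex) \<Rightarrow> (real^'p \<Rightarrow> complex)) \<Rightarrow> real^'d \<Rightarrow>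
     ((real^'d) \<times> (real^'p) \<Rightarrow> complex) set" where
  "generator_domain P \<alpha> = {f. \<exists>g. generator_limit P \<alpha> f g}"

text \<open>The limit is unique up to null sets; the choice picks a representative.\<close>

definition generator ::
    "(real^'d \<Rightarrow> real \<Rightarrow> (real^'p \<Rightarrow> complex) \<Rightarrow> (real^'p \<Rightarrow> complex)) \<Rightarrow> real^'d \<Rightarrow>
     ((real^'d) \<times> (real^'p) \<Rightarrow> complex) \<Rightarrow> ((real^'d) \<times> (real^'p) \<Rightarrow> complex)" where
  "generator P \<alpha> f = (SOME g. generator_limit P \<alpha> f g)"

section \<open>The generator matrix\<close>

text \<open>\<open>n \<cdot> z\<close> for an integer vector \<open>n\<close> and a complex vector \<open>z\<close>, bilinear (no conjugation).\<close>

definition int_dot :: "int^'k \<Rightarrow> complex^'k \<Rightarrow> complex" where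
  "int_dot n z = (\<Sum>i\<in>UNIV. of_int (n $ i) * z $ i)"

definition Gamma_matrix ::
    "real \<Rightarrow> real^'d \<Rightarrow> ((real^'d) \<times> (real^'p) \<Rightarrow> real^'p) \<Rightarrow>
     (int^'d) \<times> (int^'p) \<Rightarrow> (int^'d) \<times> (int^'p) \<Rightarrow> complex" where
  "Gamma_matrix \<epsilon> \<alpha> v = (\<lambda>(m, n) (m', n').
     if (m, n) = (m', n') then
       - of_real (1/2 * \<epsilon>\<^sup>2 * (2 * pi * norm (of_int_vec n))\<^sup>2)
       - 2 * of_real pi * \<i> *
           (of_real (of_int_vec m \<bullet> \<alpha>) + int_dot n (fourier_coeff_vec v 0 0))
     else
       - 2 * of_real pi * \<i> * int_dot n (fourier_coeff_vec v (m - m') (n - n')))"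

end

theory Submission
  imports Defs
begin

text \<open>
  The weak form of the Fokker--Planck equation turns the Fourier coefficients of a solution on a
  single fibre into a differential equation whose right-hand side makes sense for every
  square-integrable function. Parseval's identity shows that the equation is dissipative, so the
  difference quotients of these coefficients at time \<open>0\<close> are dominated by a multiple of the norm of
  the initial value. Dominated convergence in \<open>\<theta>\<close>, after translating by \<open>t \<alpha>\<close> on the driving
  torus, then gives the Fourier coefficients of the generator, with the drift appearing as
  coefficients of the products \<open>f v\<^sub>i\<close>. Parseval expands these products into the convolution sums
  of the matrix \<open>\<Gamma>\<close>.
\<close>

section \<open>The lattice and translation invariance\<close>

text \<open>The obstacle is that the data are known only up to null sets and only for positive
  times. The functions \<open>P \<theta> t f0\<close> are representatives chosen separately for each
  \<open>\<theta>\<close>, so nothing is integrated in \<open>\<theta>\<close> before it has been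
  replaced by the Borel function \<open>u t\<close> of the relation \<open>mather\<close>. A slice
  of \<open>f\<close> is merely square-integrable, so its solution need not be differentiable at
  time \<open>0\<close>. Both difficulties are met by following one Fourier coefficient at a time:
  its derivative has a limit as time decreases to \<open>0\<close>, and it is bounded by the norm of
  the slice with a constant that depends on neither time nor \<open>\<theta>\<close>. Functions,
  lattice and characters live on an arbitrary Euclidean space, and frequencies are vectors of that
  same space, so that the same lemmas serve for the driving torus, the fibre and their product.
  Integer vectors come back only at the end, by reindexing.\<close>

definition lattice_point :: "'a::euclidean_space \<Rightarrow> bool" where
  "lattice_point k \<longleftrightarrow> (\<forall>b\<in>Basis. k \<bullet> b \<in> \<int>)"

definition floor_point :: "'a::euclidean_space \<Rightarrow> 'a" where
  "floor_point x = (\<Sum>b\<in>Basis. of_int \<lfloor>x \<bullet> b\<rfloor> *\<^sub>R b)"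

text \<open>The half-open cube, an exact fundamental domain of the lattice. The closed cube behind
  \<open>torus\<close> meets its own translates in faces, so tiling arguments are run with this set
  instead.\<close>

definition unit_cell :: "'a::euclidean_space set" where
  "unit_cell = {x. floor_point x = 0}"

lemma inner_floor_point: "b \<in> Basis \<Longrightarrow> floor_point x \<bullet> b = of_int \<lfloor>x \<bullet> b\<rfloor>"
  by (simp add: floor_point_def inner_sum_left inner_Basis if_distrib sum.delta' cong: if_cong)

lemma lattice_point_floor: "lattice_point (floor_point x)"
  by (simp add: lattice_point_def inner_floor_point)

lemma lattice_point_minus: "lattice_point k \<Longrightarrow> lattice_point (- k)"
  by (simp add: lattice_point_def)

lemma lattice_point_add: "lattice_point k \<Longrightarrow> lattice_point l \<Longrightarrow> lattice_point (k + l)"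
  by (simp add: lattice_point_def inner_add_left)

lemma lattice_point_diff: "lattice_point k \<Longrightarrow> lattice_point l \<Longrightarrow> lattice_point (k - l)"
  by (simp add: lattice_point_def inner_diff_left)

lemma lattice_point_0: "lattice_point 0"
  by (simp add: lattice_point_def)

lemma lattice_point_Basis: "b \<in> Basis \<Longrightarrow> lattice_point b"
  by (simp add: lattice_point_def inner_Basis)

lemma mem_unit_cell: "x \<in> unit_cell \<longleftrightarrow> (\<forall>b\<in>Basis. 0 \<le> x \<bullet> b \<and> x \<bullet> b < 1)"
proof -
  have "x \<in> unit_cell \<longleftrightarrow> (\<forall>b\<in>Basis. \<lfloor>x \<bullet> b\<rfloor> = 0)"
    by (auto simp: unit_cell_def euclidean_eq_iff[where 'a='a] inner_floor_point)
  then show ?thesis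
    by (simp add: floor_eq_iff)
qed

text \<open>The tiling property: each point lies in exactly one lattice translate of the cell. This
  is what makes the sums of cell indicators over the lattice equal to 1.\<close>

lemma diff_mem_unit_cell:
  assumes "lattice_point k" shows "x - k \<in> unit_cell \<longleftrightarrow> k = floor_point x"
proof -
  have "x \<bullet> b - k \<bullet> b \<ge> 0 \<and> x \<bullet> b - k \<bullet> b < 1 \<longleftrightarrow> k \<bullet> b = of_int \<lfloor>x \<bullet> b\<rfloor>" if "b \<in> Basis" for b
  proof -
    obtain i where i: "k \<bullet> b = of_int i"
      using assms \<open>b \<in> Basis\<close> by (auto simp: lattice_point_def elim!: Ints_cases)
    show ?thesis unfolding i of_int_eq_iff by linarith
  qed
  then show ?thesis
    by (auto simp: mem_unit_cell inner_diff_left euclidean_eq_iff[where 'a='a] inner_floor_point)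
qed

lemma countable_lattice: "countable {k::'a::euclidean_space. lattice_point k}"
proof -
  have "{k::'a. lattice_point k} \<subseteq> (\<lambda>h. \<Sum>b\<in>Basis. of_int (h b) *\<^sub>R b) ` (Basis \<rightarrow>\<^sub>E (UNIV::int set))"
  proof
    fix k :: 'a assume "k \<in> {k. lattice_point k}"
    then have "k \<bullet> b = of_int \<lfloor>k \<bullet> b\<rfloor>" if "b \<in> Basis" for b
      using that by (auto simp: lattice_point_def of_int_floor)
    then have "k = (\<Sum>b\<in>Basis. of_int (restrict (\<lambda>b. \<lfloor>k \<bullet> b\<rfloor>) Basis b) *\<^sub>R b)"
      by (subst euclidean_representation[symmetric, of k]) (rule sum.cong; simp)
    then show "k \<in> (\<lambda>h. \<Sum>b\<in>Basis. of_int (h b) *\<^sub>R b) ` (Basis \<rightarrow>\<^sub>E (UNIV::int set))"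
      by (rule image_eqI[where x = "restrict (\<lambda>b. \<lfloor>k \<bullet> b\<rfloor>) Basis"]) (auto simp: PiE_def)
  qed
  moreover have "countable (Basis \<rightarrow>\<^sub>E (UNIV::int set) :: ('a \<Rightarrow> int) set)"
    by (intro countable_PiE) auto
  ultimately show ?thesis
    by (meson countable_image countable_subset)
qed

lemma unit_cell_sets [measurable]: "unit_cell \<in> sets borel"
proof -
  have "unit_cell = (\<Inter>b\<in>(Basis::'a set). {x. 0 \<le> x \<bullet> b \<and> x \<bullet> b < 1})"
    by (auto simp: mem_unit_cell)
  also have "\<dots> \<in> sets borel"
    by (intro sets.finite_INT) (auto simp: nonempty_Basis)
  finally show ?thesis .
qed

text \<open>The definition gives invariance under adding one basis vector. It is iterated to natural
  multiples, then to integer multiples, then to sums over subsets of the basis.\<close>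

lemma torus_periodic_lattice:
  assumes f: "torus_periodic f" and k: "lattice_point k"
  shows "f (x + k) = f x"
proof -
  have nat: "f (x + real n *\<^sub>R b) = f x" if "b \<in> Basis" for x b n
  proof (induction n)
    case (Suc n)
    have "x + real (Suc n) *\<^sub>R b = (x + real n *\<^sub>R b) + b" by (simp add: algebra_simps)
    then show ?case using f that Suc by (simp only: torus_periodic_def)
  qed simp
  have int: "f (x + of_int i *\<^sub>R b) = f x" if "b \<in> Basis" for x b i
  proof (cases "i \<ge> 0")
    case True then show ?thesis using nat[OF that, of x "nat i"] by simp
  next
    case False
    \<comment> \<open>For negative \<open>i\<close> the translated point serves as the base point,
      and adding \<open>- i\<close> copies of \<open>b\<close> leads back to
      \<open>x\<close>.\<close>
    then show ?thesis using nat[OF that, of "x + of_int i *\<^sub>R b" "nat (- i)"] by simp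
  qed
  have "f (x + (\<Sum>b\<in>B. (k \<bullet> b) *\<^sub>R b)) = f x" if "B \<subseteq> Basis" for B
  proof -
    have "finite B" using that finite_Basis finite_subset by blast
    then show ?thesis using that
    proof (induction B)
      case (insert b B)
      obtain i where "k \<bullet> b = of_int i"
        using k insert.prems by (auto simp: lattice_point_def elim!: Ints_cases)
      then show ?case
        using insert int[of b "x + (\<Sum>b\<in>B. (k \<bullet> b) *\<^sub>R b)" i] by (simp add: add_ac)
    qed simp
  qed
  from this[of Basis] show ?thesis by (simp add: euclidean_representation)
qed

lemma torus_periodic_shift: "torus_periodic f \<Longrightarrow> torus_periodic (\<lambda>x. f (x + s))"
  unfolding torus_periodic_def by (metis add.assoc add.commute)

lemma One_inner_Basis: "b \<in> Basis \<Longrightarrow> One \<bullet> b = (1::real)"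
  by (simp add: inner_sum_left inner_Basis if_distrib sum.delta' cong: if_cong)

section \<open>Closed cube, half-open cell and whole space up to null sets\<close>

lemma AE_lborel_not_negligible:
  assumes "negligible Z" shows "AE x in lborel. x \<notin> Z"
proof -
  have "AE x in lebesgue. x \<notin> Z"
    using assms by (simp add: negligible_iff_null_sets AE_not_in)
  then show ?thesis
    by (simp add: AE_completion_iff)
qed

text \<open>The two sets differ only on the frontier of the cube, and the frontier of a convex set
  is negligible.\<close>

lemma AE_cube_unit_cell: "AE x in lborel. x \<in> cbox 0 One \<longleftrightarrow> x \<in> (unit_cell :: 'a::euclidean_space set)"
proof -
  have "negligible (frontier (cbox (0::'a) One))"
    by (rule negligible_convex_frontier) simp
  then have "AE x in lborel. x \<notin> frontier (cbox (0::'a) One)"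
    by (rule AE_lborel_not_negligible)
  then show ?thesis
  proof (eventually_elim, goal_cases)
    case (1 x)
    have "x \<in> box 0 One \<longleftrightarrow> x \<in> cbox 0 One"
      using 1 closure_Un_frontier[of "cbox (0::'a) One"] box_subset_cbox[of 0 One]
      by (auto simp: frontier_def interior_cbox)
    then show ?case
      by (force simp: mem_unit_cell mem_box One_inner_Basis less_imp_le)
  qed
qed

lemma space_torus: "space torus = cbox 0 One"
  by (simp add: torus_def space_restrict_space)

lemma measurable_torus: "f \<in> borel_measurable borel \<Longrightarrow> f \<in> borel_measurable torus"
  unfolding torus_def by (rule measurable_restrict_space1) simp

lemma nn_integral_torus: "(\<integral>\<^sup>+x. f x \<partial>torus) = (\<integral>\<^sup>+x. f x * indicator unit_cell x \<partial>lborel)"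
proof -
  have "(\<integral>\<^sup>+x. f x \<partial>torus) = (\<integral>\<^sup>+x. f x * indicator (cbox 0 One) x \<partial>lborel)"
    unfolding torus_def by (rule nn_integral_restrict_space) simp
  also have "\<dots> = (\<integral>\<^sup>+x. f x * indicator unit_cell x \<partial>lborel)"
    by (rule nn_integral_cong_AE) (use AE_cube_unit_cell in eventually_elim, auto simp: indicator_def)
  finally show ?thesis .
qed

lemma AE_torus_iff: "(AE x in torus. Q x) \<longleftrightarrow> (AE x in lborel. x \<in> cbox 0 One \<longrightarrow> Q x)"
  unfolding torus_def by (rule AE_restrict_space_iff) simp

lemma AE_lborel_translation:
  fixes Q :: "'a::euclidean_space \<Rightarrow> bool"
  assumes "AE x in lborel. Q x" shows "AE x in lborel. Q (x + s)"
proof -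
  have "AE x in distr lborel borel ((+) s). Q x"
    using assms by (subst lborel_distr_plus)
  then have "AE x in lborel. Q (s + x)"
    by (auto dest: AE_distrD[rotated])
  then show ?thesis by (simp add: add.commute)
qed

text \<open>If a periodic property fails only on a null part of the cell, its exceptional set in the
  whole space is covered by the lattice translates of that part, of which there are countably
  many.\<close>

lemma AE_torus_periodic_iff:
  fixes Q :: "'a::euclidean_space \<Rightarrow> bool"
  assumes per: "torus_periodic Q"
  shows "(AE x in torus. Q x) \<longleftrightarrow> (AE x in lborel. Q x)"
proof
  assume "AE x in torus. Q x"
  then have *: "AE x in lborel. x \<in> unit_cell \<longrightarrow> Q x"
    unfolding AE_torus_iff using AE_cube_unit_cell by eventually_elim auto
  have "AE x in lborel. \<forall>k\<in>{k. lattice_point k}. x + - k \<in> unit_cell \<longrightarrow> Q (x + - k)"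
    using AE_lborel_translation[OF *] countable_lattice by (subst AE_ball_countable) blast+
  then show "AE x in lborel. Q x"
  proof eventually_elim
    case (elim x)
    have "x + - floor_point x \<in> unit_cell"
      using diff_mem_unit_cell[OF lattice_point_floor, of x x] by simp
    then have "Q (x + - floor_point x)"
      using elim lattice_point_floor by blast
    then show ?case
      using torus_periodic_lattice[OF per lattice_point_minus[OF lattice_point_floor]] by simp
  qed
qed (auto simp: AE_torus_iff)

lemma AE_torus_shift:
  assumes "torus_periodic Q" and "AE x in torus. Q x"
  shows "AE x in torus. Q (x + s)"
  using assms AE_lborel_translation[of Q s] torus_periodic_shift[of Q s]
  by (simp add: AE_torus_periodic_iff)

lemma floor_point_measurable [measurable]: "floor_point \<in> borel_measurable borel"
  unfolding floor_point_def by measurable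

lemma sum_lattice_unit_cell:
  "(\<integral>\<^sup>+k. indicator unit_cell (x - k) \<partial>count_space {k. lattice_point k}) = 1"
proof -
  have "(\<integral>\<^sup>+k. indicator unit_cell (x - k) \<partial>count_space {k. lattice_point k})
      = (\<integral>\<^sup>+k. indicator {floor_point x} k \<partial>count_space {k. lattice_point k})"
    by (intro nn_integral_cong) (auto simp: indicator_def diff_mem_unit_cell)
  also have "\<dots> = 1"
    by (simp add: lattice_point_floor)
  finally show ?thesis .
qed

lemma sum_lattice_unit_cell':
  "(\<integral>\<^sup>+k. indicator unit_cell (x + k) \<partial>count_space {k. lattice_point k}) = 1"
proof -
  have eq: "x + k \<in> unit_cell \<longleftrightarrow> k = - floor_point x" if "lattice_point k" for k
    using diff_mem_unit_cell[OF lattice_point_minus[OF that], of x]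
    by (metis add.inverse_inverse diff_minus_eq_add)
  have "(\<integral>\<^sup>+k. indicator unit_cell (x + k) \<partial>count_space {k. lattice_point k})
      = (\<integral>\<^sup>+k. indicator {- floor_point x} k \<partial>count_space {k. lattice_point k})"
    by (intro nn_integral_cong) (auto simp: indicator_def eq)
  also have "\<dots> = 1"
    by (simp add: lattice_point_floor lattice_point_minus)
  finally show ?thesis .
qed

text \<open>Both sides equal the integral of \<open>F\<close> over the whole space against
  \<open>\<Sum>\<^sub>k 1(x - s \<in> cell) 1(x - k \<in> cell)\<close>, the sum ranging over the lattice.\<close>

lemma nn_integral_torus_shift:
  fixes F :: "'a::euclidean_space \<Rightarrow> ennreal"
  assumes per: "torus_periodic F" and [measurable]: "F \<in> borel_measurable borel"
  shows "(\<integral>\<^sup>+x. F (x + s) \<partial>torus) = (\<integral>\<^sup>+x. F x \<partial>torus)"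
proof -
  let ?L = "{k::'a. lattice_point k}"
  let ?C = "unit_cell :: 'a set"
  have "(\<integral>\<^sup>+x. F (x + s) \<partial>torus) = (\<integral>\<^sup>+x. F (s + x) * indicator ?C ((s + x) - s) \<partial>lborel)"
    by (simp add: nn_integral_torus add.commute)
  also have "\<dots> = (\<integral>\<^sup>+x. F x * indicator ?C (x - s) \<partial>lborel)"
    by (subst (2) lborel_distr_plus[symmetric, of s]) (simp add: nn_integral_distr)
  also have "\<dots> = (\<integral>\<^sup>+x. (\<integral>\<^sup>+k. F x * indicator ?C (x - s) * indicator ?C (x - k) \<partial>count_space ?L) \<partial>lborel)"
    by (simp add: nn_integral_cmult sum_lattice_unit_cell)
  also have "\<dots> = (\<integral>\<^sup>+k. (\<integral>\<^sup>+x. F x * indicator ?C (x - s) * indicator ?C (x - k) \<partial>lborel) \<partial>count_space ?L)"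
    by (intro nn_integral_count_space_nn_integral countable_lattice) measurable
  also have "\<dots> = (\<integral>\<^sup>+k. (\<integral>\<^sup>+x. F x * indicator ?C (x + k - s) * indicator ?C x \<partial>lborel) \<partial>count_space ?L)"
  proof (rule nn_integral_cong)
    fix k assume "k \<in> space (count_space ?L)"
    then have k: "lattice_point k" by simp
    have "(\<integral>\<^sup>+x. F x * indicator ?C (x - s) * indicator ?C (x - k) \<partial>lborel)
        = (\<integral>\<^sup>+x. F (k + x) * indicator ?C (k + x - s) * indicator ?C (k + x - k) \<partial>lborel)"
      by (subst lborel_distr_plus[symmetric, of k]) (simp add: nn_integral_distr)
    then show "(\<integral>\<^sup>+x. F x * indicator ?C (x - s) * indicator ?C (x - k) \<partial>lborel)
        = (\<integral>\<^sup>+x. F x * indicator ?C (x + k - s) * indicator ?C x \<partial>lborel)"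
      using torus_periodic_lattice[OF per k] by (simp add: add.commute)
  qed
  also have "\<dots> = (\<integral>\<^sup>+x. (\<integral>\<^sup>+k. F x * indicator ?C (x + k - s) * indicator ?C x \<partial>count_space ?L) \<partial>lborel)"
    by (intro nn_integral_count_space_nn_integral[symmetric] countable_lattice) measurable
  also have "\<dots> = (\<integral>\<^sup>+x. (\<integral>\<^sup>+k. F x * indicator ?C x * indicator ?C ((x - s) + k) \<partial>count_space ?L) \<partial>lborel)"
    by (simp add: algebra_simps)
  also have "\<dots> = (\<integral>\<^sup>+x. F x \<partial>torus)"
    by (simp add: nn_integral_cmult sum_lattice_unit_cell' nn_integral_torus)
  finally show ?thesis .
qed

section \<open>Translation as a measure-preserving map of the torus\<close>

lemma sets_torus: "A \<in> sets torus \<Longrightarrow> A \<in> sets borel"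
  unfolding torus_def by (auto simp: sets_restrict_space)

text \<open>The representative of a point in the half-open cell. Translation by \<open>s\<close>
  leaves the cube; followed by this map it becomes a measurable self-map of the measure space
  \<open>torus\<close>.\<close>

definition torus_frac :: "'a::euclidean_space \<Rightarrow> 'a" where
  "torus_frac x = x - floor_point x"

lemma torus_frac_in_cell: "torus_frac x \<in> unit_cell"
  using diff_mem_unit_cell[OF lattice_point_floor, of x x] by (simp add: torus_frac_def)

lemma unit_cell_subset_cube: "unit_cell \<subseteq> cbox 0 One"
  by (auto simp: mem_unit_cell mem_box One_inner_Basis less_imp_le)

lemma torus_periodic_frac: "torus_periodic (torus_frac :: 'a::euclidean_space \<Rightarrow> 'a)"
proof -
  have "floor_point (x + b) = floor_point x + b" if b: "b \<in> Basis" for x b :: 'a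
  proof -
    have "lattice_point (floor_point x + b)"
      using b by (intro lattice_point_add lattice_point_floor lattice_point_Basis)
    moreover have "x + b - (floor_point x + b) \<in> unit_cell"
      using torus_frac_in_cell[of x] by (simp add: torus_frac_def)
    ultimately show ?thesis
      using diff_mem_unit_cell by metis
  qed
  then show ?thesis by (simp add: torus_periodic_def torus_frac_def)
qed

lemma torus_periodic_frac_eq: "torus_periodic f \<Longrightarrow> f (torus_frac x) = f x"
  using torus_periodic_lattice[OF _ lattice_point_minus[OF lattice_point_floor], of f x]
  by (simp add: torus_frac_def)

lemma torus_frac_id: "x \<in> unit_cell \<Longrightarrow> torus_frac x = x"
  by (simp add: torus_frac_def unit_cell_def)

lemma torus_shift_measurable:
  "(\<lambda>x. torus_frac (x + s)) \<in> torus \<rightarrow>\<^sub>M torus"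
proof -
  have "(\<lambda>x. torus_frac (x + s)) \<in> borel_measurable borel"
    unfolding torus_frac_def by measurable
  then show ?thesis
    using torus_frac_in_cell unit_cell_subset_cube
    by (subst (2) torus_def, intro measurable_restrict_space2)
      (force, simp add: measurable_torus)
qed

text \<open>Phrasing invariance as an image measure carries it from nonnegative functions to Bochner
  integrals in any Banach space, with no integrability assumption.\<close>

lemma distr_torus_shift:
  "distr torus torus (\<lambda>x. torus_frac (x + s)) = (torus :: 'a::euclidean_space measure)"
proof (rule measure_eqI)
  fix A :: "'a set" assume "A \<in> sets (distr torus torus (\<lambda>x. torus_frac (x + s)))"
  then have A: "A \<in> sets torus" by simp
  then have [measurable]: "A \<in> sets borel" by (rule sets_torus)
  let ?F = "\<lambda>x. indicator A (torus_frac x) :: ennreal"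
  have per: "torus_periodic ?F"
    using torus_periodic_frac[where 'a='a] by (simp add: torus_periodic_def)
  have meas: "?F \<in> borel_measurable borel"
    unfolding torus_frac_def by measurable
  have "emeasure (distr torus torus (\<lambda>x. torus_frac (x + s))) A
      = (\<integral>\<^sup>+x. indicator A x \<partial>distr torus torus (\<lambda>x. torus_frac (x + s)))"
    using A by simp
  also have "\<dots> = (\<integral>\<^sup>+x. ?F (x + s) \<partial>torus)"
    using A by (intro nn_integral_distr torus_shift_measurable) auto
  also have "\<dots> = (\<integral>\<^sup>+x. ?F x \<partial>torus)"
    by (rule nn_integral_torus_shift[OF per meas])
  also have "\<dots> = (\<integral>\<^sup>+x. indicator A x \<partial>torus)"
    unfolding nn_integral_torus
    by (intro nn_integral_cong) (auto simp: torus_frac_id split: split_indicator)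
  finally show "emeasure (distr torus torus (\<lambda>x. torus_frac (x + s))) A = emeasure torus A"
    using A by simp
qed simp

lemma integral_torus_shift:
  fixes F :: "'a::euclidean_space \<Rightarrow> 'b::{banach, second_countable_topology}"
  assumes per: "torus_periodic F" and F: "F \<in> borel_measurable borel"
  shows "(\<integral>x. F (x + s) \<partial>torus) = (\<integral>x. F x \<partial>torus)"
proof -
  have "(\<integral>x. F x \<partial>torus) = (\<integral>x. F x \<partial>distr torus torus (\<lambda>x. torus_frac (x + s)))"
    by (simp add: distr_torus_shift)
  also have "\<dots> = (\<integral>x. F (torus_frac (x + s)) \<partial>torus)"
    by (intro integral_distr torus_shift_measurable measurable_torus F)
  finally show ?thesis
    by (simp add: torus_periodic_frac_eq[OF per])
qed

section \<open>Total mass and products of tori\<close>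

lemma emeasure_torus_space: "emeasure torus (space torus) = 1"
proof -
  have "emeasure torus (space torus) = emeasure lborel (cbox (0::'a) One)"
    unfolding torus_def by (subst emeasure_restrict_space) (auto simp: space_restrict_space)
  also have "\<dots> = 1"
    by (subst emeasure_lborel_cbox) (auto simp: One_inner_Basis)
  finally show ?thesis .
qed

lemma finite_measure_torus: "finite_measure torus"
  by (rule finite_measureI) (simp add: emeasure_torus_space)

lemma measure_torus_space: "measure torus (space torus) = 1"
  by (simp add: measure_def emeasure_torus_space)

lemma sets_torus_iff: "A \<in> sets torus \<longleftrightarrow> A \<in> sets borel \<and> A \<subseteq> cbox 0 One"
  unfolding torus_def by (subst sets_restrict_space_iff) auto

lemma emeasure_torus: "A \<in> sets torus \<Longrightarrow> emeasure torus A = emeasure lborel A"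
  unfolding sets_torus_iff unfolding torus_def by (subst emeasure_restrict_space) auto

lemma cube_prod: "cbox (0::'a \<times> 'b) One = cbox (0::'a::euclidean_space) One \<times> cbox (0::'b::euclidean_space) One"
proof -
  have "(One :: 'a \<times> 'b) = (One, One)"
    by (simp add: sum_Basis_prod_eq sum_prod)
  then show ?thesis
    by (simp add: zero_prod_def cbox_Pair_eq)
qed

text \<open>Makes Fubini available: \<open>fourier_coeff\<close> is an iterated integral, while the
  norm and Parseval refer to the torus of the product type.\<close>

lemma torus_pair: "torus \<Otimes>\<^sub>M torus = (torus :: ('a::euclidean_space \<times> 'b::euclidean_space) measure)"
proof (rule pair_measure_eqI)
  show "sigma_finite_measure (torus :: 'a measure)" "sigma_finite_measure (torus :: 'b measure)"
    using finite_measure_torus by (auto simp: finite_measure_def)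
  have rect: "X \<times> Y \<in> sets (torus :: ('a \<times> 'b) measure)"
    if "X \<in> sets torus" "Y \<in> sets torus" for X :: "'a set" and Y :: "'b set"
    using that by (auto simp: sets_torus_iff cube_prod intro!: borel_Times)
  show "emeasure torus X * emeasure torus Y = emeasure torus (X \<times> Y)"
    if "X \<in> sets torus" "Y \<in> sets torus" for X :: "'a set" and Y :: "'b set"
  proof -
    have "emeasure (lborel :: ('a \<times> 'b) measure) (X \<times> Y) = emeasure lborel X * emeasure lborel Y"
      using that unfolding lborel_prod[symmetric] sets_torus_iff
      by (intro lborel.emeasure_pair_measure_Times) auto
    then show ?thesis
      using that rect by (simp add: emeasure_torus)
  qed
  \<comment> \<open>The pair of projections is measurable from the product sigma-algebra into the
    Borel sets of the product space, so every Borel subset of the cube is the preimage of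
    itself.\<close>
  have "S \<in> sets (torus \<Otimes>\<^sub>M torus)" if S: "S \<in> sets (torus :: ('a \<times> 'b) measure)" for S
  proof -
    have "fst \<in> borel_measurable (torus \<Otimes>\<^sub>M torus :: ('a \<times> 'b) measure)"
      by (rule measurable_compose[OF measurable_fst measurable_torus]) simp
    moreover have "snd \<in> borel_measurable (torus \<Otimes>\<^sub>M torus :: ('a \<times> 'b) measure)"
      by (rule measurable_compose[OF measurable_snd measurable_torus]) simp
    ultimately have "(\<lambda>p. (fst p, snd p)) \<in> borel_measurable (torus \<Otimes>\<^sub>M torus :: ('a \<times> 'b) measure)"
      by measurable
    from measurable_sets[OF this, of S] have
      "S \<inter> space (torus \<Otimes>\<^sub>M torus) \<in> sets (torus \<Otimes>\<^sub>M torus)"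
      using S by (simp add: sets_torus_iff vimage_def Int_def conj_commute)
    moreover have "S \<inter> space (torus \<Otimes>\<^sub>M torus) = S"
      using S by (auto simp: sets_torus_iff space_pair_measure space_torus cube_prod)
    ultimately show ?thesis by simp
  qed
  moreover have "sets (torus \<Otimes>\<^sub>M torus) \<subseteq> sets (torus :: ('a \<times> 'b) measure)"
    unfolding sets_pair_measure using rect
    by (subst space_torus, subst space_torus, subst cube_prod[symmetric], subst space_torus[symmetric])
      (rule sets.sigma_sets_subset; auto)
  ultimately show "sets (torus \<Otimes>\<^sub>M torus) = sets (torus :: ('a \<times> 'b) measure)"
    by blast
qed

section \<open>Square-integrable functions\<close>

lemma torus_periodic_compose: "torus_periodic f \<Longrightarrow> torus_periodic (\<lambda>x. h (f x))"
  by (simp add: torus_periodic_def)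

lemma torus_L2_periodic: "f \<in> torus_L2 \<Longrightarrow> torus_periodic f"
  and torus_L2_measurable: "f \<in> torus_L2 \<Longrightarrow> f \<in> borel_measurable borel"
  and torus_L2_square_integrable: "f \<in> torus_L2 \<Longrightarrow> integrable torus (\<lambda>x. (norm (f x))\<^sup>2)"
  by (simp_all add: torus_L2_def)

lemma torus_L2_mult_integrable:
  assumes "f \<in> torus_L2" "g \<in> torus_L2"
  shows "integrable torus (\<lambda>x. f x * g x)"
proof (rule Bochner_Integration.integrable_bound)
  show "integrable torus (\<lambda>x. (norm (f x))\<^sup>2 + (norm (g x))\<^sup>2)"
    using assms by (simp add: torus_L2_def)
  show "(\<lambda>x. f x * g x) \<in> borel_measurable torus"
    using assms by (intro measurable_torus borel_measurable_times) (auto simp: torus_L2_def)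
  show "AE x in torus. norm (f x * g x) \<le> norm ((norm (f x))\<^sup>2 + (norm (g x))\<^sup>2)"
  proof (intro always_eventually allI)
    fix x
    have "0 \<le> norm (f x) * norm (g x)" by simp
    then have "norm (f x) * norm (g x) \<le> (norm (f x))\<^sup>2 + (norm (g x))\<^sup>2"
      using sum_squares_bound[of "norm (f x)" "norm (g x)"] by linarith
    then show "norm (f x * g x) \<le> norm ((norm (f x))\<^sup>2 + (norm (g x))\<^sup>2)"
      by (simp add: norm_mult)
  qed
qed

lemma torus_L2I_bound:
  assumes "torus_periodic h" "h \<in> borel_measurable borel"
    and g: "integrable torus (g :: _ \<Rightarrow> real)" "\<And>x. x \<in> cbox 0 One \<Longrightarrow> (norm (h x))\<^sup>2 \<le> g x"
  shows "h \<in> torus_L2"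
proof -
  have "(\<lambda>x. (norm (h x))\<^sup>2) \<in> borel_measurable torus"
    using assms(2) by (intro measurable_torus) measurable
  moreover have "AE x in torus. norm ((norm (h x))\<^sup>2) \<le> norm (g x)"
    using g(2) by (intro AE_I2) (fastforce simp: space_torus)
  ultimately have "integrable torus (\<lambda>x. (norm (h x))\<^sup>2)"
    by (rule Bochner_Integration.integrable_bound[OF g(1)])
  then show ?thesis
    using assms(1,2) by (simp add: torus_L2_def)
qed

lemma torus_L2_bounded_mult:
  assumes "torus_periodic h" "h \<in> borel_measurable borel" "\<And>x. x \<in> cbox 0 One \<Longrightarrow> norm (h x) \<le> B"
    and f: "f \<in> torus_L2"
  shows "(\<lambda>x. h x * f x) \<in> torus_L2"
proof (rule torus_L2I_bound)
  show "torus_periodic (\<lambda>x. h x * f x)"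
    using assms(1) torus_L2_periodic[OF f] by (simp add: torus_periodic_def)
  show "(\<lambda>x. h x * f x) \<in> borel_measurable borel"
    by (intro borel_measurable_times assms torus_L2_measurable)
  show "integrable torus (\<lambda>x. B\<^sup>2 * (norm (f x))\<^sup>2)"
    using f by (simp add: torus_L2_def)
  show "(norm (h x * f x))\<^sup>2 \<le> B\<^sup>2 * (norm (f x))\<^sup>2" if "x \<in> cbox 0 One" for x
    using assms(3)[OF that] by (simp add: norm_mult power_mult_distrib mult_right_mono power_mono)
qed

lemma torus_L2_const: "(\<lambda>x. c) \<in> torus_L2"
proof (rule torus_L2I_bound)
  show "integrable torus (\<lambda>x. (norm c)\<^sup>2)"
    using finite_measure.integrable_const[OF finite_measure_torus] .
qed (auto simp: torus_periodic_def)

lemma torus_L2_bounded: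
  assumes "torus_periodic h" "h \<in> borel_measurable borel" "\<And>x. x \<in> cbox 0 One \<Longrightarrow> norm (h x) \<le> B"
  shows "h \<in> torus_L2"
  using torus_L2_bounded_mult[OF assms torus_L2_const[of 1]] by simp

lemma torus_L2_cmult: "f \<in> torus_L2 \<Longrightarrow> (\<lambda>x. c * f x) \<in> torus_L2"
  by (rule torus_L2_bounded_mult[where B = "norm c"]) (auto simp: torus_periodic_def)

lemma torus_L2_add:
  assumes "f \<in> torus_L2" "g \<in> torus_L2"
  shows "(\<lambda>x. f x + g x) \<in> torus_L2"
proof (rule torus_L2I_bound)
  show "torus_periodic (\<lambda>x. f x + g x)"
    using assms[THEN torus_L2_periodic] by (simp add: torus_periodic_def)
  show "(\<lambda>x. f x + g x) \<in> borel_measurable borel"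
    by (intro borel_measurable_add assms torus_L2_measurable)
  show "integrable torus (\<lambda>x. 2 * (norm (f x))\<^sup>2 + 2 * (norm (g x))\<^sup>2)"
    using assms by (simp add: torus_L2_def)
  show "(norm (f x + g x))\<^sup>2 \<le> 2 * (norm (f x))\<^sup>2 + 2 * (norm (g x))\<^sup>2" for x
  proof -
    have "(norm (f x + g x))\<^sup>2 \<le> (norm (f x) + norm (g x))\<^sup>2"
      by (intro power_mono norm_triangle_ineq) auto
    also have "\<dots> \<le> 2 * (norm (f x))\<^sup>2 + 2 * (norm (g x))\<^sup>2"
      using sum_squares_bound[of "norm (f x)" "norm (g x)"] by (simp add: power2_sum)
    finally show ?thesis .
  qed
qed

lemma torus_L2_diff:
  assumes "f \<in> torus_L2" "g \<in> torus_L2"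
  shows "(\<lambda>x. f x - g x) \<in> torus_L2"
  using torus_L2_add[OF assms(1) torus_L2_cmult[OF assms(2), of "-1"]] by simp

lemma torus_L2_sum: "(\<And>i. i \<in> I \<Longrightarrow> f i \<in> torus_L2) \<Longrightarrow> (\<lambda>x. \<Sum>i\<in>I. f i x) \<in> torus_L2"
  by (induction I rule: infinite_finite_induct) (auto intro: torus_L2_add torus_L2_const)

lemma torus_L2_cnj: "f \<in> torus_L2 \<Longrightarrow> (\<lambda>x. cnj (f x)) \<in> torus_L2"
  by (auto simp: torus_L2_def intro!: torus_periodic_compose[where h = cnj]
      measurable_compose[OF _ borel_measurable_continuous_onI[OF continuous_on_cnj[OF continuous_on_id]]])

lemma torus_L2_shift:
  assumes f: "f \<in> torus_L2"
  shows "(\<lambda>x. f (x + s)) \<in> torus_L2"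
proof -
  let ?F = "\<lambda>x. ennreal ((norm (f x))\<^sup>2)"
  have per: "torus_periodic ?F"
    using torus_L2_periodic[OF f] by (rule torus_periodic_compose)
  have [measurable]: "f \<in> borel_measurable borel" using f by (rule torus_L2_measurable)
  have "(\<integral>\<^sup>+x. ?F x \<partial>torus) < \<infinity>"
    using torus_L2_square_integrable[OF f] by (simp add: integrable_iff_bounded)
  then have "(\<integral>\<^sup>+x. ?F (x + s) \<partial>torus) < \<infinity>"
    by (subst nn_integral_torus_shift[OF per]) auto
  moreover have "(\<lambda>x. (norm (f (x + s)))\<^sup>2) \<in> borel_measurable torus"
    by (rule measurable_torus) measurable
  ultimately have "integrable torus (\<lambda>x. (norm (f (x + s)))\<^sup>2)"
    by (simp add: integrable_iff_bounded)
  then show ?thesis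
    using torus_periodic_shift[OF torus_L2_periodic[OF f]] by (simp add: torus_L2_def)
qed

lemma torus_L2_integrable: "f \<in> torus_L2 \<Longrightarrow> integrable torus f"
  using torus_L2_mult_integrable[OF _ torus_L2_const[of 1]] by simp

section \<open>The square norm\<close>

lemma L2norm_nonneg: "0 \<le> L2norm f"
  by (simp add: L2norm_def)

lemma L2norm_power2: "(L2norm f)\<^sup>2 = (\<integral>x. (norm (f x))\<^sup>2 \<partial>torus)"
  by (simp add: L2norm_def)

lemma L2norm_cong_AE:
  assumes "f \<in> borel_measurable borel" "g \<in> borel_measurable borel" "AE x in torus. f x = g x"
  shows "L2norm f = L2norm g"
proof -
  have "(\<integral>x. (norm (f x))\<^sup>2 \<partial>torus) = (\<integral>x. (norm (g x))\<^sup>2 \<partial>torus)"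
    using assms(3) by (intro integral_cong_AE measurable_torus)
      (use assms(1,2) in measurable, auto elim: eventually_mono)
  then show ?thesis by (simp add: L2norm_def)
qed

text \<open>Cauchy-Schwarz from the weighted inequality between arithmetic and geometric mean, with
  the weights that make it sharp after integration. The summand \<open>e\<close> keeps the
  denominators positive when a norm vanishes and is sent to 0 at the end.\<close>

lemma integral_norm_mult_le:
  assumes f: "f \<in> torus_L2" and g: "g \<in> torus_L2"
  shows "(\<integral>x. norm (f x * g x) \<partial>torus) \<le> L2norm f * L2norm g"
proof (rule tendsto_lowerbound)
  show "((\<lambda>e. (L2norm f + e) * (L2norm g + e)) \<longlongrightarrow> L2norm f * L2norm g) (at_right 0)"
    by (auto intro!: tendsto_eq_intros)
  show "\<forall>\<^sub>F e in at_right 0. (\<integral>x. norm (f x * g x) \<partial>torus) \<le> (L2norm f + e) * (L2norm g + e)"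
  proof (rule eventually_at_right_less[THEN eventually_mono])
    fix e :: real assume "e > 0"
    define a where "a = L2norm f + e"
    define b where "b = L2norm g + e"
    have pos: "a > 0" "b > 0" and le: "L2norm f \<le> a" "L2norm g \<le> b"
      using \<open>e > 0\<close> L2norm_nonneg[of f] L2norm_nonneg[of g] by (auto simp: a_def b_def)
    have pt: "norm (f x * g x) \<le> (b / a) / 2 * (norm (f x))\<^sup>2 + (a / b) / 2 * (norm (g x))\<^sup>2" for x
    proof -
      have "0 \<le> (b * norm (f x) - a * norm (g x))\<^sup>2" by simp
      then show ?thesis
        using pos by (simp add: norm_mult field_simps power2_eq_square)
    qed
    have "(\<integral>x. norm (f x * g x) \<partial>torus)
        \<le> (\<integral>x. (b / a) / 2 * (norm (f x))\<^sup>2 + (a / b) / 2 * (norm (g x))\<^sup>2 \<partial>torus)"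
      using torus_L2_mult_integrable[OF f g] torus_L2_square_integrable[OF f] torus_L2_square_integrable[OF g]
      by (intro integral_mono pt) auto
    also have "\<dots> = (b / a) / 2 * (L2norm f)\<^sup>2 + (a / b) / 2 * (L2norm g)\<^sup>2"
      using torus_L2_square_integrable[OF f] torus_L2_square_integrable[OF g]
      by (simp add: L2norm_power2)
    also have "\<dots> \<le> (b / a) / 2 * a\<^sup>2 + (a / b) / 2 * b\<^sup>2"
      using pos le L2norm_nonneg by (intro add_mono mult_left_mono power_mono) auto
    also have "\<dots> = a * b"
      using pos by (simp add: field_simps power2_eq_square)
    finally show "(\<integral>x. norm (f x * g x) \<partial>torus) \<le> (L2norm f + e) * (L2norm g + e)"
      by (simp add: a_def b_def)
  qed
qed simp

lemma norm_integral_mult_le: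
  assumes f: "f \<in> torus_L2" and g: "g \<in> torus_L2"
  shows "norm (\<integral>x. f x * g x \<partial>torus) \<le> L2norm f * L2norm g"
  using integral_norm_bound integral_norm_mult_le[OF assms] by (rule order_trans)

lemma L2norm_mono:
  assumes "f \<in> torus_L2" "g \<in> torus_L2" "\<And>x. x \<in> cbox 0 One \<Longrightarrow> norm (f x) \<le> norm (g x)"
  shows "L2norm f \<le> L2norm g"
  unfolding L2norm_def using assms
  by (intro real_sqrt_le_mono integral_mono torus_L2_square_integrable power_mono) (auto simp: space_torus)

lemma L2norm_cmult: "L2norm (\<lambda>x. c * f x) = norm c * L2norm f"
  by (simp add: L2norm_def norm_mult power_mult_distrib real_sqrt_mult)

lemma L2norm_const: "L2norm (\<lambda>x. c :: complex) = norm c"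
  using finite_measure.finite_emeasure_space[OF finite_measure_torus]
  by (simp add: L2norm_def measure_torus_space)

lemma L2norm_le_const:
  assumes "f \<in> torus_L2" "\<And>x. x \<in> cbox 0 One \<Longrightarrow> norm (f x) \<le> B" "0 \<le> B"
  shows "L2norm f \<le> B"
  using L2norm_mono[OF assms(1) torus_L2_const[of "of_real B"]] assms by (simp add: L2norm_const)

lemma L2norm_power2_add:
  assumes f: "f \<in> torus_L2" and g: "g \<in> torus_L2"
  shows "(L2norm (\<lambda>x. f x + g x))\<^sup>2 = (L2norm f)\<^sup>2 + 2 * Re (\<integral>x. f x * cnj (g x) \<partial>torus) + (L2norm g)\<^sup>2"
proof -
  have int: "integrable torus (\<lambda>x. f x * cnj (g x))"
    by (intro torus_L2_mult_integrable torus_L2_cnj assms)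
  define r where "r = (\<lambda>x. Re (f x * cnj (g x)))"
  have r: "integrable torus r" "(\<integral>x. r x \<partial>torus) = Re (\<integral>x. f x * cnj (g x) \<partial>torus)"
    unfolding r_def using integrable_Re[OF int] integral_Re[OF int] by auto
  have "(norm (f x + g x))\<^sup>2 = (norm (f x))\<^sup>2 + 2 * r x + (norm (g x))\<^sup>2" for x
    unfolding r_def cmod_power2 by (simp add: power2_eq_square algebra_simps)
  then have "(L2norm (\<lambda>x. f x + g x))\<^sup>2 = (\<integral>x. (norm (f x))\<^sup>2 + 2 * r x + (norm (g x))\<^sup>2 \<partial>torus)"
    by (simp add: L2norm_power2)
  also have "\<dots> = (L2norm f)\<^sup>2 + 2 * Re (\<integral>x. f x * cnj (g x) \<partial>torus) + (L2norm g)\<^sup>2"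
    using r torus_L2_square_integrable[OF f] torus_L2_square_integrable[OF g]
    by (simp add: L2norm_power2)
  finally show ?thesis .
qed

lemma L2norm_cnj: "L2norm (\<lambda>x. cnj (f x)) = L2norm f"
  by (simp add: L2norm_def)

lemma L2norm_triangle:
  assumes f: "f \<in> torus_L2" and g: "g \<in> torus_L2"
  shows "L2norm (\<lambda>x. f x + g x) \<le> L2norm f + L2norm g"
proof (rule power2_le_imp_le)
  have "Re (\<integral>x. f x * cnj (g x) \<partial>torus) \<le> L2norm f * L2norm g"
    using order_trans[OF complex_Re_le_cmod norm_integral_mult_le[OF f torus_L2_cnj[OF g]]]
    by (simp add: L2norm_cnj)
  then show "(L2norm (\<lambda>x. f x + g x))\<^sup>2 \<le> (L2norm f + L2norm g)\<^sup>2"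
    unfolding L2norm_power2_add[OF assms] by (simp add: power2_sum)
qed (simp add: L2norm_nonneg)

lemma L2norm_triangle_diff:
  assumes "f \<in> torus_L2" "g \<in> torus_L2" "h \<in> torus_L2"
  shows "L2norm (\<lambda>x. f x - h x) \<le> L2norm (\<lambda>x. f x - g x) + L2norm (\<lambda>x. g x - h x)"
  using L2norm_triangle[OF torus_L2_diff[OF assms(1,2)] torus_L2_diff[OF assms(2,3)]] by simp

lemma L2norm_minus_commute: "L2norm (\<lambda>x. f x - g x) = L2norm (\<lambda>x. g x - f x)"
  by (simp add: L2norm_def norm_minus_commute)

lemma abs_L2norm_diff_le:
  assumes "f \<in> torus_L2" "g \<in> torus_L2"
  shows "\<bar>L2norm f - L2norm g\<bar> \<le> L2norm (\<lambda>x. f x - g x)"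
  using L2norm_triangle_diff[OF assms torus_L2_const[of 0]]
    L2norm_triangle_diff[OF assms(2,1) torus_L2_const[of 0]] L2norm_minus_commute[of f g]
  by simp

lemma tendsto_L2norm:
  assumes "\<forall>\<^sub>F s in F. f s \<in> torus_L2" "g \<in> torus_L2"
    and "((\<lambda>s. L2norm (\<lambda>x. f s x - g x)) \<longlongrightarrow> 0) F"
  shows "((\<lambda>s. L2norm (f s)) \<longlongrightarrow> L2norm g) F"
proof (rule LIM_zero_cancel)
  show "((\<lambda>s. L2norm (f s) - L2norm g) \<longlongrightarrow> 0) F"
    using assms(1)
    by (rule Lim_null_comparison[OF eventually_mono assms(3)]) (simp add: abs_L2norm_diff_le assms(2))
qed

text \<open>Norm convergence implies weak convergence, by Cauchy-Schwarz. The filter is arbitrary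
  because the lemma is used both for limits in time and along finite sets of frequencies.\<close>

lemma tendsto_integral_mult:
  assumes ev: "\<forall>\<^sub>F s in F. f s \<in> torus_L2" and g: "g \<in> torus_L2" and h: "h \<in> torus_L2"
    and lim: "((\<lambda>s. L2norm (\<lambda>x. f s x - g x)) \<longlongrightarrow> 0) F"
  shows "((\<lambda>s. \<integral>x. f s x * h x \<partial>torus) \<longlongrightarrow> (\<integral>x. g x * h x \<partial>torus)) F"
proof (rule LIM_zero_cancel, rule Lim_null_comparison)
  show "((\<lambda>s. L2norm (\<lambda>x. f s x - g x) * L2norm h) \<longlongrightarrow> 0) F"
    using tendsto_mult_right[OF lim, of "L2norm h"] by simp
  show "\<forall>\<^sub>F s in F. norm ((\<integral>x. f s x * h x \<partial>torus) - (\<integral>x. g x * h x \<partial>torus))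
      \<le> L2norm (\<lambda>x. f s x - g x) * L2norm h"
    using ev
  proof eventually_elim
    case (elim s)
    have "(\<integral>x. f s x * h x \<partial>torus) - (\<integral>x. g x * h x \<partial>torus) = (\<integral>x. (f s x - g x) * h x \<partial>torus)"
      using torus_L2_mult_integrable[OF elim h] torus_L2_mult_integrable[OF g h]
      by (simp add: left_diff_distrib)
    then show ?case
      using norm_integral_mult_le[OF torus_L2_diff[OF elim g] h] by simp
  qed
qed

section \<open>Fourier series on the torus\<close>

definition character :: "'a::euclidean_space \<Rightarrow> 'a \<Rightarrow> complex" where
  "character k x = cis (2 * pi * (k \<bullet> x))"

definition torus_coeff :: "('a::euclidean_space \<Rightarrow> complex) \<Rightarrow> 'a \<Rightarrow> complex" where
  "torus_coeff f k = (\<integral>x. f x * character (- k) x \<partial>torus)"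

lemma norm_character [simp]: "norm (character k x) = 1"
  by (simp add: character_def)

lemma character_0 [simp]: "character 0 x = 1"
  by (simp add: character_def)

lemma character_mult: "character k x * character l x = character (k + l) x"
  by (simp add: character_def cis_mult inner_add_left distrib_left)

lemma character_shift: "character k (x + s) = character k x * character k s"
  by (simp add: character_def cis_mult inner_add_right distrib_left)

lemma cnj_character: "cnj (character k x) = character (- k) x"
  by (simp add: character_def cis_cnj)

lemma continuous_character: "continuous_on S (character k)"
  unfolding character_def cis_conv_exp by (intro continuous_intros)

lemma measurable_character [measurable]: "character k \<in> borel_measurable borel"
  by (intro borel_measurable_continuous_onI continuous_character)

lemma torus_periodic_character:
  assumes "lattice_point k" shows "torus_periodic (character k)"
  unfolding torus_periodic_def
proof (intro allI ballI)
  fix x b :: 'a assume "b \<in> Basis"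
  then obtain i where i: "k \<bullet> b = of_int i"
    using assms by (auto simp: lattice_point_def elim!: Ints_cases)
  have "character k b = 1"
    using cis_multiple_2pi[of "of_int i"] by (simp add: character_def i)
  then show "character k (x + b) = character k x"
    by (simp add: character_shift)
qed

lemma character_L2: "lattice_point k \<Longrightarrow> character k \<in> torus_L2"
  by (rule torus_L2_bounded[where B = 1]) (auto intro: torus_periodic_character)

lemma L2norm_character: "L2norm (character k) = 1"
  by (simp add: L2norm_def measure_torus_space)

text \<open>For nonzero \<open>k\<close> some translation multiplies the character by
  \<open>-1\<close>, while translations do not change the integral.\<close>

lemma integral_character:
  assumes k: "lattice_point k"
  shows "(\<integral>x. character k x \<partial>torus) = (if k = 0 then 1 else 0)"
proof (cases "k = 0")
  case False
  \<comment> \<open>Scaled so that \<open>k \<bullet> s\<close> is one half, that is half a period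
    of the character.\<close>
  define s where "s = (1 / (2 * (k \<bullet> k))) *\<^sub>R k"
  have "2 * pi * (k \<bullet> s) = pi"
    using False by (simp add: s_def)
  then have "character k s = -1"
    by (simp only: character_def cis_pi)
  then have "(\<integral>x. character k (x + s) \<partial>torus) = - (\<integral>x. character k x \<partial>torus)"
    by (simp add: character_shift)
  then show ?thesis
    using integral_torus_shift[OF torus_periodic_character[OF k] measurable_character, of s] False
    by (simp add: equation_minus_iff)
qed (simp add: measure_torus_space)

lemma torus_coeff_add: "f \<in> torus_L2 \<Longrightarrow> g \<in> torus_L2 \<Longrightarrow> lattice_point k \<Longrightarrow>
    torus_coeff (\<lambda>x. f x + g x) k = torus_coeff f k + torus_coeff g k"
  by (simp add: torus_coeff_def distrib_right torus_L2_mult_integrable character_L2 lattice_point_minus)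

lemma torus_coeff_diff: "f \<in> torus_L2 \<Longrightarrow> g \<in> torus_L2 \<Longrightarrow> lattice_point k \<Longrightarrow>
    torus_coeff (\<lambda>x. f x - g x) k = torus_coeff f k - torus_coeff g k"
  by (simp add: torus_coeff_def left_diff_distrib torus_L2_mult_integrable character_L2 lattice_point_minus)

lemma torus_coeff_cmult: "torus_coeff (\<lambda>x. c * f x) k = c * torus_coeff f k"
  by (simp add: torus_coeff_def mult.assoc)

lemma torus_coeff_sum: "(\<And>i. i \<in> I \<Longrightarrow> f i \<in> torus_L2) \<Longrightarrow> lattice_point k \<Longrightarrow>
    torus_coeff (\<lambda>x. \<Sum>i\<in>I. f i x) k = (\<Sum>i\<in>I. torus_coeff (f i) k)"
  by (simp add: torus_coeff_def sum_distrib_right torus_L2_mult_integrable character_L2 lattice_point_minus)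

lemma torus_coeff_character:
  "lattice_point k \<Longrightarrow> lattice_point l \<Longrightarrow> torus_coeff (character k) l = (if k = l then 1 else 0)"
  by (simp add: torus_coeff_def character_mult integral_character lattice_point_diff)

lemma cnj_torus_coeff: "cnj (torus_coeff f k) = torus_coeff (\<lambda>x. cnj (f x)) (- k)"
  unfolding torus_coeff_def Bochner_Integration.integral_cnj[symmetric]
  by (simp add: cnj_character del: Bochner_Integration.integral_cnj)

section \<open>Density of trigonometric polynomials\<close>

inductive_set trig_poly :: "('a::euclidean_space \<Rightarrow> complex) set" where
  char: "lattice_point k \<Longrightarrow> (\<lambda>x. c * character k x) \<in> trig_poly"
| add: "p \<in> trig_poly \<Longrightarrow> q \<in> trig_poly \<Longrightarrow> (\<lambda>x. p x + q x) \<in> trig_poly"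

lemma trig_poly_const: "(\<lambda>x. c) \<in> trig_poly"
  using trig_poly.char[OF lattice_point_0, of c] by simp

lemma trig_poly_mult:
  assumes "p \<in> trig_poly" "q \<in> trig_poly"
  shows "(\<lambda>x. p x * q x) \<in> trig_poly"
  using assms(1)
proof induction
  case (char k c)
  show ?case using assms(2)
  proof induction
    case (char l d)
    have "(\<lambda>x. (c * d) * character (k + l) x) \<in> trig_poly"
      using \<open>lattice_point k\<close> char by (intro trig_poly.char lattice_point_add)
    then show ?case
      by (simp add: character_mult[symmetric] mult_ac)
  next
    case (add p q)
    then show ?case using trig_poly.add by (fastforce simp: distrib_left)
  qed
next
  case (add p1 p2)
  then show ?case using trig_poly.add by (fastforce simp: distrib_right)
qed

lemma trig_poly_sum: "(\<And>i. i \<in> I \<Longrightarrow> p i \<in> trig_poly) \<Longrightarrow> (\<lambda>x. \<Sum>i\<in>I. p i x) \<in> trig_poly"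
  by (induction I rule: infinite_finite_induct) (auto intro: trig_poly.add trig_poly_const)

lemma trig_poly_L2: "p \<in> trig_poly \<Longrightarrow> p \<in> torus_L2"
  by (induction rule: trig_poly.induct) (auto intro: torus_L2_cmult torus_L2_add character_L2)

text \<open>The torus as a product of unit circles, the cosines and the sines collected in two
  vectors. Opposite faces of the cube are glued, and polynomials in the coordinates become
  trigonometric polynomials, so Stone-Weierstrass on the compact image yields the
  approximation.\<close>

definition torus_embed :: "'a::euclidean_space \<Rightarrow> 'a \<times> 'a" where
  "torus_embed x = ((\<Sum>b\<in>Basis. cos (2 * pi * (b \<bullet> x)) *\<^sub>R b), (\<Sum>b\<in>Basis. sin (2 * pi * (b \<bullet> x)) *\<^sub>R b))"

lemma continuous_torus_embed: "continuous_on S torus_embed"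
  unfolding torus_embed_def by (intro continuous_intros)

lemma trig_poly_linear_embed:
  fixes L :: "'a::euclidean_space \<times> 'a \<Rightarrow> real"
  assumes "bounded_linear L"
  shows "(\<lambda>x. complex_of_real (L (torus_embed x))) \<in> trig_poly"
proof -
  interpret bounded_linear L by fact
  have L: "L (torus_embed x) = (\<Sum>b\<in>Basis. cos (2 * pi * (b \<bullet> x)) * L (b, 0) + sin (2 * pi * (b \<bullet> x)) * L (0, b))" for x
  proof -
    have "torus_embed x = (\<Sum>b\<in>Basis. cos (2 * pi * (b \<bullet> x)) *\<^sub>R (b, 0) + sin (2 * pi * (b \<bullet> x)) *\<^sub>R (0, b))"
      by (simp add: torus_embed_def sum_prod)
    then show ?thesis by (simp only: sum add scale real_scaleR_def)
  qed
  have cos: "(\<lambda>x. complex_of_real (cos (2 * pi * (b \<bullet> x)))) \<in> trig_poly" if b: "b \<in> Basis" for b :: 'a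
  proof -
    have "(\<lambda>x. (1/2) * character b x + (1/2) * character (- b) x) \<in> trig_poly"
      using b by (intro trig_poly.intros lattice_point_Basis lattice_point_minus)
    moreover have "(1/2) * character b x + (1/2) * character (- b) x = of_real (cos (2 * pi * (b \<bullet> x)))" for x
      by (simp add: character_def complex_eq_iff)
    ultimately show ?thesis by simp
  qed
  have sin: "(\<lambda>x. complex_of_real (sin (2 * pi * (b \<bullet> x)))) \<in> trig_poly" if b: "b \<in> Basis" for b :: 'a
  proof -
    have "(\<lambda>x. (-\<i>/2) * character b x + (\<i>/2) * character (- b) x) \<in> trig_poly"
      using b by (intro trig_poly.intros lattice_point_Basis lattice_point_minus)
    moreover have "(-\<i>/2) * character b x + (\<i>/2) * character (- b) x = of_real (sin (2 * pi * (b \<bullet> x)))" for x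
      by (simp add: character_def complex_eq_iff)
    ultimately show ?thesis by simp
  qed
  show ?thesis
    unfolding L of_real_sum of_real_add of_real_mult
    by (intro trig_poly_sum trig_poly.add trig_poly_mult trig_poly_const cos sin)
qed

lemma trig_poly_polynomial_embed:
  fixes p :: "'a::euclidean_space \<times> 'a \<Rightarrow> complex"
  assumes "polynomial_function p"
  shows "(\<lambda>x. p (torus_embed x)) \<in> trig_poly"
proof -
  have real: "(\<lambda>x. complex_of_real (q (torus_embed x))) \<in> trig_poly"
    if "real_polynomial_function q" for q :: "'a \<times> 'a \<Rightarrow> real"
    using that
  proof induction
    case (linear f) then show ?case by (rule trig_poly_linear_embed)
  next
    case (const c) then show ?case by (rule trig_poly_const)
  next
    case (add f g) then show ?case by (simp add: trig_poly.add)
  next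
    case (mult f g) then show ?case by (simp add: trig_poly_mult)
  qed
  have "real_polynomial_function (Re \<circ> p)" "real_polynomial_function (Im \<circ> p)"
    using assms bounded_linear_Re bounded_linear_Im unfolding polynomial_function_def by blast+
  then have "(\<lambda>x. complex_of_real (Re (p (torus_embed x))) + \<i> * complex_of_real (Im (p (torus_embed x)))) \<in> trig_poly"
    using real[of "Re \<circ> p"] real[of "Im \<circ> p"]
    by (auto simp: o_def intro!: trig_poly.add trig_poly_mult trig_poly_const)
  then show ?thesis
    by (simp add: complex_eq[symmetric])
qed

text \<open>Equal sines and cosines make coordinates differ by integers. Two different numbers of
  the unit interval that differ by an integer are 0 and 1, so points glued together lie on the
  boundary.\<close>

lemma torus_embed_eq_cube:
  assumes eq: "torus_embed x = torus_embed y" and x: "x \<in> cbox 0 One" and y: "y \<in> cbox 0 One"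
    and "x \<noteq> y"
  shows "x \<notin> box 0 One" and "y \<notin> box 0 One"
proof -
  obtain b where b: "b \<in> Basis" "x \<bullet> b \<noteq> y \<bullet> b"
    using \<open>x \<noteq> y\<close> euclidean_eq_iff by blast
  have "(\<Sum>c\<in>Basis. cos (2 * pi * (c \<bullet> x)) *\<^sub>R c) \<bullet> b = (\<Sum>c\<in>Basis. cos (2 * pi * (c \<bullet> y)) *\<^sub>R c) \<bullet> b"
    "(\<Sum>c\<in>Basis. sin (2 * pi * (c \<bullet> x)) *\<^sub>R c) \<bullet> b = (\<Sum>c\<in>Basis. sin (2 * pi * (c \<bullet> y)) *\<^sub>R c) \<bullet> b"
    using eq by (simp_all add: torus_embed_def)
  then have "cos (2 * pi * (x \<bullet> b)) = cos (2 * pi * (y \<bullet> b))" "sin (2 * pi * (x \<bullet> b)) = sin (2 * pi * (y \<bullet> b))"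
    using b(1) by (simp_all only: inner_sum_left_Basis) (simp_all add: inner_commute)
  then obtain n :: int where "2 * pi * (x \<bullet> b) = 2 * pi * (y \<bullet> b) + 2 * pi * n"
    using sin_cos_eq_iff[of "2 * pi * (x \<bullet> b)" "2 * pi * (y \<bullet> b)"] by auto
  then have "2 * pi * (x \<bullet> b) = 2 * pi * (y \<bullet> b + n)"
    by (simp add: distrib_left)
  then have n: "x \<bullet> b = y \<bullet> b + n"
    by simp
  have "0 \<le> x \<bullet> b" "x \<bullet> b \<le> 1" "0 \<le> y \<bullet> b" "y \<bullet> b \<le> 1"
    using x y b(1) by (auto simp: mem_box One_inner_Basis)
  then have "x \<bullet> b \<in> {0, 1} \<and> y \<bullet> b \<in> {0, 1}"
    using n b(2) by (cases "n = 0"; cases "n \<ge> 1"; force)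
  then show "x \<notin> box 0 One" "y \<notin> box 0 One"
    using b(1) by (auto simp: mem_box One_inner_Basis intro!: bexI[of _ b])
qed

text \<open>A function on the cube vanishing on the boundary factors through the image of the torus
  under \<open>torus_embed\<close>, where Stone--Weierstrass applies.\<close>

lemma trig_poly_uniform_approx:
  fixes g :: "'a::euclidean_space \<Rightarrow> complex"
  assumes cont: "continuous_on (cbox 0 One) g" and zero: "\<And>x. x \<notin> box 0 One \<Longrightarrow> g x = 0" and "e > 0"
  obtains p where "p \<in> trig_poly" "\<And>x. x \<in> cbox 0 One \<Longrightarrow> norm (g x - p x) < e"
proof -
  let ?Q = "cbox (0::'a) One"
  let ?K = "torus_embed ` ?Q"
  \<comment> \<open>The chosen preimage does not matter: two different ones are both outside the
    open box, where \<open>g\<close> is 0.\<close>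
  define F where "F = (\<lambda>y. g (inv_into ?Q torus_embed y))"
  have F: "F (torus_embed x) = g x" if "x \<in> ?Q" for x
  proof -
    let ?x = "inv_into ?Q torus_embed (torus_embed x)"
    have "?x \<in> ?Q" "torus_embed ?x = torus_embed x"
      using that by (auto intro: inv_into_into f_inv_into_f)
    then show ?thesis
      using torus_embed_eq_cube[of ?x x] that zero by (cases "?x = x") (auto simp: F_def)
  qed
  have comp: "compact ?K"
    by (intro compact_continuous_image continuous_torus_embed compact_cbox)
  \<comment> \<open>The quotient topology argument: the preimage of a closed set under
    \<open>F\<close> is the continuous image of a compact part of the cube, hence closed.\<close>
  have "continuous_on ?K F"
    unfolding continuous_on_closed_vimage[OF compact_imp_closed[OF comp]]
  proof (intro allI impI)
    fix B :: "complex set" assume "closed B"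
    have "F -` B \<inter> ?K = torus_embed ` (g -` B \<inter> ?Q)"
      using F by auto
    moreover have "compact (g -` B \<inter> ?Q)"
      using cont \<open>closed B\<close> continuous_on_closed_vimage[OF closed_cbox] 
      by (metis Int_lower2 bounded_cbox bounded_subset compact_eq_bounded_closed)
    ultimately show "closed (F -` B \<inter> ?K)"
      by (simp add: compact_imp_closed compact_continuous_image continuous_torus_embed)
  qed
  then obtain q where q: "polynomial_function q" "\<And>y. y \<in> ?K \<Longrightarrow> norm (F y - q y) < e"
    using Stone_Weierstrass_polynomial_function[OF comp _ \<open>e > 0\<close>, of F] by blast
  show thesis
    by (rule that[OF trig_poly_polynomial_embed[OF q(1)]]) (metis F q(2) imageI)
qed

lemma AE_torus_box: "AE x in torus. x \<in> box 0 One \<and> torus_frac x = x"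
proof -
  have "negligible (frontier (cbox (0::'a) One))"
    by (rule negligible_convex_frontier) simp
  then have "AE x in lborel. x \<notin> frontier (cbox (0::'a) One)"
    by (rule AE_lborel_not_negligible)
  then show ?thesis
    unfolding AE_torus_iff using AE_cube_unit_cell
  proof eventually_elim
    case (elim x)
    then show ?case
      using closure_Un_frontier[of "cbox (0::'a) One"] by (auto simp: frontier_def interior_cbox torus_frac_id)
  qed
qed

text \<open>A Lebesgue measurable function is an almost everywhere limit of continuous functions.
  These are modified to be bounded by \<open>N\<close>, so that dominated convergence applies, and
  to vanish outside the open box, so that they are compatible with gluing the faces.\<close>

lemma L2_approx_continuous:
  fixes f :: "'a::euclidean_space \<Rightarrow> complex"
  assumes f: "f \<in> torus_L2" and bound: "\<And>x. norm (f x) \<le> N" and "e > 0"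
  obtains g where "continuous_on UNIV g" "\<And>x. x \<notin> box 0 One \<Longrightarrow> g x = 0" "\<And>x. norm (g x) \<le> N"
    "L2norm (\<lambda>x. f x - g (torus_frac x)) < e"
proof -
  have "0 \<le> N" using bound[of 0] norm_ge_zero order_trans by blast
  have [measurable]: "f \<in> borel_measurable borel" using f by (rule torus_L2_measurable)
  have "f \<in> borel_measurable lebesgue"
    using f by (intro measurable_completion) (simp add: torus_L2_measurable)
  then have "f measurable_on UNIV"
    by (rule lebesgue_measurable_imp_measurable_on) simp
  then obtain Z g where Z: "negligible Z" and g: "\<And>n. continuous_on UNIV (g n)"
    and lim: "\<And>x. x \<notin> Z \<Longrightarrow> (\<lambda>n. g n x) \<longlonglongrightarrow> f x"
    unfolding measurable_on_def by auto
  let ?B = "- box (0::'a) One"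
  \<comment> \<open>Nearest-point projection onto the ball that contains all values of
    \<open>f\<close>: it enforces the bound \<open>N\<close> and leaves the pointwise limit
    unchanged.\<close>
  let ?P = "closest_point (cball (0::complex) N)"
  \<comment> \<open>A cutoff that is 0 outside the open box and, at each point inside it, equals 1
    for all large \<open>n\<close>.\<close>
  define \<rho> where "\<rho> n x = min 1 (real n * infdist x ?B)" for n x
  define h where "h n x = of_real (\<rho> n x) * ?P (g n x)" for n x
  have "0 \<in> ?B" by (auto simp: mem_box)
  then have B: "closed ?B" "?B \<noteq> {}" by auto
  have P: "continuous_on UNIV ?P"
    using \<open>0 \<le> N\<close> by (intro continuous_on_closest_point) auto
  have P_norm: "norm (?P z) \<le> N" for z
    using closest_point_in_set[of "cball 0 N" z] \<open>0 \<le> N\<close> by auto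
  have P_id: "?P z = z" if "norm z \<le> N" for z
    using that by (intro closest_point_self) auto
  have \<rho>: "0 \<le> \<rho> n x" "\<rho> n x \<le> 1" for n x
    by (auto simp: \<rho>_def infdist_nonneg)
  have cont: "continuous_on UNIV (h n)" for n
    unfolding h_def \<rho>_def using continuous_on_compose2[OF P g]
    by (intro continuous_intros) auto
  have zero: "h n x = 0" if "x \<notin> box 0 One" for n x
    using that by (simp add: h_def \<rho>_def)
  have h_norm: "norm (h n x) \<le> N" for n x
    using mult_mono[OF \<rho>(2)[of n x] P_norm[of "g n x"]] \<rho>[of n x]
    by (simp add: h_def norm_mult)
  have h_lim: "(\<lambda>n. h n x) \<longlonglongrightarrow> f x" if "x \<notin> Z" "x \<in> box 0 One" for x
  proof -
    have "infdist x ?B > 0"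
      using infdist_pos_not_in_closed[OF B] that by auto
    then have "\<forall>\<^sub>F n in sequentially. real n * infdist x ?B \<ge> 1"
      using filterlim_at_top_mult_tendsto_pos[OF tendsto_const _ filterlim_real_sequentially, of "infdist x ?B"]
      by (simp add: filterlim_at_top mult.commute)
    then have "\<forall>\<^sub>F n in sequentially. complex_of_real (\<rho> n x) = 1"
      by eventually_elim (simp add: \<rho>_def)
    then have "(\<lambda>n. complex_of_real (\<rho> n x)) \<longlonglongrightarrow> 1"
      by (rule tendsto_eventually)
    moreover have "(\<lambda>n. ?P (g n x)) \<longlonglongrightarrow> ?P (f x)"
      using P lim[OF that(1)] by (rule continuous_on_tendsto_compose) auto
    ultimately show ?thesis
      unfolding h_def using P_id[OF bound[of x]] tendsto_mult by fastforce
  qed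
  have meas [measurable]: "h n \<in> borel_measurable borel" for n
    using cont by (intro borel_measurable_continuous_onI)
  have frac [measurable]: "torus_frac \<in> borel_measurable (borel :: 'a measure)"
    unfolding torus_frac_def by measurable
  have "AE x in lborel. x \<notin> Z"
    using Z by (rule AE_lborel_not_negligible)
  then have "AE x in torus. x \<notin> Z"
    by (auto simp: AE_torus_iff)
  then have ae: "AE x in torus. (\<lambda>n. (norm (f x - h n (torus_frac x)))\<^sup>2) \<longlonglongrightarrow> 0"
    using AE_torus_box
  proof eventually_elim
    case (elim x)
    then have "(\<lambda>n. (norm (f x - h n x))\<^sup>2) \<longlonglongrightarrow> (norm (f x - f x))\<^sup>2"
      by (intro tendsto_intros h_lim) auto
    then show ?case using elim by simp
  qed
  have "(\<lambda>n. \<integral>x. (norm (f x - h n (torus_frac x)))\<^sup>2 \<partial>torus) \<longlonglongrightarrow> (\<integral>x. 0 \<partial>(torus :: 'a measure))"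
  proof (rule integral_dominated_convergence[where w = "\<lambda>x. (2 * N)\<^sup>2"])
    show "integrable torus (\<lambda>x::'a. (2 * N)\<^sup>2)"
      by (rule finite_measure.integrable_const[OF finite_measure_torus])
    show "(\<lambda>x. (norm (f x - h n (torus_frac x)))\<^sup>2) \<in> borel_measurable torus" for n
      by (rule measurable_torus) measurable
    show "AE x in torus. norm ((norm (f x - h n (torus_frac x)))\<^sup>2) \<le> (2 * N)\<^sup>2" for n
    proof (rule AE_I2)
      fix x
      have "norm (f x - h n (torus_frac x)) \<le> 2 * N"
        using norm_triangle_ineq4[of "f x" "h n (torus_frac x)"] bound[of x] h_norm[of n "torus_frac x"] by linarith
      from power_mono[OF this, of 2]
      show "norm ((norm (f x - h n (torus_frac x)))\<^sup>2) \<le> (2 * N)\<^sup>2"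
        by simp
    qed
  qed (use ae in auto)
  then have "(\<lambda>n. L2norm (\<lambda>x. f x - h n (torus_frac x))) \<longlonglongrightarrow> sqrt 0"
    unfolding L2norm_def by (intro tendsto_real_sqrt) simp
  then have "\<forall>\<^sub>F n in sequentially. L2norm (\<lambda>x. f x - h n (torus_frac x)) < e"
    using order_tendstoD(2)[OF _ \<open>e > 0\<close>] by simp
  then obtain n where "L2norm (\<lambda>x. f x - h n (torus_frac x)) < e"
    by (auto simp: eventually_sequentially)
  then show thesis
    using that[OF cont zero h_norm] by blast
qed

text \<open>Three approximations, each costing \<open>e / 3\<close>: truncation of large values, a
  continuous function vanishing outside the open box, and a trigonometric polynomial uniformly close
  to it on the cube.\<close>

lemma trig_poly_dense:
  fixes f :: "'a::euclidean_space \<Rightarrow> complex"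
  assumes f: "f \<in> torus_L2" and "e > 0"
  obtains p where "p \<in> trig_poly" "L2norm (\<lambda>x. f x - p x) < e"
proof -
  have [measurable]: "f \<in> borel_measurable borel" using f by (rule torus_L2_measurable)
  define t where "t n x = (if norm (f x) \<le> real n then f x else 0)" for n :: nat and x
  have t_L2: "t n \<in> torus_L2" for n
  proof (rule torus_L2_bounded)
    show "torus_periodic (t n)"
      using torus_L2_periodic[OF f] by (simp add: t_def torus_periodic_def)
    show "t n \<in> borel_measurable borel"
      unfolding t_def by measurable
    show "norm (t n x) \<le> real n" for x
      by (simp add: t_def)
  qed
  have "(\<lambda>n. \<integral>x. (norm (f x - t n x))\<^sup>2 \<partial>torus) \<longlonglongrightarrow> (\<integral>x. 0 \<partial>(torus :: 'a measure))"
  proof (rule integral_dominated_convergence[where w = "\<lambda>x. (norm (f x))\<^sup>2"])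
    show "integrable torus (\<lambda>x. (norm (f x))\<^sup>2)"
      using f by (rule torus_L2_square_integrable)
    show "(\<lambda>x. (norm (f x - t n x))\<^sup>2) \<in> borel_measurable torus" for n
      by (intro borel_measurable_integrable torus_L2_square_integrable torus_L2_diff f t_L2)
    show "AE x in torus. (\<lambda>n. (norm (f x - t n x))\<^sup>2) \<longlonglongrightarrow> 0"
    proof (rule AE_I2)
      fix x
      have "\<forall>\<^sub>F n in sequentially. norm (f x) \<le> real n"
        by (meson eventually_sequentiallyI order_trans real_nat_ceiling_ge of_nat_mono)
      then show "(\<lambda>n. (norm (f x - t n x))\<^sup>2) \<longlonglongrightarrow> 0"
        by (rule tendsto_eventually[OF eventually_mono]) (simp add: t_def)
    qed
    show "AE x in torus. norm ((norm (f x - t n x))\<^sup>2) \<le> (norm (f x))\<^sup>2" for n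
      by (rule AE_I2) (simp add: t_def)
  qed simp
  then have "(\<lambda>n. L2norm (\<lambda>x. f x - t n x)) \<longlonglongrightarrow> sqrt 0"
    unfolding L2norm_def by (intro tendsto_real_sqrt) simp
  then have "\<forall>\<^sub>F n in sequentially. L2norm (\<lambda>x. f x - t n x) < e / 3"
    by (rule order_tendstoD(2)) (use \<open>e > 0\<close> in simp)
  then obtain n where n: "L2norm (\<lambda>x. f x - t n x) < e / 3"
    by (auto simp: eventually_sequentially)
  have "norm (t n x) \<le> real n" for x
    by (simp add: t_def)
  then obtain g where g: "continuous_on UNIV g" "\<And>x. x \<notin> box 0 One \<Longrightarrow> g x = 0" "\<And>x. norm (g x) \<le> real n"
    "L2norm (\<lambda>x. t n x - g (torus_frac x)) < e / 3"
    using L2_approx_continuous[OF t_L2[of n], of "real n" "e / 3"] \<open>e > 0\<close> by auto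
  obtain p where p: "p \<in> trig_poly" "\<And>x. x \<in> cbox 0 One \<Longrightarrow> norm (g x - p x) < e / 3"
    using trig_poly_uniform_approx[of g "e / 3"] continuous_on_subset[OF g(1)] g(2) \<open>e > 0\<close> by auto
  \<comment> \<open>\<open>g\<close> vanishes outside the open box and is not periodic as it stands;
    composing it with \<open>torus_frac\<close> repeats its values on the cell periodically.\<close>
  have gf_L2: "(\<lambda>x. g (torus_frac x)) \<in> torus_L2"
  proof (rule torus_L2_bounded)
    show "torus_periodic (\<lambda>x. g (torus_frac x))"
      using torus_periodic_frac by (rule torus_periodic_compose)
    have "torus_frac \<in> borel_measurable (borel :: 'a measure)"
      unfolding torus_frac_def by measurable
    then show "(\<lambda>x. g (torus_frac x)) \<in> borel_measurable borel"
      using borel_measurable_continuous_onI[OF g(1)] by (rule measurable_compose)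
  qed (rule g(3))
  have "L2norm (\<lambda>x. g (torus_frac x) - p x) \<le> e / 3"
  proof (rule L2norm_le_const)
    fix x
    have "norm (g (torus_frac x) - p (torus_frac x)) < e / 3"
      using p(2) torus_frac_in_cell[of x] unit_cell_subset_cube by blast
    then show "norm (g (torus_frac x) - p x) \<le> e / 3"
      using torus_periodic_frac_eq[OF torus_L2_periodic[OF trig_poly_L2[OF p(1)]]] by simp
  qed (use gf_L2 p trig_poly_L2 torus_L2_diff \<open>e > 0\<close> in auto)
  then have "L2norm (\<lambda>x. f x - p x) < e"
    using n g(4) L2norm_triangle_diff[OF f t_L2[of n] trig_poly_L2[OF p(1)]]
      L2norm_triangle_diff[OF t_L2[of n] gf_L2 trig_poly_L2[OF p(1)]] by linarith
  then show thesis using that p(1) by blast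
qed

section \<open>Fourier series and the identity of Parseval\<close>

definition fourier_sum :: "'a::euclidean_space set \<Rightarrow> ('a \<Rightarrow> complex) \<Rightarrow> 'a \<Rightarrow> complex" where
  "fourier_sum A f x = (\<Sum>k\<in>A. torus_coeff f k * character k x)"

lemma fourier_sum_L2: "A \<subseteq> {k. lattice_point k} \<Longrightarrow> fourier_sum A f \<in> torus_L2"
  unfolding fourier_sum_def by (intro torus_L2_sum torus_L2_cmult character_L2) auto

lemma torus_coeff_fourier_sum:
  assumes "finite A" "A \<subseteq> {k. lattice_point k}" "l \<in> A"
  shows "torus_coeff (fourier_sum A f) l = torus_coeff f l"
proof -
  have "torus_coeff (fourier_sum A f) l = (\<Sum>k\<in>A. torus_coeff f k * (if k = l then 1 else 0))"
    unfolding fourier_sum_def using assms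
    by (subst torus_coeff_sum) (auto intro!: torus_L2_cmult character_L2 sum.cong simp: torus_coeff_cmult torus_coeff_character subset_iff)
  also have "\<dots> = torus_coeff f l"
    using assms by (simp add: if_distrib cong: if_cong)
  finally show ?thesis .
qed

text \<open>Orthonormality: a partial sum containing all frequencies of \<open>p\<close> reproduces
  \<open>p\<close>. Admitting every larger \<open>A\<close> allows two frequency sets to be united
  in the induction and fits the filter of finite subsets.\<close>

lemma fourier_sum_trig_poly:
  assumes "p \<in> trig_poly"
  obtains B where "finite B" "B \<subseteq> {k. lattice_point k}"
    "\<And>A. finite A \<Longrightarrow> B \<subseteq> A \<Longrightarrow> A \<subseteq> {k. lattice_point k} \<Longrightarrow> fourier_sum A p = p"
proof -
  have "\<exists>B. finite B \<and> B \<subseteq> {k. lattice_point k} \<and>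
    (\<forall>A. finite A \<longrightarrow> B \<subseteq> A \<longrightarrow> A \<subseteq> {k. lattice_point k} \<longrightarrow> fourier_sum A p = p)"
    using assms
  proof induction
    case (char k c)
    show ?case
    proof (intro exI[of _ "{k}"] conjI allI impI)
      fix A assume A: "finite A" "{k} \<subseteq> A" "A \<subseteq> {k. lattice_point k}"
      have "fourier_sum A (\<lambda>x. c * character k x) x = (\<Sum>l\<in>A. (if k = l then c * character k x else 0))" for x
        unfolding fourier_sum_def
        by (rule sum.cong) (use A char in \<open>auto simp: torus_coeff_cmult torus_coeff_character\<close>)
      then show "fourier_sum A (\<lambda>x. c * character k x) = (\<lambda>x. c * character k x)"
        using A by (auto simp: sum.delta')
    qed (use char in auto)
  next
    case (add p q)
    then obtain B C where BC: "finite B" "B \<subseteq> {k. lattice_point k}" "finite C" "C \<subseteq> {k. lattice_point k}"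
      "\<And>A. finite A \<Longrightarrow> B \<subseteq> A \<Longrightarrow> A \<subseteq> {k. lattice_point k} \<Longrightarrow> fourier_sum A p = p"
      "\<And>A. finite A \<Longrightarrow> C \<subseteq> A \<Longrightarrow> A \<subseteq> {k. lattice_point k} \<Longrightarrow> fourier_sum A q = q"
      by blast
    have "fourier_sum A (\<lambda>x. p x + q x) = (\<lambda>x. fourier_sum A p x + fourier_sum A q x)"
      if "A \<subseteq> {k. lattice_point k}" for A
      unfolding fourier_sum_def sum.distrib[symmetric]
      by (intro ext sum.cong) (use that add.hyps in \<open>auto simp: torus_coeff_add trig_poly_L2 distrib_right\<close>)
    then show ?case
      using BC by (intro exI[of _ "B \<union> C"]) auto
  qed
  then show thesis using that by blast
qed

text \<open>The error has zero coefficients on \<open>A\<close>, so it is orthogonal to the partial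
  sum, and Pythagoras applies.\<close>

lemma L2norm_fourier_sum_error:
  assumes f: "f \<in> torus_L2" and A: "finite A" "A \<subseteq> {k. lattice_point k}"
  shows "L2norm (\<lambda>x. f x - fourier_sum A f x) \<le> L2norm f"
proof -
  let ?S = "fourier_sum A f" and ?r = "\<lambda>x. f x - fourier_sum A f x"
  have S: "?S \<in> torus_L2" by (rule fourier_sum_L2[OF A(2)])
  have r: "?r \<in> torus_L2" by (rule torus_L2_diff[OF f S])
  have "(\<integral>x. h x * cnj (?S x) \<partial>torus) = (\<Sum>k\<in>A. cnj (torus_coeff f k) * torus_coeff h k)"
    if h: "h \<in> torus_L2" for h
  proof -
    have "(\<integral>x. h x * cnj (?S x) \<partial>torus)
        = (\<integral>x. (\<Sum>k\<in>A. cnj (torus_coeff f k) * (h x * character (- k) x)) \<partial>torus)"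
      by (simp add: fourier_sum_def cnj_character sum_distrib_left mult_ac)
    also have "\<dots> = (\<Sum>k\<in>A. cnj (torus_coeff f k) * torus_coeff h k)"
      unfolding torus_coeff_def[of h] using A(2) h
      by (subst Bochner_Integration.integral_sum)
        (auto intro!: torus_L2_mult_integrable character_L2 lattice_point_minus integrable_mult_right)
    finally show ?thesis .
  qed
  from this[OF r] have "(\<integral>x. ?r x * cnj (?S x) \<partial>torus) = (\<Sum>k\<in>A. cnj (torus_coeff f k) * torus_coeff ?r k)" .
  also have "\<dots> = 0"
    using A torus_coeff_diff[OF f S] torus_coeff_fourier_sum[OF A]
    by (intro sum.neutral) (auto simp: subset_iff)
  finally have "(L2norm (\<lambda>x. ?r x + ?S x))\<^sup>2 = (L2norm ?r)\<^sup>2 + (L2norm ?S)\<^sup>2"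
    by (subst L2norm_power2_add[OF r S]) simp
  then have "(L2norm ?r)\<^sup>2 \<le> (L2norm f)\<^sup>2"
    by simp
  then show ?thesis
    by (rule power2_le_imp_le) (rule L2norm_nonneg)
qed

text \<open>Once \<open>A\<close> contains the frequencies of a trigonometric polynomial
  \<open>p\<close> near \<open>f\<close>, the error of \<open>f\<close> equals the error of
  \<open>f - p\<close>, and forming the error does not increase the norm.\<close>

lemma fourier_series_L2:
  assumes f: "f \<in> torus_L2"
  shows "((\<lambda>A. L2norm (\<lambda>x. f x - fourier_sum A f x)) \<longlongrightarrow> 0) (finite_subsets_at_top {k. lattice_point k})"
proof (rule tendstoI)
  fix e :: real assume "e > 0"
  then obtain p where p: "p \<in> trig_poly" "L2norm (\<lambda>x. f x - p x) < e"
    using trig_poly_dense[OF f] by blast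
  obtain B where B: "finite B" "B \<subseteq> {k. lattice_point k}"
    "\<And>A. finite A \<Longrightarrow> B \<subseteq> A \<Longrightarrow> A \<subseteq> {k. lattice_point k} \<Longrightarrow> fourier_sum A p = p"
    using fourier_sum_trig_poly[OF p(1)] by blast
  have "L2norm (\<lambda>x. f x - fourier_sum A f x) < e"
    if A: "finite A" "B \<subseteq> A" "A \<subseteq> {k. lattice_point k}" for A
  proof -
    have pL2: "p \<in> torus_L2" by (rule trig_poly_L2[OF p(1)])
    have "fourier_sum A (\<lambda>x. f x - p x) x = fourier_sum A f x - fourier_sum A p x" for x
      unfolding fourier_sum_def sum_subtractf[symmetric]
      by (intro sum.cong refl) (use A(3) in \<open>auto simp: torus_coeff_diff[OF f pL2] left_diff_distrib\<close>)
    then have "L2norm (\<lambda>x. f x - fourier_sum A f x)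
        = L2norm (\<lambda>x. (f x - p x) - fourier_sum A (\<lambda>x. f x - p x) x)"
      by (simp add: B(3)[OF A])
    also have "\<dots> \<le> L2norm (\<lambda>x. f x - p x)"
      by (rule L2norm_fourier_sum_error[OF torus_L2_diff[OF f pL2] A(1,3)])
    finally show ?thesis using p(2) by simp
  qed
  then show "\<forall>\<^sub>F A in finite_subsets_at_top {k. lattice_point k}. dist (L2norm (\<lambda>x. f x - fourier_sum A f x)) 0 < e"
    unfolding eventually_finite_subsets_at_top using B(1,2)
    by (intro exI[of _ B]) (auto simp: L2norm_nonneg)
qed

text \<open>The pairing is bilinear, without conjugation, hence the frequency \<open>- k\<close> in
  the second factor. Only \<open>f\<close> is expanded. The limit along all finite subsets is an
  unconditional sum, so no order of frequencies has to be chosen.\<close>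

theorem parseval:
  assumes f: "f \<in> torus_L2" and g: "g \<in> torus_L2"
  shows "((\<lambda>k. torus_coeff f k * torus_coeff g (- k)) has_sum (\<integral>x. f x * g x \<partial>torus)) {k. lattice_point k}"
  unfolding has_sum_def
proof (rule Lim_transform_eventually)
  let ?F = "finite_subsets_at_top {k::'a. lattice_point k}"
  show "((\<lambda>A. \<integral>x. fourier_sum A f x * g x \<partial>torus) \<longlongrightarrow> (\<integral>x. f x * g x \<partial>torus)) ?F"
  proof (rule tendsto_integral_mult[OF _ f g])
    show "\<forall>\<^sub>F A in ?F. fourier_sum A f \<in> torus_L2"
      by (intro eventually_finite_subsets_at_top_weakI fourier_sum_L2)
    show "((\<lambda>A. L2norm (\<lambda>x. fourier_sum A f x - f x)) \<longlongrightarrow> 0) ?F"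
      using fourier_series_L2[OF f] by (simp add: L2norm_minus_commute)
  qed
  show "\<forall>\<^sub>F A in ?F. (\<integral>x. fourier_sum A f x * g x \<partial>torus) = (\<Sum>k\<in>A. torus_coeff f k * torus_coeff g (- k))"
  proof (rule eventually_finite_subsets_at_top_weakI)
    fix A :: "'a set" assume "finite A" and A: "A \<subseteq> {k. lattice_point k}"
    have "(\<integral>x. fourier_sum A f x * g x \<partial>torus) = (\<integral>x. (\<Sum>k\<in>A. torus_coeff f k * (g x * character k x)) \<partial>torus)"
      by (simp add: fourier_sum_def sum_distrib_right sum_distrib_left mult_ac)
    also have "\<dots> = (\<Sum>k\<in>A. torus_coeff f k * (\<integral>x. g x * character k x \<partial>torus))"
      using A g by (subst Bochner_Integration.integral_sum)
        (auto intro!: torus_L2_mult_integrable character_L2 integrable_mult_right)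
    finally show "(\<integral>x. fourier_sum A f x * g x \<partial>torus) = (\<Sum>k\<in>A. torus_coeff f k * torus_coeff g (- k))"
      by (simp add: torus_coeff_def)
  qed
qed

lemma has_sum_sum:
  fixes f :: "'i \<Rightarrow> 'a \<Rightarrow> 'b::topological_comm_monoid_add"
  shows "(\<And>i. i \<in> I \<Longrightarrow> (f i has_sum S i) A) \<Longrightarrow> ((\<lambda>k. \<Sum>i\<in>I. f i k) has_sum (\<Sum>i\<in>I. S i)) A"
  by (induction I rule: infinite_finite_induct) (auto intro: has_sum_add)

lemma continuous_bounded_cube:
  fixes f :: "'a::euclidean_space \<Rightarrow> 'b::real_normed_vector"
  assumes "continuous_on UNIV f"
  obtains B where "\<And>x. x \<in> cbox 0 One \<Longrightarrow> norm (f x) \<le> B"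
proof -
  have "compact (f ` cbox 0 One)"
    using assms by (intro compact_continuous_image compact_cbox continuous_on_subset[OF assms]) simp
  then have "bounded (f ` cbox 0 One)"
    by (rule compact_imp_bounded)
  then show thesis
    using that unfolding bounded_iff by blast
qed

section \<open>Smooth test functions\<close>

lemma frechet_derivative_eq: "(f has_derivative f') (at x) \<Longrightarrow> frechet_derivative f (at x) = f'"
  using frechet_derivative_at by metis

lemma has_derivative_frechet:
  "f differentiable_on UNIV \<Longrightarrow> (f has_derivative frechet_derivative f (at x)) (at x)"
  by (simp add: differentiable_on_def frechet_derivative_works[symmetric])

lemma differentiable_on_UNIV_I: "(\<And>x. (f has_derivative f' x) (at x)) \<Longrightarrow> f differentiable_on UNIV"
  by (auto simp: differentiable_on_def differentiable_def)

lemma Ck_Suc_imp: "Ck (Suc k) f \<Longrightarrow> Ck k f"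
proof (induction k arbitrary: f)
  case 0 then show ?case by (simp add: differentiable_imp_continuous_on)
next
  case (Suc k)
  have "f differentiable_on UNIV" "Ck k (\<lambda>x. frechet_derivative f (at x) h)" for h
    using Suc.prems Suc.IH by auto
  then show ?case by simp
qed

lemma Ck_add: "Ck k f \<Longrightarrow> Ck k g \<Longrightarrow> Ck k (\<lambda>x. f x + g x)"
proof (induction k arbitrary: f g)
  case 0 then show ?case by (simp add: continuous_on_add)
next
  case (Suc k)
  have "((\<lambda>x. f x + g x) has_derivative (\<lambda>h. frechet_derivative f (at x) h + frechet_derivative g (at x) h)) (at x)" for x
    using Suc.prems by (auto intro!: has_derivative_add has_derivative_frechet)
  from frechet_derivative_eq[OF this] differentiable_on_UNIV_I[OF this]
  show ?case using Suc by simp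
qed

lemma Ck_mult:
  fixes f g :: "'a::real_normed_vector \<Rightarrow> 'b::real_normed_algebra"
  shows "Ck k f \<Longrightarrow> Ck k g \<Longrightarrow> Ck k (\<lambda>x. f x * g x)"
proof (induction k arbitrary: f g)
  case 0 then show ?case by (simp add: continuous_on_mult)
next
  case (Suc k)
  have "((\<lambda>x. f x * g x) has_derivative (\<lambda>h. f x * frechet_derivative g (at x) h + frechet_derivative f (at x) h * g x)) (at x)" for x
    using Suc.prems by (auto intro!: has_derivative_mult has_derivative_frechet)
  from frechet_derivative_eq[OF this] differentiable_on_UNIV_I[OF this]
  show ?case using Suc.prems Suc.prems[THEN Ck_Suc_imp] Suc.IH by (simp add: Ck_add)
qed

lemma Ck_linear_compose: "bounded_linear L \<Longrightarrow> Ck k f \<Longrightarrow> Ck k (\<lambda>x. L (f x))"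
proof (induction k arbitrary: f)
  case 0 then show ?case
    using bounded_linear.continuous_on[of L UNIV f] by simp
next
  case (Suc k)
  have "((\<lambda>x. L (f x)) has_derivative (\<lambda>h. L (frechet_derivative f (at x) h))) (at x)" for x
    by (rule bounded_linear.has_derivative[OF Suc.prems(1) has_derivative_frechet]) (use Suc.prems in simp)
  from frechet_derivative_eq[OF this] differentiable_on_UNIV_I[OF this]
  show ?case using Suc by simp
qed

text \<open>Freezing the driving state is composition with an affine map:
  \<open>(\<theta>, x)\<close> is \<open>(\<theta>, 0)\<close> plus a linear image of
  \<open>x\<close>.\<close>

lemma Ck_affine_compose:
  assumes "bounded_linear A" shows "Ck k f \<Longrightarrow> Ck k (\<lambda>x. f (c + A x))"
proof (induction k arbitrary: f)
  case 0
  have "continuous_on UNIV (\<lambda>x. c + A x)"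
    by (intro continuous_on_add continuous_on_const linear_continuous_on assms)
  then show ?case using 0 continuous_on_compose2[of UNIV f UNIV "\<lambda>x. c + A x"] by simp
next
  case (Suc k)
  have "((\<lambda>x. f (c + A x)) has_derivative (\<lambda>h. frechet_derivative f (at (c + A x)) (A h))) (at x)" for x
  proof (rule has_derivative_compose[where g = f])
    show "((\<lambda>x. c + A x) has_derivative A) (at x)"
      using bounded_linear_imp_has_derivative[OF assms] by (auto intro!: derivative_eq_intros)
  qed (use Suc.prems in \<open>simp add: has_derivative_frechet\<close>)
  note frechet_derivative_eq[OF this] differentiable_on_UNIV_I[OF this]
  moreover have "Ck k (\<lambda>x. frechet_derivative f (at (c + A x)) (A h))" for h
    using Suc.prems Suc.IH[of "\<lambda>y. frechet_derivative f (at y) (A h)"] by simp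
  ultimately show ?case by simp
qed

lemma has_derivative_character:
  "(character k has_derivative (\<lambda>h. 2 * of_real pi * \<i> * of_real (k \<bullet> h) * character k x)) (at x)"
proof -
  have "((\<lambda>x. \<i> * of_real (2 * pi * (k \<bullet> x))) has_derivative (\<lambda>h. \<i> * of_real (2 * pi * (k \<bullet> h)))) (at x)"
    by (intro bounded_linear_imp_has_derivative bounded_linear_compose[OF bounded_linear_mult_right]
        bounded_linear_compose[OF bounded_linear_of_real] bounded_linear_inner_right)
  from has_derivative_compose[OF this has_field_derivative_imp_has_derivative[OF DERIV_exp]]
  have "((\<lambda>x. exp (\<i> * of_real (2 * pi * (k \<bullet> x)))) has_derivative
      (\<lambda>h. exp (\<i> * of_real (2 * pi * (k \<bullet> x))) * (\<i> * of_real (2 * pi * (k \<bullet> h))))) (at x)" .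
  then show ?thesis
    by (simp add: character_def[abs_def] cis_conv_exp mult_ac)
qed

text \<open>The constant \<open>c\<close> is what lets the induction close: a directional derivative
  of a multiple of a character is again a multiple of it.\<close>

lemma Ck_character: "Ck n (\<lambda>x. c * character k x)"
proof (induction n arbitrary: c)
  case 0 show ?case by (simp add: continuous_character continuous_on_mult_left)
next
  case (Suc n)
  have "((\<lambda>x. c * character k x) has_derivative
      (\<lambda>h. c * (2 * of_real pi * \<i> * of_real (k \<bullet> h) * character k x))) (at x)" for x
    by (intro has_derivative_mult_right has_derivative_character)
  from frechet_derivative_eq[OF this] differentiable_on_UNIV_I[OF this]
  show ?case using Suc[of "c * (2 * of_real pi * \<i> * of_real (k \<bullet> h))" for h]
    by (simp add: mult_ac)
qed

lemma smooth_character: "smooth (character k)"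
  using Ck_character[of _ 1 k] by (simp add: smooth_def)

lemma smooth_mult:
  fixes f g :: "'a::real_normed_vector \<Rightarrow> 'b::real_normed_algebra"
  shows "smooth f \<Longrightarrow> smooth g \<Longrightarrow> smooth (\<lambda>x. f x * g x)"
  by (simp add: smooth_def Ck_mult)

lemma smooth_differentiable: "smooth f \<Longrightarrow> f differentiable_on UNIV"
  unfolding smooth_def by (metis Ck.simps(2))

lemma smooth_continuous: "smooth f \<Longrightarrow> continuous_on UNIV f"
  unfolding smooth_def by (metis Ck.simps(1))

lemma smooth_frechet_continuous: "smooth f \<Longrightarrow> continuous_on UNIV (\<lambda>x. frechet_derivative f (at x) h)"
  unfolding smooth_def by (metis Ck.simps)

lemma bounded_linear_component: "bounded_linear (\<lambda>z :: real^'p. complex_of_real (z $ i))"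
  by (intro bounded_linear_compose[OF bounded_linear_of_real] bounded_linear_vec_nth)

section \<open>The Fokker--Planck right-hand side\<close>

text \<open>The test function is \<open>character (- k)\<close>, an eigenfunction of every
  directional derivative.\<close>

lemma weak_deriv_coeff:
  assumes "weak_deriv b f g" and k: "lattice_point k"
  shows "torus_coeff g k = 2 * of_real pi * \<i> * of_real (k \<bullet> b) * torus_coeff f k"
proof -
  have "(\<integral>x. f x * frechet_derivative (character (- k)) (at x) b \<partial>torus) = - (\<integral>x. g x * character (- k) x \<partial>torus)"
    using assms smooth_character torus_periodic_character[OF lattice_point_minus[OF k]]
    unfolding weak_deriv_def by blast
  moreover have "(\<integral>x. f x * frechet_derivative (character (- k)) (at x) b \<partial>torus)
      = (\<integral>x. - (2 * of_real pi * \<i> * of_real (k \<bullet> b)) * (f x * character (- k) x) \<partial>torus)"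
    by (simp add: frechet_derivative_eq[OF has_derivative_character] mult_ac)
  ultimately show ?thesis
    unfolding torus_coeff_def by simp
qed

text \<open>The Fourier transform of the right-hand side of the Fokker--Planck equation with the drift
  integrated by parts, which makes sense for every square-integrable \<open>f\<close>.\<close>

definition fp_coeff :: "real \<Rightarrow> (real^'p \<Rightarrow> real^'p) \<Rightarrow> (real^'p \<Rightarrow> complex) \<Rightarrow> real^'p \<Rightarrow> complex" where
  "fp_coeff \<epsilon> w f k = - of_real (1/2 * \<epsilon>\<^sup>2 * (2 * pi * norm k)\<^sup>2) * torus_coeff f k
     - 2 * of_real pi * \<i> * (\<Sum>i\<in>UNIV. of_real (k $ i) * torus_coeff (\<lambda>x. f x * of_real (w x $ i)) k)"

text \<open>Models the velocity field on one fibre, at a frozen driving state. The estimates must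
  not depend on which fibre it is.\<close>

locale divergence_free_field =
  fixes w :: "real^'p \<Rightarrow> real^'p"
  assumes smooth: "smooth w" and periodic: "torus_periodic w"
    and divergence_free: "\<And>x. (\<Sum>i\<in>UNIV. frechet_derivative w (at x) (axis i 1) $ i) = 0"
begin

abbreviation comp :: "'p \<Rightarrow> real^'p \<Rightarrow> complex" where
  "comp i x \<equiv> of_real (w x $ i)"

lemma smooth_comp: "smooth (comp i)"
  using smooth Ck_linear_compose[OF bounded_linear_component, of _ w i] by (simp add: smooth_def)

lemma frechet_comp: "frechet_derivative (comp i) (at x) h = of_real (frechet_derivative w (at x) h $ i)"
  using frechet_derivative_eq[OF bounded_linear.has_derivative[OF bounded_linear_component
        has_derivative_frechet[OF smooth_differentiable[OF smooth]], of i x]]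
  by simp

lemma periodic_comp: "torus_periodic (comp i)"
  using periodic by (rule torus_periodic_compose)

lemma continuous_comp: "continuous_on UNIV (comp i)"
  by (rule smooth_continuous[OF smooth_comp])

lemma bounded_comp: obtains B where "\<And>i x. x \<in> cbox 0 One \<Longrightarrow> norm (comp i x) \<le> B"
proof -
  obtain B where "\<And>x. x \<in> cbox 0 One \<Longrightarrow> norm (w x) \<le> B"
    using continuous_bounded_cube[OF smooth_continuous[OF smooth]] by blast
  then show thesis
    using that[of B] component_le_norm_cart order_trans by (metis norm_of_real real_norm_def)
qed

lemma mult_comp_L2:
  assumes "f \<in> torus_L2" shows "(\<lambda>x. f x * comp i x) \<in> torus_L2"
proof -
  obtain B where "\<And>i x. x \<in> cbox 0 One \<Longrightarrow> norm (comp i x) \<le> B"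
    using bounded_comp by blast
  then have "(\<lambda>x. comp i x * f x) \<in> torus_L2"
    using assms
    by (intro torus_L2_bounded_mult[of _ B] periodic_comp borel_measurable_continuous_onI continuous_comp) auto
  then show ?thesis by (simp add: mult.commute)
qed

text \<open>Since \<open>w\<close> is divergence-free, testing with \<open>comp i * character (- k)\<close> and summing over \<open>i\<close>
  leaves only the derivative of the character.\<close>

lemma drift_coeff:
  assumes f: "f \<in> torus_L2" and D: "\<And>i. weak_deriv (axis i 1) f (D i)" and k: "lattice_point k"
  shows "(\<Sum>i\<in>UNIV. torus_coeff (\<lambda>x. D i x * comp i x) k)
    = 2 * of_real pi * \<i> * (\<Sum>i\<in>UNIV. of_real (k $ i) * torus_coeff (\<lambda>x. f x * comp i x) k)"
proof -
  let ?c = "character (- k)"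
  let ?d = "\<lambda>i x. f x * (frechet_derivative (comp i) (at x) (axis i 1) * ?c x)"
  let ?e = "\<lambda>i x. - (2 * of_real pi * \<i> * of_real (k $ i)) * (f x * comp i x * ?c x)"
  have c: "?c \<in> torus_L2"
    using k by (intro character_L2 lattice_point_minus)
  have frechet: "frechet_derivative (\<lambda>x. comp i x * ?c x) (at x) (axis i 1)
      = frechet_derivative (comp i) (at x) (axis i 1) * ?c x - 2 * of_real pi * \<i> * of_real (k $ i) * (comp i x * ?c x)" for i x
    using frechet_derivative_eq[OF has_derivative_mult[OF
          has_derivative_frechet[OF smooth_differentiable[OF smooth_comp]] has_derivative_character]]
    by (simp add: inner_axis algebra_simps)
  have int_e: "integrable torus (?e i)" for i
    by (intro integrable_mult_right torus_L2_mult_integrable mult_comp_L2 f c)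
  have prod_int: "integrable torus (\<lambda>x. f x * frechet_derivative (\<lambda>x. comp i x * ?c x) (at x) (axis i 1))" for i
  proof -
    let ?\<phi> = "\<lambda>x. frechet_derivative (\<lambda>x. comp i x * ?c x) (at x) (axis i 1)"
    have cont: "continuous_on UNIV ?\<phi>"
      by (intro smooth_frechet_continuous smooth_mult smooth_comp smooth_character)
    obtain B where B: "\<And>x. x \<in> cbox 0 One \<Longrightarrow> norm (?\<phi> x) \<le> B"
      using continuous_bounded_cube[OF cont] by blast
    show ?thesis
    proof (rule Bochner_Integration.integrable_bound)
      show "integrable torus (\<lambda>x. of_real B * f x)"
        using torus_L2_integrable[OF f] by simp
      show "(\<lambda>x. f x * ?\<phi> x) \<in> borel_measurable torus"
        by (intro measurable_torus borel_measurable_times torus_L2_measurable f borel_measurable_continuous_onI cont)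
      show "AE x in torus. norm (f x * ?\<phi> x) \<le> norm (of_real B * f x)"
      proof (rule AE_I2)
        fix x :: "real^'p" assume "x \<in> space torus"
        then have "norm (?\<phi> x) \<le> \<bar>B\<bar>" using B[of x] by (simp add: space_torus)
        from mult_right_mono[OF this norm_ge_zero[of "f x"]]
        show "norm (f x * ?\<phi> x) \<le> norm (of_real B * f x)"
          by (simp add: norm_mult mult_ac)
      qed
    qed
  qed
  \<comment> \<open>Obtained by subtracting the explicit character term from the full product rule,
    whose integrability was just shown by boundedness of the derivative of the test
    function.\<close>
  then have int_d: "integrable torus (?d i)" for i
  proof -
    have "?d i = (\<lambda>x. f x * frechet_derivative (\<lambda>x. comp i x * ?c x) (at x) (axis i 1) - ?e i x)"
      unfolding frechet by (rule ext) (simp add: algebra_simps)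
    then show ?thesis
      using Bochner_Integration.integrable_diff[OF prod_int int_e] by simp
  qed
  have step: "torus_coeff (\<lambda>x. D i x * comp i x) k
      = 2 * of_real pi * \<i> * of_real (k $ i) * torus_coeff (\<lambda>x. f x * comp i x) k - (\<integral>x. ?d i x \<partial>torus)" for i
  proof -
    have "smooth (\<lambda>x. comp i x * ?c x)"
      by (intro smooth_mult smooth_comp smooth_character)
    moreover have "torus_periodic (\<lambda>x. comp i x * ?c x)"
      using periodic_comp[of i] torus_periodic_character[OF lattice_point_minus[OF k]]
      by (simp add: torus_periodic_def)
    ultimately have test: "(\<integral>x. f x * frechet_derivative (\<lambda>x. comp i x * ?c x) (at x) (axis i 1) \<partial>torus)
        = - torus_coeff (\<lambda>x. D i x * comp i x) k"
      using D[of i] unfolding weak_deriv_def torus_coeff_def by (simp add: mult.assoc)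
    have expand: "(\<integral>x. f x * frechet_derivative (\<lambda>x. comp i x * ?c x) (at x) (axis i 1) \<partial>torus)
        = (\<integral>x. ?d i x + ?e i x \<partial>torus)"
      unfolding frechet by (simp add: algebra_simps)
    have split: "(\<integral>x. ?d i x + ?e i x \<partial>torus) = (\<integral>x. ?d i x \<partial>torus)
        - 2 * of_real pi * \<i> * of_real (k $ i) * torus_coeff (\<lambda>x. f x * comp i x) k"
      unfolding Bochner_Integration.integral_add[OF int_d int_e] torus_coeff_def by simp
    have "a = c - b" if "- a = b - c" for a b c :: complex
      using that by (metis minus_diff_eq minus_minus)
    from this[OF trans[OF trans[OF test[symmetric] expand] split]] show ?thesis .
  qed
  have "(\<Sum>i\<in>UNIV. \<integral>x. ?d i x \<partial>torus) = (\<integral>x. (\<Sum>i\<in>UNIV. ?d i x) \<partial>torus)"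
    using int_d by (intro Bochner_Integration.integral_sum[symmetric])
  also have "(\<lambda>x. \<Sum>i\<in>UNIV. ?d i x) = (\<lambda>x. 0)"
  proof
    fix x
    have "(\<Sum>i\<in>UNIV. ?d i x) = f x * ?c x * of_real (\<Sum>i\<in>UNIV. frechet_derivative w (at x) (axis i 1) $ i)"
      by (simp add: frechet_comp sum_distrib_left mult_ac)
    then show "(\<Sum>i\<in>UNIV. ?d i x) = 0"
      by (simp add: divergence_free)
  qed
  finally show ?thesis
    by (simp add: step sum_subtractf sum_distrib_left mult.assoc)
qed

text \<open>Used with two kinds of \<open>g\<close>: characters give the Fourier coefficients of the
  right-hand side, and the conjugate of \<open>f\<close> gives the energy balance.\<close>

lemma fokker_planck_rhs_integral:
  assumes "\<And>i. weak_deriv (axis i 1) f (D i)" "\<And>i. weak_deriv (axis i 1) (D i) (D2 i)"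
    and r: "r \<in> torus_L2"
    and ae: "AE x in torus. r x = of_real (1/2 * \<epsilon>\<^sup>2) * (\<Sum>i\<in>UNIV. D2 i x) - (\<Sum>i\<in>UNIV. D i x * comp i x)"
    and g: "g \<in> torus_L2"
  shows "(\<integral>x. r x * g x \<partial>torus) = of_real (1/2 * \<epsilon>\<^sup>2) * (\<Sum>i\<in>UNIV. \<integral>x. D2 i x * g x \<partial>torus)
      - (\<Sum>i\<in>UNIV. \<integral>x. D i x * comp i x * g x \<partial>torus)"
proof -
  have D: "D i \<in> torus_L2" "D2 i \<in> torus_L2" for i
    using assms(2) by (auto simp: weak_deriv_def)
  have int: "integrable torus (\<lambda>x. D2 i x * g x)" "integrable torus (\<lambda>x. D i x * comp i x * g x)" for i
    by (intro torus_L2_mult_integrable mult_comp_L2 D g)+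
  let ?R = "\<lambda>x. of_real (1/2 * \<epsilon>\<^sup>2) * (\<Sum>i\<in>UNIV. D2 i x * g x) - (\<Sum>i\<in>UNIV. D i x * comp i x * g x)"
  have intR: "integrable torus ?R"
    using int by (intro Bochner_Integration.integrable_diff integrable_mult_right Bochner_Integration.integrable_sum) auto
  have "(\<integral>x. r x * g x \<partial>torus) = (\<integral>x. ?R x \<partial>torus)"
  proof (rule integral_cong_AE)
    show "(\<lambda>x. r x * g x) \<in> borel_measurable torus"
      by (intro borel_measurable_integrable torus_L2_mult_integrable r g)
    show "?R \<in> borel_measurable torus"
      using intR by (rule borel_measurable_integrable)
    show "AE x in torus. r x * g x = ?R x"
      using ae by eventually_elim (simp add: left_diff_distrib sum_distrib_right mult.assoc)
  qed
  also have "\<dots> = of_real (1/2 * \<epsilon>\<^sup>2) * (\<Sum>i\<in>UNIV. \<integral>x. D2 i x * g x \<partial>torus)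
      - (\<Sum>i\<in>UNIV. \<integral>x. D i x * comp i x * g x \<partial>torus)"
    using int
    by (subst Bochner_Integration.integral_diff)
      (auto intro!: integrable_mult_right Bochner_Integration.integrable_sum simp: Bochner_Integration.integral_sum)
  finally show ?thesis .
qed

text \<open>Two weak derivatives contribute the squares of the frequencies, which add up to the
  squared norm of \<open>k\<close>; \<open>drift_coeff\<close> moves the derivative off
  \<open>f\<close> in the drift. The result no longer mentions derivatives of \<open>f\<close>, so
  it can be followed to time 0.\<close>

lemma fokker_planck_rhs_coeff:
  assumes rhs: "fokker_planck_rhs \<epsilon> w f r" and k: "lattice_point k"
  shows "torus_coeff r k = fp_coeff \<epsilon> w f k"
proof -
  obtain D D2 where D: "\<And>i. weak_deriv (axis i 1) f (D i)" and D2: "\<And>i. weak_deriv (axis i 1) (D i) (D2 i)"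
    and r: "r \<in> torus_L2"
    and ae: "AE x in torus. r x = of_real (1/2 * \<epsilon>\<^sup>2) * (\<Sum>i\<in>UNIV. D2 i x) - (\<Sum>i\<in>UNIV. D i x * comp i x)"
    using rhs unfolding fokker_planck_rhs_def by blast
  have f: "f \<in> torus_L2" using D by (simp add: weak_deriv_def)
  have "torus_coeff (D2 i) k = - of_real ((2 * pi)\<^sup>2 * (k $ i)\<^sup>2) * torus_coeff f k" for i
    unfolding weak_deriv_coeff[OF D2 k] weak_deriv_coeff[OF D k]
    by (simp add: inner_axis power2_eq_square algebra_simps)
  then have "(\<Sum>i\<in>UNIV. torus_coeff (D2 i) k) = - of_real ((2 * pi * norm k)\<^sup>2) * torus_coeff f k"
    by (simp add: norm_vec_def L2_set_def power_mult_distrib sum_nonneg sum_distrib_left sum_distrib_right sum_negf)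
  moreover have "torus_coeff r k = of_real (1/2 * \<epsilon>\<^sup>2) * (\<Sum>i\<in>UNIV. torus_coeff (D2 i) k)
      - (\<Sum>i\<in>UNIV. torus_coeff (\<lambda>x. D i x * comp i x) k)"
    unfolding torus_coeff_def
    by (rule fokker_planck_rhs_integral[OF D D2 r ae character_L2[OF lattice_point_minus[OF k]]])
  ultimately show ?thesis
    unfolding drift_coeff[OF f D k] fp_coeff_def by simp
qed

text \<open>By Parseval, the diffusion term is a negative sum and the drift term equals minus its own
  conjugate.\<close>

lemma fokker_planck_rhs_dissipative:
  assumes rhs: "fokker_planck_rhs \<epsilon> w f r"
  shows "Re (\<integral>x. r x * cnj (f x) \<partial>torus) \<le> 0"
proof -
  obtain D D2 where D: "\<And>i. weak_deriv (axis i 1) f (D i)" and D2: "\<And>i. weak_deriv (axis i 1) (D i) (D2 i)"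
    and r: "r \<in> torus_L2"
    and ae: "AE x in torus. r x = of_real (1/2 * \<epsilon>\<^sup>2) * (\<Sum>i\<in>UNIV. D2 i x) - (\<Sum>i\<in>UNIV. D i x * comp i x)"
    using rhs unfolding fokker_planck_rhs_def by blast
  have f: "f \<in> torus_L2" using D by (simp add: weak_deriv_def)
  have DL2: "D i \<in> torus_L2" "D2 i \<in> torus_L2" for i
    using D2 by (auto simp: weak_deriv_def)
  let ?L = "{k::real^'p. lattice_point k}"
  have cnj: "torus_coeff (\<lambda>x. cnj (h x)) (- k) = cnj (torus_coeff h k)" for h :: "real^'p \<Rightarrow> complex" and k
    by (simp add: cnj_torus_coeff)
  have diffusion: "Re (\<integral>x. D2 i x * cnj (f x) \<partial>torus) \<le> 0" for i
  proof -
    have "((\<lambda>k. Re (torus_coeff (D2 i) k * torus_coeff (\<lambda>x. cnj (f x)) (- k)))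
        has_sum Re (\<integral>x. D2 i x * cnj (f x) \<partial>torus)) ?L"
      by (intro has_sum_Re parseval DL2 torus_L2_cnj f)
    moreover have "Re (torus_coeff (D2 i) k * torus_coeff (\<lambda>x. cnj (f x)) (- k)) \<le> 0" if "k \<in> ?L" for k
    proof -
      have k: "lattice_point k" using that by simp
      have "torus_coeff (D2 i) k * torus_coeff (\<lambda>x. cnj (f x)) (- k)
          = of_real (- ((2 * pi * (k $ i))\<^sup>2)) * (torus_coeff f k * cnj (torus_coeff f k))"
        unfolding weak_deriv_coeff[OF D2 k] weak_deriv_coeff[OF D k] cnj
        by (simp add: inner_axis power2_eq_square algebra_simps)
      also have "\<dots> = of_real (- ((2 * pi * (k $ i))\<^sup>2) * (norm (torus_coeff f k))\<^sup>2)"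
        by (simp add: complex_norm_square[symmetric])
      finally show ?thesis by simp
    qed
    ultimately show ?thesis
      using has_sum_mono[of _ ?L _ "\<lambda>_. 0" "0::real"] has_sum_0 by fastforce
  qed
  \<comment> \<open>Weak derivatives may be tested only with smooth functions, and the conjugate of
    \<open>f\<close> need not be smooth. The integration by parts that makes the drift skew is
    therefore done on the Fourier side.\<close>
  define X where "X = (\<Sum>i\<in>UNIV. \<integral>x. D i x * comp i x * cnj (f x) \<partial>torus)"
  have sum1: "((\<lambda>k. \<Sum>i\<in>UNIV. torus_coeff (\<lambda>x. D i x * comp i x) k * torus_coeff (\<lambda>x. cnj (f x)) (- k)) has_sum X) ?L"
    unfolding X_def by (intro has_sum_sum parseval mult_comp_L2 torus_L2_cnj f DL2)
  have sum2: "((\<lambda>k. \<Sum>i\<in>UNIV. torus_coeff (\<lambda>x. f x * comp i x) k * torus_coeff (\<lambda>x. cnj (D i x)) (- k))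
      has_sum (\<Sum>i\<in>UNIV. \<integral>x. f x * comp i x * cnj (D i x) \<partial>torus)) ?L"
    by (intro has_sum_sum parseval mult_comp_L2 torus_L2_cnj f DL2)
  have cnj_X: "(\<Sum>i\<in>UNIV. \<integral>x. f x * comp i x * cnj (D i x) \<partial>torus) = cnj X"
    unfolding X_def by (simp add: Bochner_Integration.integral_cnj[symmetric] mult_ac del: Bochner_Integration.integral_cnj)
  have terms: "(\<Sum>i\<in>UNIV. torus_coeff (\<lambda>x. f x * comp i x) k * torus_coeff (\<lambda>x. cnj (D i x)) (- k))
      = - (\<Sum>i\<in>UNIV. torus_coeff (\<lambda>x. D i x * comp i x) k * torus_coeff (\<lambda>x. cnj (f x)) (- k))"
    if "k \<in> ?L" for k
  proof -
    have k: "lattice_point k" using that by simp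
    show ?thesis
      unfolding cnj weak_deriv_coeff[OF D k] sum_distrib_right[symmetric] drift_coeff[OF f D k]
      by (simp add: inner_axis sum_distrib_left sum_distrib_right sum_negf[symmetric] mult_ac)
  qed
  have "cnj X = - X"
    by (rule has_sum_unique[OF iffD1[OF has_sum_cong[OF terms] sum2[unfolded cnj_X]] has_sum_uminusI[OF sum1]])
  then have "Re X = 0"
    by (simp add: complex_eq_iff)
  moreover have "Re (\<Sum>i\<in>UNIV. \<integral>x. D2 i x * cnj (f x) \<partial>torus) \<le> 0"
    using diffusion by (simp add: sum_nonpos)
  ultimately show ?thesis
    unfolding fokker_planck_rhs_integral[OF D D2 r ae torus_L2_cnj[OF f]] X_def[symmetric]
    by (simp add: mult_nonneg_nonpos)
qed

end

section \<open>Fourier coefficients of Fokker--Planck solutions\<close>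

text \<open>A bound on the whole space is wanted because the driving state
  \<open>\<theta> + t *\<^sub>R \<alpha>\<close> leaves the unit cube.\<close>

lemma continuous_periodic_bounded:
  fixes f :: "'a::euclidean_space \<Rightarrow> 'b::real_normed_vector"
  assumes "continuous_on UNIV f" "torus_periodic f"
  obtains B where "\<And>x. norm (f x) \<le> B"
proof -
  obtain B where B: "\<And>x. x \<in> cbox 0 One \<Longrightarrow> norm (f x) \<le> B"
    using continuous_bounded_cube[OF assms(1)] by blast
  have "norm (f x) \<le> B" for x
    using B[of "torus_frac x"] torus_frac_in_cell[of x] unit_cell_subset_cube
    by (auto simp: torus_periodic_frac_eq[OF assms(2)])
  then show thesis by (rule that)
qed

lemma norm_torus_coeff_le:
  assumes "f \<in> torus_L2" "lattice_point k"
  shows "norm (torus_coeff f k) \<le> L2norm f"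
  using norm_integral_mult_le[OF assms(1) character_L2[OF lattice_point_minus[OF assms(2)]]]
  by (simp add: torus_coeff_def L2norm_character)

lemma L2norm_bounded_mult:
  assumes "(\<lambda>x. f x * h x) \<in> torus_L2" "f \<in> torus_L2" "\<And>x. x \<in> cbox 0 One \<Longrightarrow> norm (h x) \<le> B"
  shows "L2norm (\<lambda>x. f x * h x) \<le> B * L2norm f"
proof -
  have "norm (h 0) \<le> B"
    by (rule assms(3)) (simp add: mem_box One_inner_Basis)
  then have "0 \<le> B"
    using norm_ge_zero[of "h 0"] by linarith
  have "L2norm (\<lambda>x. f x * h x) \<le> L2norm (\<lambda>x. of_real B * f x)"
  proof (rule L2norm_mono)
    show "norm (f x * h x) \<le> norm (of_real B * f x)" if "x \<in> cbox 0 One" for x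
      using mult_left_mono[OF assms(3)[OF that] norm_ge_zero[of "f x"]] \<open>0 \<le> B\<close>
      by (simp add: norm_mult mult_ac)
  qed (use assms torus_L2_cmult in auto)
  then show ?thesis
    using \<open>0 \<le> B\<close> by (simp add: L2norm_cmult)
qed

lemma divergence_free_slice:
  assumes "smooth v" "torus_periodic v" "divergence_free_snd v"
  shows "divergence_free_field (\<lambda>x. v (\<theta>, x))"
proof
  have "bounded_linear (\<lambda>x::real^'b. (0::real^'a, x))"
    by (intro bounded_linear_Pair bounded_linear_zero bounded_linear_ident)
  from Ck_affine_compose[OF this, of _ v "(\<theta>, 0)"] show "smooth (\<lambda>x. v (\<theta>, x))"
    using assms(1) by (simp add: smooth_def)
  show "torus_periodic (\<lambda>x. v (\<theta>, x))"
    unfolding torus_periodic_def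
  proof (intro allI ballI)
    fix x b :: "real^'b" assume "b \<in> Basis"
    then have "(0, b) \<in> (Basis :: ((real^'a) \<times> (real^'b)) set)"
      by (simp add: Basis_prod_def)
    then have "v ((\<theta>, x) + (0, b)) = v (\<theta>, x)"
      using assms(2) unfolding torus_periodic_def by blast
    then show "v (\<theta>, x + b) = v (\<theta>, x)" by simp
  qed
  show "(\<Sum>i\<in>UNIV. frechet_derivative (\<lambda>x. v (\<theta>, x)) (at x) (axis i 1) $ i) = 0" for x
    using assms(3) by (simp add: divergence_free_snd_def)
qed

text \<open>The norm bound for \<open>fp_coeff\<close> as a functional on square-integrable
  functions: a coefficient is at most the norm, and multiplication by a velocity component costs a
  factor \<open>B\<close>. With \<open>B\<close> bounding \<open>v\<close> everywhere, it is the
  same for all fibres and times.\<close>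

definition fp_bound :: "real \<Rightarrow> real \<Rightarrow> real^'p \<Rightarrow> real" where
  "fp_bound \<epsilon> B k = 1/2 * \<epsilon>\<^sup>2 * (2 * pi * norm k)\<^sup>2 + 2 * pi * (\<Sum>i\<in>UNIV. \<bar>k $ i\<bar> * B)"

lemma (in divergence_free_field) norm_fp_coeff_le:
  assumes f: "f \<in> torus_L2" and k: "lattice_point k" and B: "\<And>x. norm (w x) \<le> B"
  shows "norm (fp_coeff \<epsilon> w f k) \<le> fp_bound \<epsilon> B k * L2norm f"
proof -
  have "norm (comp i x) \<le> B" for i x
    using order_trans[OF component_le_norm_cart B, of x i] by simp
  then have c: "norm (torus_coeff (\<lambda>x. f x * comp i x) k) \<le> B * L2norm f" for i
    by (intro order_trans[OF norm_torus_coeff_le[OF mult_comp_L2[OF f] k]]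
        L2norm_bounded_mult mult_comp_L2 f)
  have "norm (\<Sum>i\<in>UNIV. of_real (k $ i) * torus_coeff (\<lambda>x. f x * comp i x) k)
      \<le> (\<Sum>i\<in>UNIV. \<bar>k $ i\<bar> * (B * L2norm f))"
    by (intro sum_norm_le) (simp add: norm_mult mult_left_mono c)
  then have "norm (2 * of_real pi * \<i> * (\<Sum>i\<in>UNIV. of_real (k $ i) * torus_coeff (\<lambda>x. f x * comp i x) k))
      \<le> 2 * pi * (\<Sum>i\<in>UNIV. \<bar>k $ i\<bar> * (B * L2norm f))"
    by (simp add: norm_mult)
  moreover have "norm (- of_real (1/2 * \<epsilon>\<^sup>2 * (2 * pi * norm k)\<^sup>2) * torus_coeff f k)
      \<le> 1/2 * \<epsilon>\<^sup>2 * (2 * pi * norm k)\<^sup>2 * L2norm f"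
    unfolding norm_mult norm_minus_cancel norm_of_real
    using mult_left_mono[OF norm_torus_coeff_le[OF f k], of "1/2 * \<epsilon>\<^sup>2 * (2 * pi * norm k)\<^sup>2"] by simp
  ultimately have "norm (fp_coeff \<epsilon> w f k)
      \<le> 1/2 * \<epsilon>\<^sup>2 * (2 * pi * norm k)\<^sup>2 * L2norm f + 2 * pi * (\<Sum>i\<in>UNIV. \<bar>k $ i\<bar> * (B * L2norm f))"
    unfolding fp_coeff_def by (intro order_trans[OF norm_triangle_ineq4] add_mono)
  also have "\<dots> = fp_bound \<epsilon> B k * L2norm f"
    by (simp add: fp_bound_def distrib_right sum_distrib_right mult.assoc)
  finally show ?thesis .
qed

text \<open>The situation on a single fibre. It is interpreted later for almost every
  \<open>\<theta>\<close>, with the slice of \<open>f\<close> at \<open>\<theta>\<close> as initial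
  value.\<close>

locale fp_solution =
  fixes \<epsilon> :: real and \<alpha> :: "real^'d" and v :: "(real^'d) \<times> (real^'p) \<Rightarrow> real^'p"
    and \<theta> :: "real^'d" and f0 :: "real^'p \<Rightarrow> complex" and u :: "real \<Rightarrow> real^'p \<Rightarrow> complex"
  assumes smooth_v: "smooth v" and periodic_v: "torus_periodic v" and div_v: "divergence_free_snd v"
    and solution: "fokker_planck_solution \<epsilon> \<alpha> v \<theta> f0 u" and f0: "f0 \<in> torus_L2"
begin

abbreviation field :: "real \<Rightarrow> real^'p \<Rightarrow> real^'p" where
  "field t x \<equiv> v (\<theta> + t *\<^sub>R \<alpha>, x)"

lemma div_field: "divergence_free_field (field t)"
  by (rule divergence_free_slice[OF smooth_v periodic_v div_v])

lemma u_L2: "0 \<le> t \<Longrightarrow> u t \<in> torus_L2"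
  using solution by (simp add: fokker_planck_solution_def)

lemma u_continuous: "0 \<le> t \<Longrightarrow> ((\<lambda>s. L2norm (\<lambda>x. u s x - u t x)) \<longlongrightarrow> 0) (at t within {0..})"
  using solution by (simp add: fokker_planck_solution_def)

lemma u_derivative:
  assumes "0 < t"
  obtains r where "fokker_planck_rhs \<epsilon> (field t) (u t) r"
    "((\<lambda>s. L2norm (\<lambda>x. (u s x - u t x) / of_real (s - t) - r x)) \<longlongrightarrow> 0) (at t)"
  using solution assms unfolding fokker_planck_solution_def by blast

lemma u_0: "AE x in torus. u 0 x = f0 x"
  using solution by (simp add: fokker_planck_solution_def)

lemma L2norm_u_0: "L2norm (u 0) = L2norm f0"
  using u_0 by (intro L2norm_cong_AE torus_L2_measurable u_L2 f0) auto

lemma eventually_pos_at: "0 < t \<Longrightarrow> \<forall>\<^sub>F s in at t. 0 < (s::real)"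
  by (intro eventually_at_in_open'[of "{0<..}", simplified]) auto

lemma quotient_L2:
  "0 \<le> s \<Longrightarrow> 0 \<le> t \<Longrightarrow> (\<lambda>x. (u s x - u t x) / of_real (s - t)) \<in> torus_L2"
  using torus_L2_cmult[OF torus_L2_diff[OF u_L2[of s] u_L2[of t]], of "1 / of_real (s - t)"] by simp

lemma eventually_quotient_L2:
  assumes "0 < t"
  shows "\<forall>\<^sub>F s in at t. (\<lambda>x. (u s x - u t x) / of_real (s - t)) \<in> torus_L2"
  using eventually_pos_at[OF assms] by eventually_elim (rule quotient_L2; use assms in simp)

lemma L2norm_power2_derivative:
  assumes "0 < t"
  shows "\<exists>D\<le>0. ((\<lambda>s. (L2norm (u s))\<^sup>2) has_real_derivative D) (at t)"
proof -
  obtain r where r: "fokker_planck_rhs \<epsilon> (field t) (u t) r"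
    "((\<lambda>s. L2norm (\<lambda>x. (u s x - u t x) / of_real (s - t) - r x)) \<longlongrightarrow> 0) (at t)"
    using u_derivative[OF assms] .
  let ?q = "\<lambda>s x. (u s x - u t x) / of_real (s - t)"
  have rL2: "r \<in> torus_L2" using r(1) by (simp add: fokker_planck_rhs_def)
  have ut: "u t \<in> torus_L2" using assms by (simp add: u_L2)
  \<comment> \<open>Expanding the squared norm of \<open>u s\<close> around \<open>u t\<close>
    writes its difference quotient in this form. The quotients \<open>?q s\<close> converge in norm,
    so the first summand vanishes and the second tends to the pairing that dissipativity
    controls.\<close>
  have "((\<lambda>s. (s - t) * (L2norm (?q s))\<^sup>2 + 2 * Re (\<integral>x. ?q s x * cnj (u t x) \<partial>torus))
      \<longlongrightarrow> (t - t) * (L2norm r)\<^sup>2 + 2 * Re (\<integral>x. r x * cnj (u t x) \<partial>torus)) (at t)"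
    by (intro tendsto_intros tendsto_L2norm[OF eventually_quotient_L2[OF assms] rL2 r(2)]
        tendsto_integral_mult[OF eventually_quotient_L2[OF assms] rL2 torus_L2_cnj[OF ut] r(2)])
  moreover have "\<forall>\<^sub>F s in at t. (s - t) * (L2norm (?q s))\<^sup>2 + 2 * Re (\<integral>x. ?q s x * cnj (u t x) \<partial>torus)
      = ((L2norm (u s))\<^sup>2 - (L2norm (u t))\<^sup>2) / (s - t)"
    using eventually_pos_at[OF assms] eventually_neq_at_within[of t]
  proof eventually_elim
    case (elim s)
    let ?d = "\<lambda>x. u s x - u t x"
    have d: "?d \<in> torus_L2" using elim assms by (intro torus_L2_diff u_L2) auto
    let ?c = "\<integral>x. ?d x * cnj (u t x) \<partial>torus"
    have square: "(L2norm (u s))\<^sup>2 = (L2norm ?d)\<^sup>2 + 2 * Re ?c + (L2norm (u t))\<^sup>2"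
      using L2norm_power2_add[OF d ut] by (simp only: diff_add_cancel)
    have norm_q: "L2norm (?q s) = L2norm ?d / \<bar>s - t\<bar>"
      using L2norm_cmult[of "1 / of_real (s - t)" ?d] by (simp add: norm_divide del: of_real_diff)
    have inner_q: "(\<integral>x. ?q s x * cnj (u t x) \<partial>torus) = ?c / of_real (s - t)"
      by (simp only: times_divide_eq_left integral_divide_zero)
    have "h * (n / \<bar>h\<bar>)\<^sup>2 + 2 * Re (c / of_real h) = (n\<^sup>2 + 2 * Re c + m - m) / h" for h n m :: real and c
      by (simp add: power2_eq_square add_divide_distrib)
    then show ?case
      unfolding square norm_q inner_q .
  qed
  ultimately have "((\<lambda>s. (L2norm (u s))\<^sup>2) has_real_derivative 2 * Re (\<integral>x. r x * cnj (u t x) \<partial>torus)) (at t)"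
    unfolding has_field_derivative_iff by (simp add: tendsto_cong)
  then show ?thesis
    using divergence_free_field.fokker_planck_rhs_dissipative[OF div_field r(1)]
    by (intro exI[of _ "2 * Re (\<integral>x. r x * cnj (u t x) \<partial>torus)"]) simp
qed

lemma continuous_L2norm: "continuous_on {0..} (\<lambda>s. L2norm (u s))"
  unfolding continuous_on_def
proof
  fix t :: real assume "t \<in> {0..}"
  then show "((\<lambda>s. L2norm (u s)) \<longlongrightarrow> L2norm (u t)) (at t within {0..})"
    by (intro tendsto_L2norm u_continuous u_L2) (auto simp: eventually_at_filter u_L2)
qed

lemma L2norm_u_le:
  assumes "0 \<le> t" shows "L2norm (u t) \<le> L2norm f0"
proof (rule power2_le_imp_le)
  have "(L2norm (u t))\<^sup>2 \<le> (L2norm (u 0))\<^sup>2"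
  \<comment> \<open>Differentiability is known only for positive times; continuity of the norm
    carries the monotonicity to the endpoint 0.\<close>
  proof (rule DERIV_nonpos_imp_decreasing_open[OF assms])
    show "continuous_on {0..t} (\<lambda>s. (L2norm (u s))\<^sup>2)"
      by (intro continuous_on_power continuous_on_subset[OF continuous_L2norm]) auto
  qed (use L2norm_power2_derivative in blast)
  then show "(L2norm (u t))\<^sup>2 \<le> (L2norm f0)\<^sup>2"
    by (simp add: L2norm_u_0)
qed (rule L2norm_nonneg)

context
  fixes k :: "real^'p" assumes k: "lattice_point k"
begin

lemma torus_coeff_u_0: "torus_coeff (u 0) k = torus_coeff f0 k"
  unfolding torus_coeff_def
proof (rule integral_cong_AE)
  show "(\<lambda>x. u 0 x * character (- k) x) \<in> borel_measurable torus"
    "(\<lambda>x. f0 x * character (- k) x) \<in> borel_measurable torus"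
    by (intro borel_measurable_integrable torus_L2_mult_integrable u_L2 f0 character_L2 lattice_point_minus k; simp)+
  show "AE x in torus. u 0 x * character (- k) x = f0 x * character (- k) x"
    using u_0 by eventually_elim simp
qed

lemma continuous_coeff: "continuous_on {0..} (\<lambda>s. torus_coeff (u s) k)"
  unfolding continuous_on_def torus_coeff_def
proof
  fix t :: real assume "t \<in> {0..}"
  then show "((\<lambda>s. \<integral>x. u s x * character (- k) x \<partial>torus) \<longlongrightarrow> (\<integral>x. u t x * character (- k) x \<partial>torus)) (at t within {0..})"
    by (intro tendsto_integral_mult u_continuous u_L2 character_L2 lattice_point_minus k)
      (auto simp: eventually_at_filter u_L2)
qed

lemma coeff_derivative:
  assumes "0 < t"
  shows "((\<lambda>s. torus_coeff (u s) k) has_vector_derivative fp_coeff \<epsilon> (field t) (u t) k) (at t)"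
proof -
  obtain r where r: "fokker_planck_rhs \<epsilon> (field t) (u t) r"
    "((\<lambda>s. L2norm (\<lambda>x. (u s x - u t x) / of_real (s - t) - r x)) \<longlongrightarrow> 0) (at t)"
    using u_derivative[OF assms] .
  let ?q = "\<lambda>s x. (u s x - u t x) / of_real (s - t)"
  have rL2: "r \<in> torus_L2" using r(1) by (simp add: fokker_planck_rhs_def)
  have "((\<lambda>s. torus_coeff (?q s) k) \<longlongrightarrow> torus_coeff r k) (at t)"
    unfolding torus_coeff_def
    by (intro tendsto_integral_mult eventually_quotient_L2 assms rL2 character_L2 lattice_point_minus k r(2))
  then have "((\<lambda>s. norm (torus_coeff (?q s) k - torus_coeff r k)) \<longlongrightarrow> 0) (at t)"
    by (intro tendsto_norm_zero LIM_zero)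
  moreover have "\<forall>\<^sub>F s in at t. norm (torus_coeff (?q s) k - torus_coeff r k)
      = norm (torus_coeff (u s) k - torus_coeff (u t) k - (s - t) *\<^sub>R torus_coeff r k) / norm (s - t)"
    using eventually_pos_at[OF assms] eventually_neq_at_within[of t]
  proof eventually_elim
    case (elim s)
    have "torus_coeff (?q s) k = (torus_coeff (u s) k - torus_coeff (u t) k) / of_real (s - t)"
      using elim assms torus_coeff_cmult[of "1 / of_real (s - t)" "\<lambda>x. u s x - u t x" k]
      by (simp add: torus_coeff_diff u_L2 k del: of_real_diff)
    then have "torus_coeff (?q s) k - torus_coeff r k
        = (torus_coeff (u s) k - torus_coeff (u t) k - (s - t) *\<^sub>R torus_coeff r k) / of_real (s - t)"
      using elim by (simp add: diff_divide_distrib scaleR_conv_of_real del: of_real_diff)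
    then show ?case
      by (simp add: norm_divide del: of_real_diff)
  qed
  ultimately have "((\<lambda>s. torus_coeff (u s) k) has_vector_derivative torus_coeff r k) (at t)"
    unfolding has_vector_derivative_def has_derivative_iff_norm
    by (auto simp: tendsto_cong intro: bounded_linear_scaleR_left)
  then show ?thesis
    by (simp add: divergence_free_field.fokker_planck_rhs_coeff[OF div_field r(1) k])
qed

text \<open>Complex values allow the mean value theorem only as an inequality. Subtracting the
  linear function with slope \<open>z\<close> adapts it to both uses: \<open>z = 0\<close> bounds
  the quotients, and \<open>z\<close> equal to the expected derivative identifies their
  limit.\<close>

lemma coeff_mean_value:
  assumes "0 < t"
  obtains s where "0 < s" "s < t"
    "norm (torus_coeff (u t) k - torus_coeff f0 k - t *\<^sub>R z) \<le> t * norm (fp_coeff \<epsilon> (field s) (u s) k - z)"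
proof -
  have "\<exists>s\<in>{0<..<t}. norm ((torus_coeff (u t) k - t *\<^sub>R z) - (torus_coeff (u 0) k - 0 *\<^sub>R z))
      \<le> norm ((t - 0) *\<^sub>R (fp_coeff \<epsilon> (field s) (u s) k - z))"
  proof (rule mvt_general[OF assms])
    show "continuous_on {0..t} (\<lambda>s. torus_coeff (u s) k - s *\<^sub>R z)"
      by (intro continuous_intros continuous_on_subset[OF continuous_coeff]) auto
    show "((\<lambda>s. torus_coeff (u s) k - s *\<^sub>R z) has_derivative (\<lambda>h. h *\<^sub>R (fp_coeff \<epsilon> (field s) (u s) k - z))) (at s)"
      if "0 < s" for s
    proof -
      have "((\<lambda>s. torus_coeff (u s) k - s *\<^sub>R z) has_vector_derivative (fp_coeff \<epsilon> (field s) (u s) k - 1 *\<^sub>R z)) (at s)"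
        by (intro has_vector_derivative_diff coeff_derivative that)
          (auto intro!: derivative_eq_intros)
      then show ?thesis by (simp add: has_vector_derivative_def)
    qed
  qed
  then obtain s where "0 < s" "s < t" "norm (torus_coeff (u t) k - t *\<^sub>R z - (torus_coeff f0 k - 0 *\<^sub>R z))
      \<le> norm ((t - 0) *\<^sub>R (fp_coeff \<epsilon> (field s) (u s) k - z))"
    unfolding torus_coeff_u_0 by auto
  moreover have "torus_coeff (u t) k - t *\<^sub>R z - (torus_coeff f0 k - 0 *\<^sub>R z) = torus_coeff (u t) k - torus_coeff f0 k - t *\<^sub>R z"
    by simp
  ultimately show thesis
    using that assms by (simp only: norm_scaleR diff_zero abs_of_pos)
qed

text \<open>The energy estimate replaces the norm at the intermediate time by that of the initial
  value. The bound is free of \<open>t\<close>, so over all fibres it serves as the dominating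
  function.\<close>

lemma coeff_increment_le:
  assumes t: "0 < t" and B: "\<And>z. norm (v z) \<le> B"
  shows "norm ((torus_coeff (u t) k - torus_coeff f0 k) / of_real t) \<le> fp_bound \<epsilon> B k * L2norm f0"
proof -
  obtain s where s: "0 < s"
    "norm (torus_coeff (u t) k - torus_coeff f0 k - t *\<^sub>R 0) \<le> t * norm (fp_coeff \<epsilon> (field s) (u s) k - 0)"
    using coeff_mean_value[OF t, of 0] by metis
  have "norm (fp_coeff \<epsilon> (field s) (u s) k) \<le> fp_bound \<epsilon> B k * L2norm (u s)"
    using s by (intro divergence_free_field.norm_fp_coeff_le[OF div_field] u_L2 k B) simp
  also have "\<dots> \<le> fp_bound \<epsilon> B k * L2norm f0"
  proof (rule mult_left_mono)
    have "0 \<le> B" using B norm_ge_zero order_trans by blast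
    then show "0 \<le> fp_bound \<epsilon> B k"
      by (simp add: fp_bound_def sum_nonneg)
  qed (use s L2norm_u_le in simp)
  finally show ?thesis
    using order_trans[OF s(2)] mult_left_mono[of "norm (fp_coeff \<epsilon> (field s) (u s) k)" "fp_bound \<epsilon> B k * L2norm f0" t] t
    by (simp add: norm_divide divide_le_eq mult_ac)
qed

lemma field_uniform_limit:
  assumes "0 < e"
  shows "\<forall>\<^sub>F s in at_right 0. \<forall>x\<in>cbox 0 One. norm (field s x - field 0 x) \<le> e"
proof -
  let ?h = "\<lambda>(s, x). field s x"
  let ?K = "{0..1::real} \<times> cbox (0::real^'p) One"
  have "continuous_on ?K ?h"
    unfolding split_beta
    by (intro continuous_on_compose2[OF smooth_continuous[OF smooth_v]] continuous_intros) auto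
  then have unif: "uniformly_continuous_on ?K ?h"
    by (intro compact_uniformly_continuous compact_Times compact_cbox) auto
  then obtain d where "d > 0"
    and d: "\<And>p q. p \<in> ?K \<Longrightarrow> q \<in> ?K \<Longrightarrow> dist q p < d \<Longrightarrow> dist (?h q) (?h p) < e"
    using uniformly_continuous_onE[OF unif \<open>0 < e\<close>] by blast
  have "norm (field s x - field 0 x) \<le> e" if "0 < s" "s < min 1 d" "x \<in> cbox 0 One" for s x
    using d[of "(0, x)" "(s, x)"] that by (simp add: dist_Pair_Pair dist_norm)
  then show ?thesis
    using \<open>d > 0\<close> by (intro eventually_at_rightI[of 0 "min 1 d"]) auto
qed

text \<open>Solution and field both vary with \<open>s\<close>. The product is split so that one
  part contains \<open>u s - u 0\<close>, small in norm against a bounded field, and the other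
  contains the fixed \<open>u 0\<close> against a field converging uniformly on the cube.\<close>

lemma fp_coeff_tendsto: "((\<lambda>s. fp_coeff \<epsilon> (field s) (u s) k) \<longlongrightarrow> fp_coeff \<epsilon> (field 0) (u 0) k) (at_right 0)"
proof -
  let ?V = "\<lambda>s i x. complex_of_real (field s x $ i)"
  have L2: "(\<lambda>x. f x * ?V s i x) \<in> torus_L2" if "f \<in> torus_L2" for f s i
    by (rule divergence_free_field.mult_comp_L2[OF div_field that])
  have u0: "u 0 \<in> torus_L2" by (simp add: u_L2)
  have lim: "((\<lambda>s. L2norm (\<lambda>x. u s x - u 0 x)) \<longlongrightarrow> 0) (at_right 0)"
    by (rule tendsto_within_subset[OF u_continuous]) auto
  have ev: "\<forall>\<^sub>F s in at_right 0. u s \<in> torus_L2"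
    by (auto simp: eventually_at_filter u_L2)
  have "((\<lambda>s. torus_coeff (\<lambda>x. u s x * ?V s i x) k) \<longlongrightarrow> torus_coeff (\<lambda>x. u 0 x * ?V 0 i x) k) (at_right 0)" for i
  proof -
    obtain B where B: "\<And>z. norm (v z) \<le> B"
      using continuous_periodic_bounded[OF smooth_continuous[OF smooth_v] periodic_v] by blast
    have VB: "norm (?V s i x) \<le> B" for s x
      using order_trans[OF component_le_norm_cart B, of _ i] by simp
    have "((\<lambda>s. torus_coeff (\<lambda>x. (u s x - u 0 x) * ?V s i x) k) \<longlongrightarrow> 0) (at_right 0)"
    proof (rule Lim_null_comparison)
      show "((\<lambda>s. B * L2norm (\<lambda>x. u s x - u 0 x)) \<longlongrightarrow> 0) (at_right 0)"
        using tendsto_mult_left[OF lim, of B] by simp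
      show "\<forall>\<^sub>F s in at_right 0. norm (torus_coeff (\<lambda>x. (u s x - u 0 x) * ?V s i x) k) \<le> B * L2norm (\<lambda>x. u s x - u 0 x)"
        using ev
      proof eventually_elim
        case (elim s)
        have d: "(\<lambda>x. u s x - u 0 x) \<in> torus_L2" by (rule torus_L2_diff[OF elim u0])
        show ?case
          by (rule order_trans[OF norm_torus_coeff_le[OF L2[OF d] k] L2norm_bounded_mult[OF L2[OF d] d VB]])
      qed
    qed
    moreover have "((\<lambda>s. torus_coeff (\<lambda>x. u 0 x * ?V s i x) k) \<longlongrightarrow> torus_coeff (\<lambda>x. u 0 x * ?V 0 i x) k) (at_right 0)"
    proof (rule tendstoI)
      fix e :: real assume "0 < e"
      \<comment> \<open>The summand 1 covers the case where \<open>u 0\<close> has norm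
        zero.\<close>
      define d where "d = e / (L2norm (u 0) + 1)"
      have d: "0 < d" "d * L2norm (u 0) < e"
        using \<open>0 < e\<close> L2norm_nonneg[of "u 0"] by (simp_all add: d_def field_simps)
      show "\<forall>\<^sub>F s in at_right 0. dist (torus_coeff (\<lambda>x. u 0 x * ?V s i x) k) (torus_coeff (\<lambda>x. u 0 x * ?V 0 i x) k) < e"
        using field_uniform_limit[OF d(1)]
      proof eventually_elim
        case (elim s)
        have eq: "(\<lambda>x. u 0 x * ?V s i x - u 0 x * ?V 0 i x) = (\<lambda>x. u 0 x * (?V s i x - ?V 0 i x))"
          by (simp add: right_diff_distrib)
        have dL2: "(\<lambda>x. u 0 x * (?V s i x - ?V 0 i x)) \<in> torus_L2"
          unfolding eq[symmetric] by (intro torus_L2_diff L2 u0)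
        have "norm (?V s i x - ?V 0 i x) \<le> d" if "x \<in> cbox 0 One" for x
          using elim that component_le_norm_cart[of "field s x - field 0 x" i]
          by (auto simp flip: of_real_diff intro: order_trans)
        then have "norm (torus_coeff (\<lambda>x. u 0 x * (?V s i x - ?V 0 i x)) k) \<le> d * L2norm (u 0)"
          by (intro order_trans[OF norm_torus_coeff_le[OF dL2 k]] L2norm_bounded_mult dL2 u0)
        then show ?case
          using d(2) unfolding dist_norm torus_coeff_diff[OF L2[OF u0] L2[OF u0] k, symmetric] eq by linarith
      qed
    qed
    ultimately have "((\<lambda>s. torus_coeff (\<lambda>x. (u s x - u 0 x) * ?V s i x) k + torus_coeff (\<lambda>x. u 0 x * ?V s i x) k)
        \<longlongrightarrow> 0 + torus_coeff (\<lambda>x. u 0 x * ?V 0 i x) k) (at_right 0)"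
      by (rule tendsto_add)
    moreover have "\<forall>\<^sub>F s in at_right 0. torus_coeff (\<lambda>x. (u s x - u 0 x) * ?V s i x) k + torus_coeff (\<lambda>x. u 0 x * ?V s i x) k
        = torus_coeff (\<lambda>x. u s x * ?V s i x) k"
      using ev
      by eventually_elim (simp add: torus_coeff_add[symmetric] L2 torus_L2_diff u0 k distrib_right[symmetric])
    ultimately show ?thesis
      by (simp add: tendsto_cong)
  qed
  moreover have "((\<lambda>s. torus_coeff (u s) k) \<longlongrightarrow> torus_coeff (u 0) k) (at_right 0)"
    unfolding torus_coeff_def
    by (intro tendsto_integral_mult ev u0 character_L2 lattice_point_minus k lim)
  ultimately show ?thesis
    unfolding fp_coeff_def by (intro tendsto_intros)
qed

lemma fp_coeff_u_0: "fp_coeff \<epsilon> (field 0) (u 0) k = fp_coeff \<epsilon> (field 0) f0 k"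
proof -
  have "torus_coeff (\<lambda>x. u 0 x * complex_of_real (field 0 x $ i)) k
      = torus_coeff (\<lambda>x. f0 x * complex_of_real (field 0 x $ i)) k" for i
    unfolding torus_coeff_def
  proof (rule integral_cong_AE)
    show "(\<lambda>x. u 0 x * complex_of_real (field 0 x $ i) * character (- k) x) \<in> borel_measurable torus"
      "(\<lambda>x. f0 x * complex_of_real (field 0 x $ i) * character (- k) x) \<in> borel_measurable torus"
      by (intro borel_measurable_integrable torus_L2_mult_integrable character_L2 lattice_point_minus k
          divergence_free_field.mult_comp_L2[OF div_field] u_L2 f0; simp)+
    show "AE x in torus. u 0 x * complex_of_real (field 0 x $ i) * character (- k) x
        = f0 x * complex_of_real (field 0 x $ i) * character (- k) x"
      using u_0 by eventually_elim simp
  qed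
  then show ?thesis
    by (simp add: fp_coeff_def torus_coeff_u_0)
qed

text \<open>By the mean value estimate the quotient at \<open>t\<close> is as close to the limit as
  the derivative at some time between 0 and \<open>t\<close>, and those derivatives converge by
  \<open>fp_coeff_tendsto\<close>.\<close>

lemma coeff_right_derivative:
  "((\<lambda>t. (torus_coeff (u t) k - torus_coeff f0 k) / of_real t) \<longlongrightarrow> fp_coeff \<epsilon> (\<lambda>x. v (\<theta>, x)) f0 k) (at_right 0)"
proof (rule tendstoI)
  let ?z = "fp_coeff \<epsilon> (\<lambda>x. v (\<theta>, x)) f0 k"
  fix e :: real assume "0 < e"
  have "((\<lambda>s. fp_coeff \<epsilon> (field s) (u s) k) \<longlongrightarrow> ?z) (at_right 0)"
    using fp_coeff_tendsto unfolding fp_coeff_u_0 by simp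
  then have "\<forall>\<^sub>F s in at_right 0. dist (fp_coeff \<epsilon> (field s) (u s) k) ?z < e"
    using \<open>0 < e\<close> by (rule tendstoD)
  then obtain b where "0 < b" and b: "\<And>s. 0 < s \<Longrightarrow> s < b \<Longrightarrow> dist (fp_coeff \<epsilon> (field s) (u s) k) ?z < e"
    unfolding eventually_at_right_field by auto
  have "dist ((torus_coeff (u t) k - torus_coeff f0 k) / of_real t) ?z < e" if t: "0 < t" "t < b" for t
  proof -
    obtain s where s: "0 < s" "s < t"
      "norm (torus_coeff (u t) k - torus_coeff f0 k - t *\<^sub>R ?z) \<le> t * norm (fp_coeff \<epsilon> (field s) (u s) k - ?z)"
      using coeff_mean_value[OF t(1)] by metis
    have "(torus_coeff (u t) k - torus_coeff f0 k) / of_real t - ?z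
        = (torus_coeff (u t) k - torus_coeff f0 k - t *\<^sub>R ?z) / of_real t"
      using t by (simp add: diff_divide_distrib scaleR_conv_of_real)
    then have "dist ((torus_coeff (u t) k - torus_coeff f0 k) / of_real t) ?z
        = norm (torus_coeff (u t) k - torus_coeff f0 k - t *\<^sub>R ?z) / t"
      using t by (simp add: dist_norm norm_divide)
    also have "\<dots> \<le> norm (fp_coeff \<epsilon> (field s) (u s) k - ?z)"
      using s(3) t by (simp add: divide_le_eq mult.commute)
    also have "\<dots> < e"
      using b[of s] s t by (simp add: dist_norm)
    finally show ?thesis .
  qed
  then show "\<forall>\<^sub>F t in at_right 0. dist ((torus_coeff (u t) k - torus_coeff f0 k) / of_real t) ?z < e"
    using \<open>0 < b\<close> unfolding eventually_at_right_field by blast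
qed

end

end

section \<open>Slices of functions on a product of tori\<close>

lemma sigma_finite_torus: "sigma_finite_measure torus"
  by (rule finite_measure.axioms(1)[OF finite_measure_torus])

lemma pair_sigma_finite_torus: "pair_sigma_finite torus torus"
  by (intro pair_sigma_finite.intro sigma_finite_torus)

text \<open>The third form has functions of \<open>x\<close> as values, so periodicity in
  \<open>\<theta>\<close> passes to any expression formed from a whole slice, such as a Fourier
  coefficient.\<close>

lemma torus_periodic_slice:
  fixes f :: "'a::euclidean_space \<times> 'b::euclidean_space \<Rightarrow> 'c"
  assumes "torus_periodic f"
  shows "torus_periodic (\<lambda>x. f (\<theta>, x))" "torus_periodic (\<lambda>\<theta>. f (\<theta>, x))" "torus_periodic (\<lambda>\<theta> x. f (\<theta>, x))"
proof -
  have "f ((\<theta>, x) + (0, b)) = f (\<theta>, x)" if "b \<in> Basis" for \<theta> x b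
    using assms that by (simp add: torus_periodic_def Basis_prod_def ball_Un del: add_Pair)
  then show "torus_periodic (\<lambda>x. f (\<theta>, x))"
    by (simp add: torus_periodic_def)
  have *: "f ((\<theta>, x) + (b, 0)) = f (\<theta>, x)" if "b \<in> Basis" for \<theta> x b
    using assms that by (simp add: torus_periodic_def Basis_prod_def ball_Un del: add_Pair)
  then show "torus_periodic (\<lambda>\<theta>. f (\<theta>, x))" "torus_periodic (\<lambda>\<theta> x. f (\<theta>, x))"
    by (simp_all add: torus_periodic_def)
qed

lemma measurable_slice:
  fixes f :: "'a::euclidean_space \<times> 'b::euclidean_space \<Rightarrow> 'c::topological_space"
  assumes "f \<in> borel_measurable borel"
  shows "(\<lambda>x. f (\<theta>, x)) \<in> borel_measurable borel"
  by (rule measurable_compose[OF _ assms]) (simp add: borel_prod[symmetric])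

text \<open>Measurability is stated on the whole space, not just on the cube, because slice
  integrals are later translated in \<open>\<theta>\<close>.\<close>

lemma measurable_slice_integral:
  fixes g :: "'a::euclidean_space \<times> 'b::euclidean_space \<Rightarrow> complex"
  assumes "g \<in> borel_measurable borel"
  shows "(\<lambda>\<theta>. \<integral>x. g (\<theta>, x) \<partial>torus) \<in> borel_measurable borel"
proof (rule sigma_finite_measure.borel_measurable_lebesgue_integral[OF sigma_finite_torus])
  have "snd \<in> borel_measurable (borel \<Otimes>\<^sub>M torus :: ('a \<times> 'b) measure)"
    by (rule measurable_compose[OF measurable_snd measurable_torus]) simp
  then have "(\<lambda>p. (fst p, snd p)) \<in> (borel \<Otimes>\<^sub>M torus :: ('a \<times> 'b) measure) \<rightarrow>\<^sub>M borel \<Otimes>\<^sub>M borel"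
    by (intro measurable_Pair measurable_fst)
  from measurable_compose[OF this, of g borel]
  show "case_prod (\<lambda>\<theta> x. g (\<theta>, x)) \<in> borel_measurable (borel \<Otimes>\<^sub>M (torus :: 'b measure))"
    using assms by (simp add: borel_prod)
qed

lemma
  fixes g :: "'a::euclidean_space \<times> 'b::euclidean_space \<Rightarrow> 'c::{banach, second_countable_topology}"
  assumes "integrable torus g"
  shows integral_torus_prod: "(\<integral>\<theta>. (\<integral>x. g (\<theta>, x) \<partial>torus) \<partial>torus) = (\<integral>z. g z \<partial>torus)"
    and integrable_torus_slice: "integrable torus (\<lambda>\<theta>. \<integral>x. g (\<theta>, x) \<partial>torus)"
    and AE_integrable_slice: "AE \<theta> in torus. integrable torus (\<lambda>x. g (\<theta>, x))"
proof -
  interpret pair_sigma_finite "torus :: 'a measure" "torus :: 'b measure"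
    by (rule pair_sigma_finite_torus)
  have "integrable (torus \<Otimes>\<^sub>M torus) (case_prod (\<lambda>\<theta> x. g (\<theta>, x)))"
    using assms by (simp add: torus_pair)
  from integral_fst[OF this] integrable_fst[OF this] AE_integrable_fst[OF this]
  show "(\<integral>\<theta>. (\<integral>x. g (\<theta>, x) \<partial>torus) \<partial>torus) = (\<integral>z. g z \<partial>torus)"
    "integrable torus (\<lambda>\<theta>. \<integral>x. g (\<theta>, x) \<partial>torus)" "AE \<theta> in torus. integrable torus (\<lambda>x. g (\<theta>, x))"
    by (simp_all add: torus_pair)
qed

lemma AE_slice_L2:
  fixes f :: "'a::euclidean_space \<times> 'b::euclidean_space \<Rightarrow> complex"
  assumes "f \<in> torus_L2"
  shows "AE \<theta> in torus. (\<lambda>x. f (\<theta>, x)) \<in> torus_L2"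
  using AE_integrable_slice[OF torus_L2_square_integrable[OF assms]]
  by eventually_elim (use assms in \<open>simp add: torus_L2_def torus_periodic_slice measurable_slice\<close>)

text \<open>Fubini controls the square of the slice norm. The norm is at most 1 plus its square, and
  the torus has finite measure.\<close>

lemma integrable_L2norm_slice:
  fixes f :: "'a::euclidean_space \<times> 'b::euclidean_space \<Rightarrow> complex"
  assumes "f \<in> torus_L2"
  shows "integrable torus (\<lambda>\<theta>. L2norm (\<lambda>x. f (\<theta>, x)))"
proof (rule Bochner_Integration.integrable_bound)
  have sq: "integrable torus (\<lambda>\<theta>. \<integral>x. (norm (f (\<theta>, x)))\<^sup>2 \<partial>torus)"
    by (rule integrable_torus_slice[OF torus_L2_square_integrable[OF assms]])
  then show "integrable torus (\<lambda>\<theta>. 1 + (\<integral>x. (norm (f (\<theta>, x)))\<^sup>2 \<partial>torus))"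
    by (intro Bochner_Integration.integrable_add finite_measure.integrable_const finite_measure_torus)
  show "(\<lambda>\<theta>. L2norm (\<lambda>x. f (\<theta>, x))) \<in> borel_measurable torus"
    unfolding L2norm_def using borel_measurable_integrable[OF sq] by measurable
  show "AE \<theta> in torus. norm (L2norm (\<lambda>x. f (\<theta>, x))) \<le> norm (1 + (\<integral>x. (norm (f (\<theta>, x)))\<^sup>2 \<partial>torus))"
  proof (intro always_eventually allI)
    fix \<theta>
    let ?n = "L2norm (\<lambda>x. f (\<theta>, x))"
    have "?n \<le> 1 + ?n\<^sup>2"
      using zero_le_power2[of "?n - 1"] L2norm_nonneg[of "\<lambda>x. f (\<theta>, x)"] by (simp add: power2_diff)
    then show "norm ?n \<le> norm (1 + (\<integral>x. (norm (f (\<theta>, x)))\<^sup>2 \<partial>torus))"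
      using L2norm_nonneg[of "\<lambda>x. f (\<theta>, x)"] by (simp add: L2norm_power2)
  qed
qed

lemma character_Pair: "character (a, b) (\<theta>, x) = character a \<theta> * character b x"
  by (simp add: character_def cis_mult distrib_left)

lemma lattice_point_Pair: "lattice_point (a, b) \<longleftrightarrow> lattice_point a \<and> lattice_point b"
  by (simp add: lattice_point_def Basis_prod_def ball_Un)

lemma
  assumes f: "f \<in> torus_L2" and ab: "lattice_point a" "lattice_point b"
  shows torus_coeff_Pair: "torus_coeff f (a, b) = (\<integral>\<theta>. torus_coeff (\<lambda>x. f (\<theta>, x)) b * character (- a) \<theta> \<partial>torus)"
    and integrable_coeff_slice: "integrable torus (\<lambda>\<theta>. torus_coeff (\<lambda>x. f (\<theta>, x)) b * character (- a) \<theta>)"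
    and measurable_coeff_slice: "(\<lambda>\<theta>. torus_coeff (\<lambda>x. f (\<theta>, x)) b) \<in> borel_measurable borel"
proof -
  let ?g = "\<lambda>z. f z * character (- (a, b)) z"
  have ch: "character (- (a, b)) \<in> torus_L2"
    using ab by (intro character_L2 lattice_point_minus) (simp add: lattice_point_Pair)
  have g: "integrable torus ?g"
    by (rule torus_L2_mult_integrable[OF f ch])
  have eq: "(\<integral>x. ?g (\<theta>, x) \<partial>torus) = torus_coeff (\<lambda>x. f (\<theta>, x)) b * character (- a) \<theta>" for \<theta>
  proof -
    have "(\<integral>x. ?g (\<theta>, x) \<partial>torus) = (\<integral>x. f (\<theta>, x) * character (- b) x * character (- a) \<theta> \<partial>torus)"
      by (simp add: character_Pair mult_ac)
    then show ?thesis
      by (simp add: torus_coeff_def)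
  qed
  show "torus_coeff f (a, b) = (\<integral>\<theta>. torus_coeff (\<lambda>x. f (\<theta>, x)) b * character (- a) \<theta> \<partial>torus)"
    "integrable torus (\<lambda>\<theta>. torus_coeff (\<lambda>x. f (\<theta>, x)) b * character (- a) \<theta>)"
    using integral_torus_prod[OF g] integrable_torus_slice[OF g] unfolding eq by (simp_all add: torus_coeff_def)
  have "(\<lambda>z. f z * character (0, - b) z) \<in> borel_measurable borel"
    by (intro borel_measurable_times torus_L2_measurable[OF f] measurable_character)
  from measurable_slice_integral[OF this]
  show "(\<lambda>\<theta>. torus_coeff (\<lambda>x. f (\<theta>, x)) b) \<in> borel_measurable borel"
    by (simp add: character_Pair torus_coeff_def)
qed

text \<open>Applied with \<open>s\<close> equal to \<open>t *\<^sub>R \<alpha>\<close>, the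
  translation undoes the shift in the Mather semigroup: the slice at \<open>\<theta> + s\<close> is
  the solution started on the fibre \<open>\<theta>\<close>. The price is the factor
  \<open>character (- a) s\<close>.\<close>

lemma torus_coeff_shift_slice:
  fixes a :: "'a::euclidean_space"
  assumes f: "f \<in> torus_L2" and ab: "lattice_point a" "lattice_point b"
  shows "torus_coeff f (a, b)
    = character (- a) s * (\<integral>\<theta>. torus_coeff (\<lambda>x. f (\<theta> + s, x)) b * character (- a) \<theta> \<partial>torus)"
    and "integrable torus (\<lambda>\<theta>. torus_coeff (\<lambda>x. f (\<theta> + s, x)) b * character (- a) \<theta>)"
proof -
  let ?F = "\<lambda>\<theta>. torus_coeff (\<lambda>x. f (\<theta>, x)) b * character (- a) \<theta>"
  have per: "torus_periodic ?F"
    using torus_periodic_compose[OF torus_periodic_slice(3)[OF torus_L2_periodic[OF f]], of "\<lambda>h. torus_coeff h b"]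
      torus_periodic_character[OF lattice_point_minus[OF ab(1)]]
    by (simp add: torus_periodic_def)
  have meas: "?F \<in> borel_measurable borel"
    by (intro borel_measurable_times measurable_coeff_slice[OF f ab] measurable_character)
  have "torus_coeff f (a, b) = (\<integral>\<theta>. ?F (\<theta> + s) \<partial>torus)"
    using torus_coeff_Pair[OF f ab] integral_torus_shift[OF per meas] by simp
  also have "\<dots> = (\<integral>\<theta>. character (- a) s * (torus_coeff (\<lambda>x. f (\<theta> + s, x)) b * character (- a) \<theta>) \<partial>torus)"
    by (simp add: character_shift mult_ac)
  also have "\<dots> = character (- a) s * (\<integral>\<theta>. torus_coeff (\<lambda>x. f (\<theta> + s, x)) b * character (- a) \<theta> \<partial>torus)"
    by simp
  finally show "torus_coeff f (a, b)
    = character (- a) s * (\<integral>\<theta>. torus_coeff (\<lambda>x. f (\<theta> + s, x)) b * character (- a) \<theta> \<partial>torus)" .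
  have "(\<lambda>z. f (z + (s, 0))) \<in> torus_L2"
    by (rule torus_L2_shift[OF f])
  from integrable_coeff_slice[OF this ab]
  show "integrable torus (\<lambda>\<theta>. torus_coeff (\<lambda>x. f (\<theta> + s, x)) b * character (- a) \<theta>)"
    by simp
qed

section \<open>The generator in Fourier coordinates\<close>

lemma character_exp:
  "exp (- (2 * of_real pi * \<i> * of_real (\<theta> \<bullet> a + x \<bullet> b))) = character (- (a, b)) (\<theta>, x)"
  by (simp add: character_def cis_conv_exp inner_commute algebra_simps)

lemma lattice_point_of_int_vec: "lattice_point (of_int_vec m)"
  by (auto simp: lattice_point_def Basis_vec_def inner_axis of_int_vec_def)

lemma bij_betw_of_int_vec:
  "bij_betw (\<lambda>(m, n). (of_int_vec m, of_int_vec n)) UNIV {k :: (real^'d) \<times> (real^'p). lattice_point k}"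
proof -
  have inj: "m = m'" if "of_int_vec m = (of_int_vec m' :: real^'k)" for m m' :: "int^'k"
    using that by (simp add: of_int_vec_def vec_eq_iff)
  have surj: "\<exists>m. k = of_int_vec m" if "lattice_point k" for k :: "real^'k"
  proof -
    have "k $ i \<in> \<int>" for i
      using that by (auto simp: lattice_point_def Basis_vec_def inner_axis)
    then have "k = of_int_vec (\<chi> i. \<lfloor>k $ i\<rfloor>)"
      by (simp add: of_int_vec_def vec_eq_iff of_int_floor)
    then show ?thesis by blast
  qed
  show ?thesis
    unfolding bij_betw_def
  proof
    show "inj (\<lambda>(m, n). (of_int_vec m :: real^'d, of_int_vec n :: real^'p))"
      by (rule injI) (auto dest: inj)
    show "range (\<lambda>(m, n). (of_int_vec m, of_int_vec n)) = {k :: (real^'d) \<times> (real^'p). lattice_point k}"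
    proof safe
      fix a :: "real^'d" and b :: "real^'p" assume "lattice_point (a, b)"
      then obtain m n where "a = of_int_vec m" "b = of_int_vec n"
        using surj unfolding lattice_point_Pair by metis
      then show "(a, b) \<in> range (\<lambda>(m, n). (of_int_vec m, of_int_vec n))"
        by auto
    qed (simp add: lattice_point_Pair lattice_point_of_int_vec)
  qed
qed

lemma fourier_coeff_eq:
  assumes "f \<in> torus_L2"
  shows "fourier_coeff f m n = torus_coeff f (of_int_vec m, of_int_vec n)"
proof -
  have "integrable torus (\<lambda>z. f z * character (- (of_int_vec m, of_int_vec n)) z)"
    by (intro torus_L2_mult_integrable assms character_L2 lattice_point_minus)
      (simp add: lattice_point_Pair lattice_point_of_int_vec)
  from integral_torus_prod[OF this] show ?thesis
    unfolding fourier_coeff_def character_exp torus_coeff_def by (simp only: mult.commute)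
qed

lemma velocity_L2:
  assumes "smooth v" "torus_periodic v"
  shows "(\<lambda>z. complex_of_real (v z $ i)) \<in> torus_L2"
    and "f \<in> torus_L2 \<Longrightarrow> (\<lambda>z. f z * complex_of_real (v z $ i)) \<in> torus_L2"
proof -
  obtain B where B: "\<And>z. norm (v z) \<le> B"
    using continuous_periodic_bounded[OF smooth_continuous[OF assms(1)] assms(2)] by blast
  have per: "torus_periodic (\<lambda>z. complex_of_real (v z $ i))"
    using assms(2) by (rule torus_periodic_compose)
  have meas: "(\<lambda>z. complex_of_real (v z $ i)) \<in> borel_measurable borel"
    using smooth_continuous[OF assms(1)]
    by (intro borel_measurable_continuous_onI bounded_linear.continuous_on[OF bounded_linear_component])
  have bound: "norm (complex_of_real (v z $ i)) \<le> B" for z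
    using order_trans[OF component_le_norm_cart B, of z i] by simp
  show "(\<lambda>z. complex_of_real (v z $ i)) \<in> torus_L2"
    using per meas bound by (rule torus_L2_bounded)
  show "(\<lambda>z. f z * complex_of_real (v z $ i)) \<in> torus_L2" if "f \<in> torus_L2"
    using torus_L2_bounded_mult[OF per meas bound that] by (simp add: mult.commute)
qed

lemma character_difference_quotient:
  "((\<lambda>t. (character k (t *\<^sub>R s) - 1) / of_real t) \<longlongrightarrow> 2 * of_real pi * \<i> * of_real (k \<bullet> s)) (at_right 0)"
proof -
  define z where "z = 2 * of_real pi * \<i> * of_real (k \<bullet> s)"
  have "character k (t *\<^sub>R s) = exp (z * of_real t)" for t
    by (simp add: character_def cis_conv_exp z_def mult_ac)
  moreover have "((\<lambda>w. exp (z * w)) has_field_derivative z) (at 0)"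
    by (auto intro!: derivative_eq_intros)
  then have "((\<lambda>w. (exp (z * w) - 1) / w) \<longlongrightarrow> z) (at 0)"
    by (simp add: has_field_derivative_iff)
  moreover have "filterlim (complex_of_real) (at 0) (at_right 0)"
    unfolding filterlim_at by (auto simp: eventually_at_filter intro!: tendsto_eq_intros)
  ultimately show ?thesis
    using filterlim_compose unfolding z_def[symmetric] by fastforce
qed

text \<open>The coefficients of the quotients \<open>(u t - f) / t\<close> are computed twice. Norm
  convergence gives the coefficient of \<open>g\<close>; the translated fibre integrals give the
  right-hand side. Uniqueness of limits identifies the two.\<close>

lemma generator_limit_coeff:
  fixes \<alpha> :: "real^'d" and v :: "(real^'d) \<times> (real^'p) \<Rightarrow> real^'p"
  assumes v: "smooth v" "torus_periodic v" "divergence_free_snd v"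
    and P: "solution_operator \<epsilon> \<alpha> v P"
    and gen: "generator_limit P \<alpha> f g"
    and a: "lattice_point a" and b: "lattice_point b"
  shows "torus_coeff g (a, b) =
      - of_real (1/2 * \<epsilon>\<^sup>2 * (2 * pi * norm b)\<^sup>2) * torus_coeff f (a, b)
      - 2 * of_real pi * \<i> * (\<Sum>i\<in>UNIV. of_real (b $ i) * torus_coeff (\<lambda>z. f z * of_real (v z $ i)) (a, b))
      - 2 * of_real pi * \<i> * of_real (a \<bullet> \<alpha>) * torus_coeff f (a, b)"
proof -
  obtain u where f: "f \<in> torus_L2" and g: "g \<in> torus_L2"
    and u: "\<And>t. 0 < t \<Longrightarrow> mather P \<alpha> t f (u t)"
    and lim: "((\<lambda>t. L2norm (\<lambda>z. (u t z - f z) / of_real t - g z)) \<longlongrightarrow> 0) (at_right 0)"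
    using gen unfolding generator_limit_def by blast
  have uL2: "u t \<in> torus_L2" if "0 < t" for t
    using u[OF that] by (simp add: mather_def)
  obtain B where B: "\<And>z. norm (v z) \<le> B"
    using continuous_periodic_bounded[OF smooth_continuous[OF v(1)] v(2)] by blast
  have fv: "(\<lambda>z. f z * of_real (v z $ i)) \<in> torus_L2" for i
    by (rule velocity_L2(2)[OF v(1,2) f])
  have ab: "lattice_point (a, b)" using a b by (simp add: lattice_point_Pair)
  let ?F = "\<lambda>\<theta> x. f (\<theta>, x)"
  let ?\<chi> = "character (- a)"
  \<comment> \<open>A sequence of times instead of all small \<open>t\<close>: only countably many
    exceptional null sets in \<open>\<theta>\<close> have to be united, and dominated convergence is
    stated for sequences.\<close>
  define X where "X k = 1 / real (Suc k)" for k
  have X_pos: "0 < X k" for k by (simp add: X_def)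
  have X_lim: "filterlim X (at_right 0) sequentially"
    unfolding X_def filterlim_at
    using LIMSEQ_inverse_real_of_nat by (auto simp: inverse_eq_divide)
  \<comment> \<open>Formed from \<open>u t\<close>, which is Borel on the product; for
    \<open>P\<close> no measurability in \<open>\<theta>\<close> is given. The two agree for almost
    every \<open>\<theta>\<close>, separately for each positive \<open>t\<close>.\<close>
  define h where "h t \<theta> = torus_coeff (\<lambda>x. u t (\<theta> + t *\<^sub>R \<alpha>, x)) b" for t \<theta>
  define h0 where "h0 \<theta> = torus_coeff (?F \<theta>) b" for \<theta>
  define s where "s k \<theta> = (h (X k) \<theta> - h0 \<theta>) / of_real (X k) * ?\<chi> \<theta>" for k \<theta>
  define l where "l \<theta> = fp_coeff \<epsilon> (\<lambda>x. v (\<theta>, x)) (?F \<theta>) b * ?\<chi> \<theta>" for \<theta>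
  have per_P: "torus_periodic P"
    using P by (simp add: solution_operator_def)
  have sol: "fp_solution \<epsilon> \<alpha> v \<theta> (?F \<theta>) (\<lambda>t. P \<theta> t (?F \<theta>))" if "?F \<theta> \<in> torus_L2" for \<theta>
    using P that v by (simp add: fp_solution_def solution_operator_def)
  have h_eq: "AE \<theta> in torus. h t \<theta> = torus_coeff (P \<theta> t (?F \<theta>)) b" if t: "0 < t" for t
  proof -
    have per_u: "torus_periodic (\<lambda>\<theta> x. u t (\<theta>, x))"
      by (rule torus_periodic_slice(3)[OF torus_L2_periodic[OF uL2[OF t]]])
    have per_f: "torus_periodic ?F"
      by (rule torus_periodic_slice(3)[OF torus_L2_periodic[OF f]])
    \<comment> \<open>Periodic in \<open>\<theta>\<close> because \<open>u t\<close>,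
      \<open>f\<close> and \<open>P\<close> all are. This allows the almost everywhere statement to
      be translated by \<open>t *\<^sub>R \<alpha>\<close>, after which \<open>P\<close> and the
      slice of \<open>f\<close> stand at \<open>\<theta>\<close> itself.\<close>
    let ?Q = "\<lambda>\<theta>. AE x in torus. u t (\<theta>, x) = P (\<theta> - t *\<^sub>R \<alpha>) t (?F (\<theta> - t *\<^sub>R \<alpha>)) x"
    have "torus_periodic (\<lambda>\<theta>. P (\<theta> - t *\<^sub>R \<alpha>))" "torus_periodic (\<lambda>\<theta>. ?F (\<theta> - t *\<^sub>R \<alpha>))"
      using torus_periodic_shift[OF per_P, of "- t *\<^sub>R \<alpha>"] torus_periodic_shift[OF per_f, of "- t *\<^sub>R \<alpha>"]
      by simp_all
    then have "torus_periodic ?Q"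
      using per_u unfolding torus_periodic_def by (auto simp: fun_eq_iff)
    moreover have "AE \<theta> in torus. ?Q \<theta>"
      using u[OF t] by (simp add: mather_def)
    ultimately have "AE \<theta> in torus. ?Q (\<theta> + t *\<^sub>R \<alpha>)"
      by (rule AE_torus_shift)
    then show ?thesis
      using AE_slice_L2[OF f]
    proof eventually_elim
      case (elim \<theta>)
      interpret fp_solution \<epsilon> \<alpha> v \<theta> "?F \<theta>" "\<lambda>t. P \<theta> t (?F \<theta>)"
        by (rule sol[OF elim(2)])
      show ?case
        unfolding h_def torus_coeff_def
      proof (rule integral_cong_AE)
        show "(\<lambda>x. u t (\<theta> + t *\<^sub>R \<alpha>, x) * character (- b) x) \<in> borel_measurable torus"
          by (intro measurable_torus borel_measurable_times measurable_slice torus_L2_measurable uL2 t measurable_character)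
        show "(\<lambda>x. P \<theta> t (?F \<theta>) x * character (- b) x) \<in> borel_measurable torus"
          using t by (intro measurable_torus borel_measurable_times torus_L2_measurable u_L2 measurable_character) simp
        show "AE x in torus. u t (\<theta> + t *\<^sub>R \<alpha>, x) * character (- b) x = P \<theta> t (?F \<theta>) x * character (- b) x"
          using elim(1) by eventually_elim simp
      qed
    qed
  qed
  have h_int: "integrable torus (\<lambda>\<theta>. h t \<theta> * ?\<chi> \<theta>)"
    and u_coeff: "torus_coeff (u t) (a, b) = ?\<chi> (t *\<^sub>R \<alpha>) * (\<integral>\<theta>. h t \<theta> * ?\<chi> \<theta> \<partial>torus)" if "0 < t" for t
    using torus_coeff_shift_slice[OF uL2[OF that] a b] unfolding h_def by blast+
  have h0_int: "integrable torus (\<lambda>\<theta>. h0 \<theta> * ?\<chi> \<theta>)"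
    and f_coeff: "torus_coeff f (a, b) = (\<integral>\<theta>. h0 \<theta> * ?\<chi> \<theta> \<partial>torus)"
    unfolding h0_def by (rule integrable_coeff_slice[OF f a b], rule torus_coeff_Pair[OF f a b])
  have s_eq: "s k = (\<lambda>\<theta>. (h (X k) \<theta> * ?\<chi> \<theta> - h0 \<theta> * ?\<chi> \<theta>) / of_real (X k))" for k
    by (simp add: s_def fun_eq_iff left_diff_distrib)
  have s_int: "integrable torus (s k)" for k
    unfolding s_eq by (intro integrable_divide_zero Bochner_Integration.integrable_diff h_int h0_int X_pos)
  have s_integral: "(\<integral>\<theta>. s k \<theta> \<partial>torus)
      = ((\<integral>\<theta>. h (X k) \<theta> * ?\<chi> \<theta> \<partial>torus) - torus_coeff f (a, b)) / of_real (X k)" for k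
    unfolding s_eq f_coeff integral_divide_zero
    by (subst Bochner_Integration.integral_diff[OF h_int[OF X_pos] h0_int]) simp
  define A where "A i \<theta> = torus_coeff (\<lambda>x. f (\<theta>, x) * of_real (v (\<theta>, x) $ i)) b * ?\<chi> \<theta>" for i \<theta>
  have A: "integrable torus (A i)" "(\<integral>\<theta>. A i \<theta> \<partial>torus) = torus_coeff (\<lambda>z. f z * of_real (v z $ i)) (a, b)" for i
    unfolding A_def
    by (rule integrable_coeff_slice[OF fv a b], rule torus_coeff_Pair[OF fv a b, symmetric])
  have l_eq: "l = (\<lambda>\<theta>. - of_real (1/2 * \<epsilon>\<^sup>2 * (2 * pi * norm b)\<^sup>2) * (h0 \<theta> * ?\<chi> \<theta>)
      - 2 * of_real pi * \<i> * (\<Sum>i\<in>UNIV. of_real (b $ i) * A i \<theta>))"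
    unfolding l_def fp_coeff_def h0_def A_def
    by (simp add: fun_eq_iff left_diff_distrib sum_distrib_right mult.assoc)
  have sum_int: "integrable torus (\<lambda>\<theta>. \<Sum>i\<in>UNIV. complex_of_real (b $ i) * A i \<theta>)"
    by (intro Bochner_Integration.integrable_sum integrable_mult_right A)
  have l_int: "integrable torus l"
    unfolding l_eq
    by (intro Bochner_Integration.integrable_diff integrable_mult_right h0_int sum_int)
  have l_integral: "(\<integral>\<theta>. l \<theta> \<partial>torus) = - of_real (1/2 * \<epsilon>\<^sup>2 * (2 * pi * norm b)\<^sup>2) * torus_coeff f (a, b)
      - 2 * of_real pi * \<i> * (\<Sum>i\<in>UNIV. of_real (b $ i) * torus_coeff (\<lambda>z. f z * of_real (v z $ i)) (a, b))"
    unfolding l_eq f_coeff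
    using A h0_int sum_int
    by (subst Bochner_Integration.integral_diff) (auto simp: Bochner_Integration.integral_sum)
  have AE_h: "AE \<theta> in torus. \<forall>k. h (X k) \<theta> = torus_coeff (P \<theta> (X k) (?F \<theta>)) b"
    unfolding AE_all_countable using h_eq X_pos by blast
  have "(\<lambda>k. \<integral>\<theta>. s k \<theta> \<partial>torus) \<longlonglongrightarrow> (\<integral>\<theta>. l \<theta> \<partial>torus)"
  proof (rule integral_dominated_convergence[where w = "\<lambda>\<theta>. fp_bound \<epsilon> B b * L2norm (?F \<theta>)"])
    show "l \<in> borel_measurable torus" "s k \<in> borel_measurable torus" for k
      by (intro borel_measurable_integrable l_int s_int)+
    show "integrable torus (\<lambda>\<theta>. fp_bound \<epsilon> B b * L2norm (?F \<theta>))"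
      by (intro integrable_mult_right integrable_L2norm_slice f)
    show "AE \<theta> in torus. (\<lambda>k. s k \<theta>) \<longlonglongrightarrow> l \<theta>"
      using AE_h AE_slice_L2[OF f]
    proof eventually_elim
      case (elim \<theta>)
      interpret fp_solution \<epsilon> \<alpha> v \<theta> "?F \<theta>" "\<lambda>t. P \<theta> t (?F \<theta>)"
        by (rule sol[OF elim(2)])
      have "(\<lambda>k. (h (X k) \<theta> - h0 \<theta>) / of_real (X k)) \<longlonglongrightarrow> fp_coeff \<epsilon> (\<lambda>x. v (\<theta>, x)) (?F \<theta>) b"
        using filterlim_compose[OF coeff_right_derivative[OF b] X_lim] elim(1)
        by (simp add: h0_def)
      then show ?case
        unfolding s_def l_def by (intro tendsto_intros)
    qed
    show "AE \<theta> in torus. norm (s k \<theta>) \<le> fp_bound \<epsilon> B b * L2norm (?F \<theta>)" for k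
      using AE_h AE_slice_L2[OF f]
    proof eventually_elim
      case (elim \<theta>)
      interpret fp_solution \<epsilon> \<alpha> v \<theta> "?F \<theta>" "\<lambda>t. P \<theta> t (?F \<theta>)"
        by (rule sol[OF elim(2)])
      show ?case
        using coeff_increment_le[OF b X_pos[of k] B] elim(1)
        by (simp add: s_def h0_def norm_mult norm_divide)
    qed
  qed
  moreover have "(\<lambda>k. ?\<chi> (X k *\<^sub>R \<alpha>)) \<longlonglongrightarrow> ?\<chi> (0 *\<^sub>R \<alpha>)"
    using X_lim by (intro continuous_on_tendsto_compose[OF continuous_character[of UNIV]] tendsto_intros)
      (auto simp: filterlim_at)
  moreover have "(\<lambda>k. (?\<chi> (X k *\<^sub>R \<alpha>) - 1) / of_real (X k)) \<longlonglongrightarrow> 2 * of_real pi * \<i> * of_real (- a \<bullet> \<alpha>)"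
    by (rule filterlim_compose[OF character_difference_quotient X_lim])
  \<comment> \<open>A product rule for the factor \<open>?\<chi> (X k *\<^sub>R \<alpha>)\<close>
    times the fibre integral. Differentiating the character yields the transport term; its sign
    comes from the frequency \<open>- a\<close>.\<close>
  ultimately have "(\<lambda>k. ?\<chi> (X k *\<^sub>R \<alpha>) * (\<integral>\<theta>. s k \<theta> \<partial>torus)
        + (?\<chi> (X k *\<^sub>R \<alpha>) - 1) / of_real (X k) * torus_coeff f (a, b))
      \<longlonglongrightarrow> ?\<chi> (0 *\<^sub>R \<alpha>) * (\<integral>\<theta>. l \<theta> \<partial>torus)
        + 2 * of_real pi * \<i> * of_real (- a \<bullet> \<alpha>) * torus_coeff f (a, b)"
    by (intro tendsto_intros)
  moreover have "?\<chi> (X k *\<^sub>R \<alpha>) * (\<integral>\<theta>. s k \<theta> \<partial>torus) + (?\<chi> (X k *\<^sub>R \<alpha>) - 1) / of_real (X k) * torus_coeff f (a, b)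
      = (torus_coeff (u (X k)) (a, b) - torus_coeff f (a, b)) / of_real (X k)" for k
    unfolding s_integral u_coeff[OF X_pos] using X_pos[of k] by (simp add: field_simps)
  ultimately have lim1: "(\<lambda>k. (torus_coeff (u (X k)) (a, b) - torus_coeff f (a, b)) / of_real (X k))
      \<longlonglongrightarrow> (\<integral>\<theta>. l \<theta> \<partial>torus) + 2 * of_real pi * \<i> * of_real (- a \<bullet> \<alpha>) * torus_coeff f (a, b)"
    by (simp add: character_def[of _ 0])
  have quot: "(\<lambda>z. (u t z - f z) / of_real t) \<in> torus_L2"
    and quot_coeff: "torus_coeff (\<lambda>z. (u t z - f z) / of_real t) (a, b)
      = (torus_coeff (u t) (a, b) - torus_coeff f (a, b)) / of_real t" if "0 < t" for t
    using torus_L2_cmult[OF torus_L2_diff[OF uL2[OF that] f], of "1 / of_real t"]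
      torus_coeff_cmult[of "1 / of_real t" "\<lambda>z. u t z - f z" "(a, b)"]
    by (simp_all add: torus_coeff_diff[OF uL2[OF that] f ab])
  have "\<forall>\<^sub>F t in at_right 0. (\<lambda>z. (u t z - f z) / of_real t) \<in> torus_L2"
    by (auto simp: eventually_at_filter quot)
  then have "((\<lambda>t. torus_coeff (\<lambda>z. (u t z - f z) / of_real t) (a, b)) \<longlongrightarrow> torus_coeff g (a, b)) (at_right 0)"
    unfolding torus_coeff_def
    by (rule tendsto_integral_mult[OF _ g character_L2[OF lattice_point_minus[OF ab]] lim])
  from filterlim_compose[OF this X_lim]
  have lim2: "(\<lambda>k. (torus_coeff (u (X k)) (a, b) - torus_coeff f (a, b)) / of_real (X k)) \<longlonglongrightarrow> torus_coeff g (a, b)"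
    by (simp add: quot_coeff X_pos)
  show ?thesis
    using LIMSEQ_unique[OF lim2 lim1] unfolding l_integral by simp
qed

text \<open>Parseval for \<open>f\<close> and \<open>w\<close> times \<open>character (- k)\<close>;
  the character shifts the frequency \<open>- l\<close> of the second factor to
  \<open>k - l\<close>.\<close>

lemma product_coeff_has_sum:
  assumes f: "f \<in> torus_L2" and w: "w \<in> torus_L2" and fw: "(\<lambda>z. w z * character (- k) z) \<in> torus_L2"
  shows "((\<lambda>l. torus_coeff f l * torus_coeff w (k - l)) has_sum torus_coeff (\<lambda>z. f z * w z) k) {l. lattice_point l}"
proof -
  have "torus_coeff (\<lambda>z. w z * character (- k) z) (- l) = torus_coeff w (k - l)" for l
    by (simp add: torus_coeff_def mult.assoc character_mult)
  then show ?thesis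
    using parseval[OF f fw] by (simp add: torus_coeff_def[of "\<lambda>z. f z * w z"] mult.assoc)
qed

theorem proposition5p2:
  fixes \<alpha> :: "real^'d" and \<epsilon> :: real
    and v :: "(real^'d) \<times> (real^'p) \<Rightarrow> real^'p"
    and P :: "real^'d \<Rightarrow> real \<Rightarrow> (real^'p \<Rightarrow> complex) \<Rightarrow> (real^'p \<Rightarrow> complex)"
    and f :: "(real^'d) \<times> (real^'p) \<Rightarrow> complex"
  assumes "rationally_independent \<alpha>"
    and "\<epsilon> > 0"
    and "smooth v" and "torus_periodic v" and "divergence_free_snd v"
    and "solution_operator \<epsilon> \<alpha> v P"
    and "f \<in> generator_domain P \<alpha>"
  shows "\<forall>m n. ((\<lambda>(m', n'). Gamma_matrix \<epsilon> \<alpha> v (m, n) (m', n') * fourier_coeff f m' n')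
           has_sum fourier_coeff (generator P \<alpha> f) m n) UNIV"
proof (intro allI)
  fix m :: "int^'d" and n :: "int^'p"
  define a where "a = (of_int_vec m :: real^'d)"
  define b where "b = (of_int_vec n :: real^'p)"
  let ?g = "generator P \<alpha> f"
  let ?j = "\<lambda>(m', n'). (of_int_vec m' :: real^'d, of_int_vec n' :: real^'p)"
  let ?V = "\<lambda>i z. complex_of_real (v z $ i)"
  \<comment> \<open>Membership in the domain makes the choice meaningful. By
    \<open>generator_limit_coeff\<close> every possible choice has the same Fourier
    coefficients.\<close>
  have gen: "generator_limit P \<alpha> f ?g"
    using assms(7) unfolding generator_domain_def generator_def by (auto intro: someI_ex[of "generator_limit P \<alpha> f"])
  then have f: "f \<in> torus_L2" and g: "?g \<in> torus_L2"
    by (simp_all add: generator_limit_def)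
  have ab: "lattice_point a" "lattice_point b"
    by (simp_all add: a_def b_def lattice_point_of_int_vec)
  have diff: "of_int_vec (x - y) = of_int_vec x - (of_int_vec y :: real^'k)" for x y :: "int^'k"
    by (simp add: of_int_vec_def vec_eq_iff)
  have zero: "of_int_vec 0 = (0 :: real^'k)"
    by (simp add: of_int_vec_def vec_eq_iff)
  have V_coeff: "fourier_coeff_vec v m' n' $ i = torus_coeff (?V i) (of_int_vec m', of_int_vec n')" for m' n' i
    by (simp add: fourier_coeff_vec_def fourier_coeff_eq[OF velocity_L2(1)[OF assms(3,4)]])
  define z where "z = - of_real (1/2 * \<epsilon>\<^sup>2 * (2 * pi * norm b)\<^sup>2) - 2 * of_real pi * \<i> * of_real (a \<bullet> \<alpha>)"
  \<comment> \<open>The mean velocity in the diagonal entry is the off-diagonal formula at frequency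
    difference 0. Both cases thus share one convolution kernel, and only \<open>z\<close> remains on
    the diagonal.\<close>
  have Gamma: "Gamma_matrix \<epsilon> \<alpha> v (m, n) (m', n') =
      (if (m', n') = (m, n) then z else 0)
      + (- 2 * of_real pi * \<i>) * (\<Sum>i\<in>UNIV. of_real (b $ i) * torus_coeff (?V i) ((a, b) - ?j (m', n')))" for m' n'
    by (auto simp: Gamma_matrix_def int_dot_def V_coeff z_def diff zero a_def b_def of_int_vec_def[of n] zero_prod_def algebra_simps)
  have drift: "((\<lambda>x. torus_coeff f (?j x) * torus_coeff (?V i) ((a, b) - ?j x))
      has_sum torus_coeff (\<lambda>z. f z * ?V i z) (a, b)) UNIV" for i
  proof -
    have ch: "character (- (a, b)) \<in> torus_L2"
      using ab by (intro character_L2 lattice_point_minus) (simp add: lattice_point_Pair)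
    have "((\<lambda>l. torus_coeff f l * torus_coeff (?V i) ((a, b) - l)) has_sum torus_coeff (\<lambda>z. f z * ?V i z) (a, b))
        {l. lattice_point l}"
      using velocity_L2(2)[OF assms(3,4) ch, of i]
      by (intro product_coeff_has_sum f velocity_L2(1)[OF assms(3,4)]) (simp add: mult.commute)
    then show ?thesis
      by (subst has_sum_reindex_bij_betw[OF bij_betw_of_int_vec])
  qed
  \<comment> \<open>The diagonal part lives on a single index. The drift is a finite sum over
    components, so the convolution sums may be added up inside the sum over frequencies.\<close>
  have total: "((\<lambda>x. (if x = (m, n) then z * torus_coeff f (a, b) else 0)
      + (- 2 * of_real pi * \<i>) * (\<Sum>i\<in>UNIV. of_real (b $ i) * (torus_coeff f (?j x) * torus_coeff (?V i) ((a, b) - ?j x))))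
      has_sum z * torus_coeff f (a, b)
        + (- 2 * of_real pi * \<i>) * (\<Sum>i\<in>UNIV. of_real (b $ i) * torus_coeff (\<lambda>z. f z * ?V i z) (a, b))) UNIV"
    by (intro has_sum_add has_sum_cmult_right has_sum_sum drift has_sum_finite_neutralI[of "{(m, n)}"]) auto
  have pull: "(\<Sum>i\<in>UNIV. c i * (d * e i)) = d * (\<Sum>i\<in>UNIV. c i * e i)"
    for c e :: "'p \<Rightarrow> complex" and d
    by (simp add: sum_distrib_left mult_ac)
  have terms: "(case x of (m', n') \<Rightarrow> Gamma_matrix \<epsilon> \<alpha> v (m, n) (m', n') * fourier_coeff f m' n')
      = (if x = (m, n) then z * torus_coeff f (a, b) else 0)
      + (- 2 * of_real pi * \<i>) * (\<Sum>i\<in>UNIV. of_real (b $ i) * (torus_coeff f (?j x) * torus_coeff (?V i) ((a, b) - ?j x)))" for x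
    by (cases x) (simp add: Gamma fourier_coeff_eq[OF f] pull a_def b_def algebra_simps)
  have "fourier_coeff ?g m n = z * torus_coeff f (a, b)
      + (- 2 * of_real pi * \<i>) * (\<Sum>i\<in>UNIV. of_real (b $ i) * torus_coeff (\<lambda>z. f z * ?V i z) (a, b))"
    unfolding fourier_coeff_eq[OF g] a_def[symmetric] b_def[symmetric]
      generator_limit_coeff[OF assms(3-6) gen ab] z_def
    by (simp add: algebra_simps)
  then show "((\<lambda>(m', n'). Gamma_matrix \<epsilon> \<alpha> v (m, n) (m', n') * fourier_coeff f m' n') has_sum fourier_coeff ?g m n) UNIV"
    using iffD2[OF has_sum_cong[OF terms] total] by simp
qed

end
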